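(* Let $S\subseteq \mathbb P^r$ be a reduced, irreducible and projective surface, of degree $s$ and sectional genus $\pi$. Let $C\subset S$ be a curve of degree $d>0$. Then $$p_a(C)\leq \frac{d^2}{2s}+\frac{d}{2s}(2\pi-2-s)+s^4.$$
   Context: The base field is $\mathbb C$. A curve is a projective scheme of dimension $1$ (not necessarily reduced, irreducible, or Cohen-Macaulay); here $C$ is a closed subscheme of $S$. The arithmetic genus is $p_a(C)=1-\chi(\mathcal O_C)$. Degrees are taken with respect to the given embedding in $\mathbb P^r$. The sectional genus of $S$ is the arithmetic genus of the integral curve $S\cap H$, where $H\subseteq\mathbb P^r$ is a general hyperplane. *)

theory Defs
  imports
    Complex_Main
    "HOL-Library.Poly_Mapping"
    "HOL-Library.Extended_Nat"
    "HOL-Library.Function_Algebras"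
    "HOL-Computational_Algebra.Polynomial"
    "HOL-Algebra.Ideal"
begin

section \<open>Graded polynomial rings\<close>

text \<open>
  Polynomials and Laurent polynomials over the complex numbers in the variables
  \<open>x\<^sub>0, x\<^sub>1, x\<^sub>2, \<dots>\<close>.  Both types carry the convolution product.
\<close>

type_synonym cpoly = "(nat \<Rightarrow>\<^sub>0 nat) \<Rightarrow>\<^sub>0 complex"
type_synonym claurent = "(nat \<Rightarrow>\<^sub>0 int) \<Rightarrow>\<^sub>0 complex"

definition var :: "nat \<Rightarrow> cpoly" where
  "var i = Poly_Mapping.single (Poly_Mapping.single i 1) 1"

definition smul :: "complex \<Rightarrow> ('m::comm_monoid_add \<Rightarrow>\<^sub>0 complex) \<Rightarrow> ('m \<Rightarrow>\<^sub>0 complex)" where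
  "smul a f = Poly_Mapping.single 0 a * f"

definition mon_deg :: "(nat \<Rightarrow>\<^sub>0 'a::comm_monoid_add) \<Rightarrow> 'a" where
  "mon_deg m = (\<Sum>i\<in>Poly_Mapping.keys m. Poly_Mapping.lookup m i)"

definition homog :: "'a \<Rightarrow> ((nat \<Rightarrow>\<^sub>0 'a::comm_monoid_add) \<Rightarrow>\<^sub>0 complex) set" where
  "homog t = {f. \<forall>m\<in>Poly_Mapping.keys f. mon_deg m = t}"

definition homog_component :: "nat \<Rightarrow> cpoly \<Rightarrow> cpoly" where
  "homog_component t f =
     (\<Sum>m | m \<in> Poly_Mapping.keys f \<and> mon_deg m = t.
        Poly_Mapping.single m (Poly_Mapping.lookup f m))"

definition eval_poly :: "(nat \<Rightarrow> complex) \<Rightarrow> cpoly \<Rightarrow> complex" where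
  "eval_poly a f =
     (\<Sum>m\<in>Poly_Mapping.keys f.
        Poly_Mapping.lookup f m * (\<Prod>i\<in>Poly_Mapping.keys m. a i ^ Poly_Mapping.lookup m i))"

text \<open>The homogeneous coordinate ring of \<open>\<P>\<^sup>r\<close>, in the variables \<open>x\<^sub>0, \<dots>, x\<^sub>r\<close>.\<close>

definition coord_ring :: "nat \<Rightarrow> cpoly ring" where
  "coord_ring r =
     \<lparr>carrier = {f. \<forall>m\<in>Poly_Mapping.keys f. Poly_Mapping.keys m \<subseteq> {..r}},
      monoid.mult = (*), one = 1, zero = 0, add = (+)\<rparr>"


section \<open>Closed subschemes of projective space\<close>

text \<open>
  A closed subscheme \<open>X\<close> of \<open>\<P>\<^sup>r\<close> is represented by its saturated homogeneous ideal
  \<open>I\<^sub>X = (\<Oplus>t. H\<^sup>0(\<I>\<^sub>X(t)))\<close>.  This is a bijection, it reverses inclusions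
  (\<open>X \<subseteq> Y\<close> iff \<open>I\<^sub>Y \<subseteq> I\<^sub>X\<close>), and the empty scheme corresponds to the whole ring.
\<close>

definition homogeneous_ideal :: "nat \<Rightarrow> cpoly set \<Rightarrow> bool" where
  "homogeneous_ideal r I \<longleftrightarrow>
     ideal I (coord_ring r) \<and> (\<forall>f\<in>I. \<forall>t. homog_component t f \<in> I)"

definition saturation :: "nat \<Rightarrow> cpoly set \<Rightarrow> cpoly set" where
  "saturation r I =
     {f \<in> carrier (coord_ring r). \<exists>k. \<forall>i\<le>r. var i ^ k * f \<in> I}"

definition closed_subscheme :: "nat \<Rightarrow> cpoly set \<Rightarrow> bool" where
  "closed_subscheme r I \<longleftrightarrow> homogeneous_ideal r I \<and> saturation r I = I"

text \<open>
  A subscheme is integral, i.e. reduced and irreducible (and nonempty), iff its saturated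
  ideal is prime.  The irrelevant ideal is prime but not saturated, so it does not occur here.
\<close>

definition integral_subscheme :: "nat \<Rightarrow> cpoly set \<Rightarrow> bool" where
  "integral_subscheme r I \<longleftrightarrow> closed_subscheme r I \<and> primeideal I (coord_ring r)"

text \<open>
  Krull dimension: integral closed subschemes of \<open>X\<close> are the irreducible closed subsets of the
  underlying space of \<open>X\<close>.  (The empty scheme gets dimension \<open>0\<close>.)
\<close>

definition subscheme_dim :: "nat \<Rightarrow> cpoly set \<Rightarrow> enat" where
  "subscheme_dim r I =
     Sup {enat n | n. \<exists>P :: nat \<Rightarrow> cpoly set.
            (\<forall>i\<le>n. integral_subscheme r (P i) \<and> I \<subseteq> P i) \<and> (\<forall>i<n. P i \<subset> P (Suc i))}"

text \<open>The scheme-theoretic intersection with the hypersurface \<open>h = 0\<close>.\<close>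

definition hypersurface_section :: "nat \<Rightarrow> cpoly set \<Rightarrow> cpoly \<Rightarrow> cpoly set" where
  "hypersurface_section r I h =
     saturation r (I <+>\<^bsub>coord_ring r\<^esub> PIdl\<^bsub>coord_ring r\<^esub> h)"


section \<open>Degree\<close>

text \<open>
  The dimension of the quotient \<open>V / W\<close> of complex vector spaces \<open>W \<subseteq> V\<close>, if finite:
  the classes of the elements of \<open>X\<close> form a basis of \<open>V / W\<close>.
\<close>

definition quot_dim ::
  "(complex \<Rightarrow> 'v::ab_group_add \<Rightarrow> 'v) \<Rightarrow> 'v set \<Rightarrow> 'v set \<Rightarrow> nat" where
  "quot_dim scale V W =
     (THE n. \<exists>X. finite X \<and> X \<subseteq> V \<and> card X = n \<and>
        (\<forall>v\<in>V. \<exists>!c. c \<in> extensional X \<and> v - (\<Sum>x\<in>X. scale (c x) x) \<in> W))"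

definition hilbert_function :: "nat \<Rightarrow> cpoly set \<Rightarrow> nat \<Rightarrow> nat" where
  "hilbert_function r I t =
     quot_dim smul (carrier (coord_ring r) \<inter> homog t) (I \<inter> homog t)"

definition hilbert_polynomial :: "nat \<Rightarrow> cpoly set \<Rightarrow> real poly" where
  "hilbert_polynomial r I =
     (THE P. \<forall>\<^sub>F t in sequentially. poly P (real t) = real (hilbert_function r I t))"

text \<open>
  The degree in \<open>\<P>\<^sup>r\<close> is \<open>n!\<close> times the leading coefficient of the Hilbert polynomial, whose
  degree \<open>n\<close> is the dimension.
\<close>

definition subscheme_degree :: "nat \<Rightarrow> cpoly set \<Rightarrow> real" where
  "subscheme_degree r I =
     fact (degree (hilbert_polynomial r I)) * lead_coeff (hilbert_polynomial r I)"


section \<open>Euler characteristic and arithmetic genus\<close>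

text \<open>
  Cohomology of the structure sheaf is computed by the alternating Cech complex of the
  standard affine cover \<open>U\<^sub>i = {x\<^sub>i \<noteq> 0}\<close>, \<open>i = 0, \<dots>, r\<close>.  Write \<open>R\<close> for the coordinate ring
  and \<open>x\<^sub>J\<close> for the product of the \<open>x\<^sub>j\<close>, \<open>j \<in> J\<close>.  The sections of the structure sheaf of \<open>X\<close>
  over the intersection \<open>U\<^sub>J\<close> of the \<open>U\<^sub>j\<close> form the quotient of the degree \<open>0\<close> part of the
  localization of \<open>R\<close> at \<open>x\<^sub>J\<close> by that of \<open>I\<close>; both are realized as sets of Laurent polynomials.
\<close>

definition laurent_of :: "cpoly \<Rightarrow> claurent" where
  "laurent_of f =
     (\<Sum>m\<in>Poly_Mapping.keys f.
        Poly_Mapping.single (Poly_Mapping.map int m) (Poly_Mapping.lookup f m))"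

definition localization0 :: "cpoly set \<Rightarrow> nat set \<Rightarrow> claurent set" where
  "localization0 I J =
     {f \<in> homog 0. \<exists>k. \<exists>p\<in>I. f * laurent_of ((\<Prod>j\<in>J. var j) ^ k) = laurent_of p}"

text \<open>
  A \<open>p\<close>-cochain assigns to each \<open>J = {j\<^sub>0 < \<dots> < j\<^sub>p}\<close> a Laurent polynomial; it is set to \<open>0\<close> at all
  other arguments.  The cochains with values in \<open>\<O>\<^sub>X\<close> are those with values in \<open>R\<close> modulo those
  with values in \<open>I\<close>, and accordingly cocycles and coboundaries are taken modulo the latter.
\<close>

definition cochains :: "nat \<Rightarrow> cpoly set \<Rightarrow> nat \<Rightarrow> (nat set \<Rightarrow> claurent) set" where
  "cochains r I p =
     {c. \<forall>J. if J \<subseteq> {..r} \<and> card J = Suc p then c J \<in> localization0 I J else c J = 0}"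

definition coboundary :: "nat \<Rightarrow> (nat set \<Rightarrow> claurent) \<Rightarrow> nat set \<Rightarrow> claurent" where
  "coboundary r c K =
     (if K \<subseteq> {..r} then \<Sum>j\<in>K. (-1) ^ card {i\<in>K. i < j} * c (K - {j}) else 0)"

definition cech_cocycles :: "nat \<Rightarrow> cpoly set \<Rightarrow> nat \<Rightarrow> (nat set \<Rightarrow> claurent) set" where
  "cech_cocycles r I p =
     {c \<in> cochains r (carrier (coord_ring r)) p. coboundary r c \<in> cochains r I (Suc p)}"

definition cech_coboundaries :: "nat \<Rightarrow> cpoly set \<Rightarrow> nat \<Rightarrow> (nat set \<Rightarrow> claurent) set" where
  "cech_coboundaries r I p =
     {coboundary r b + e | b e.
        b \<in> (case p of 0 \<Rightarrow> {0} | Suc q \<Rightarrow> cochains r (carrier (coord_ring r)) q) \<and>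
        e \<in> cochains r I p}"

definition cohomology_dim :: "nat \<Rightarrow> cpoly set \<Rightarrow> nat \<Rightarrow> nat" where
  "cohomology_dim r I p =
     quot_dim (\<lambda>a c J. smul a (c J)) (cech_cocycles r I p) (cech_coboundaries r I p)"

definition euler_characteristic :: "nat \<Rightarrow> cpoly set \<Rightarrow> int" where
  "euler_characteristic r I = (\<Sum>p\<le>r. (-1) ^ p * int (cohomology_dim r I p))"

text \<open>The arithmetic genus of a scheme of dimension \<open>1\<close>.\<close>

definition arithmetic_genus :: "nat \<Rightarrow> cpoly set \<Rightarrow> int" where
  "arithmetic_genus r I = 1 - euler_characteristic r I"


section \<open>General hyperplanes and the sectional genus\<close>

text \<open>
  \<open>Q\<close> holds for the general hyperplane \<open>h = 0\<close> of \<open>\<P>\<^sup>r\<close> if it holds on a nonempty Zariski open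
  subset of the dual projective space; it suffices to consider a basic open set \<open>F \<noteq> 0\<close>.
\<close>

definition general_hyperplane :: "nat \<Rightarrow> (cpoly \<Rightarrow> bool) \<Rightarrow> bool" where
  "general_hyperplane r Q \<longleftrightarrow>
     (\<exists>F t. F \<in> carrier (coord_ring r) \<inter> homog t \<and> F \<noteq> 0 \<and>
        (\<forall>h \<in> carrier (coord_ring r) \<inter> homog 1.
           h \<noteq> 0 \<and> eval_poly (\<lambda>i. Poly_Mapping.lookup h (Poly_Mapping.single i 1)) F \<noteq> 0 \<longrightarrow> Q h))"

text \<open>
  For an integral surface the general hyperplane section is an integral curve by Bertini's
  theorem; the value below depends only on its arithmetic genus.
\<close>

definition sectional_genus :: "nat \<Rightarrow> cpoly set \<Rightarrow> int" where
  "sectional_genus r I =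
     (THE g. general_hyperplane r (\<lambda>h. arithmetic_genus r (hypersurface_section r I h) = g))"

end

theory Submission
  imports Defs "HOL-Library.Set_Algebras"
begin

text \<open>
  Write \<open>h\<^sub>S\<close>, \<open>h\<^sub>C\<close> for the Hilbert functions of \<open>S\<close> and \<open>C\<close>.  For large \<open>n\<close> the Cech complexes of all
  twists give \<open>h\<^sub>C(n) = d n + 1 - p\<^sub>a(C)\<close>, and \<open>h\<^sub>S(n + 1) - h\<^sub>S(n) = s (n + 1) + 1 - \<pi>\<close> because every
  hyperplane not containing \<open>S\<close> cuts \<open>S\<close> in a curve with the same Hilbert polynomial.  So the task is to
  bound \<open>h\<^sub>C\<close> from below.

  Instead of an integral hyperplane section (Bertini's theorem) one uses the generic member of a pencil
  spanned by two regular linear forms \<open>x\<close>, \<open>y\<close>.  Let \<open>\<rho>\<^sub>X(n)\<close> be the dimension of the forms of degree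
  \<open>n\<close> on the section of \<open>X\<close> by this generic member.  Then \<open>h\<^sub>C(n + 1) - h\<^sub>C(n) \<ge> \<rho>\<^sub>C(n + 1)\<close>, and
  \<open>\<rho>\<^sub>C\<close> increases strictly until it reaches \<open>d\<close>.  Put \<open>m = (d - 1) div s\<close>.  As \<open>s m < d\<close>, Bezout's
  theorem on \<open>S\<close> shows that \<open>h\<^sub>C(m) = h\<^sub>S(m)\<close> and \<open>\<rho>\<^sub>C(m) = \<rho>\<^sub>S(m)\<close>.  These two numbers are bounded
  from below by applying Castelnuovo's argument to a section of \<open>S\<close> by one and by two linear forms.
\<close>

text \<open>The obstacle is that Bezout and Castelnuovo are usually applied to an integral
  hyperplane section. With the generic member only the integrality of \<open>S\<close> itself is
  used: a form outside its prime ideal multiplies injectively on the spaces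
  \<open>(x, y)^t R_n\<close>, and the numbers \<open>\<rho>\<close> are the slopes of their
  dimensions in \<open>t\<close>. Where an integral section would give \<open>\<pi> \<ge> 0\<close>,
  one proves \<open>1 - \<pi> \<le> s\<close>, which is weaker but suffices. The constant: put
  \<open>B = s (s - 1) / 2\<close>. The deficiency of the Hilbert function of the section of
  \<open>S\<close> costs \<open>(s - 1) B + B^2 / 2\<close> in the bound for \<open>h_S(m)\<close>,
  the shortfall of \<open>\<rho>_C\<close> from \<open>d\<close> costs \<open>B^2 / 2\<close>, and
  the remainder of dividing \<open>d\<close> by \<open>s\<close> costs \<open>s\<close>. Together
  they stay below \<open>s^4\<close>. Hilbert polynomials, Serre vanishing and the existence of
  regular linear forms are all obtained by one device, Noetherian induction along the exact sequence
  that joins \<open>I : x\<close>, \<open>I\<close> and \<open>I + (x)\<close>.\<close>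

section \<open>Dimension modulo a subspace\<close>

locale relative_dim = vector_space scale
  for scale :: "'a::field \<Rightarrow> 'b::ab_group_add \<Rightarrow> 'b"
begin

text \<open>
  \<open>qbasis X A B\<close> says that the classes of \<open>X \<subseteq> A\<close> form a basis of \<open>(A + B) / B\<close>, whose dimension is
  \<open>rd A B\<close>; \<open>B\<close> need not be contained in \<open>A\<close>.
\<close>

definition qbasis :: "'b set \<Rightarrow> 'b set \<Rightarrow> 'b set \<Rightarrow> bool" where
  "qbasis X A B \<longleftrightarrow> finite X \<and> X \<subseteq> A \<and> A \<subseteq> span X + B \<and>
     (\<forall>c. (\<Sum>x\<in>X. scale (c x) x) \<in> B \<longrightarrow> (\<forall>x\<in>X. c x = 0))"

definition fd :: "'b set \<Rightarrow> 'b set \<Rightarrow> bool" where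
  "fd A B \<longleftrightarrow> (\<exists>X. finite X \<and> A \<subseteq> span X + B)"

text \<open>Values in \<open>enat\<close> make additivity unconditional, so long exact sequences can
  be split before any cohomology group is known to be finite-dimensional.\<close>

definition rd :: "'b set \<Rightarrow> 'b set \<Rightarrow> enat" where
  "rd A B = (if \<exists>X. qbasis X A B then enat (card (SOME X. qbasis X A B)) else \<infinity>)"

lemma subspace_plus: "subspace A \<Longrightarrow> subspace B \<Longrightarrow> subspace (A + B)"
proof -
  have "A + B = {x + y |x y. x \<in> A \<and> y \<in> B}" by (auto simp: set_plus_def)
  then show "subspace A \<Longrightarrow> subspace B \<Longrightarrow> subspace (A + B)" using subspace_sums by simp
qed

lemma subset_plus_left: "subspace B \<Longrightarrow> A \<subseteq> A + B"
  using set_plus_intro[of _ A 0 B] subspace_0 by fastforce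

lemma subset_plus_right: "subspace A \<Longrightarrow> B \<subseteq> A + B"
  using set_zero_plus2 subspace_0 by blast

lemma plus_subset: "subspace C \<Longrightarrow> A \<subseteq> C \<Longrightarrow> B \<subseteq> C \<Longrightarrow> A + B \<subseteq> C"
  by (auto simp: set_plus_def intro!: subspace_add)

lemma plus_absorb: "subspace A \<Longrightarrow> subspace B \<Longrightarrow> B \<subseteq> A \<Longrightarrow> A + B = A"
  using plus_subset[of A A B] subset_plus_left[of B A] by auto

text \<open>Identity minus a projection onto \<open>B\<close>: this realizes the quotient by
  \<open>B\<close> inside the space itself.\<close>

lemma exists_projection:
  assumes B: "subspace B"
  obtains p where "Vector_Spaces.linear scale scale p" "\<And>v. p v = 0 \<longleftrightarrow> v \<in> B"
proof -
  interpret vector_space_pair scale scale by unfold_locales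
  obtain \<beta> where \<beta>: "\<beta> \<subseteq> B" "independent \<beta>" "B \<subseteq> span \<beta>"
    using maximal_independent_subset by blast
  obtain f where f: "Vector_Spaces.linear scale scale f" "\<forall>x\<in>\<beta>. f x = x" "Set.range f = span ((\<lambda>x. x) ` \<beta>)"
    using linear_independent_extend_subspace[OF \<beta>(2), of "\<lambda>x. x"] by auto
  have sB: "span \<beta> = B"
    using \<beta> B by (simp add: span_minimal subset_antisym)
  interpret f: Vector_Spaces.linear scale scale f by fact
  have fid: "f v = v" if "v \<in> B" for v
    using linear_eq_on[OF f(1) linear_id, of v \<beta>] f(2) that \<beta>(3) by auto
  have "Vector_Spaces.linear scale scale (\<lambda>v. v - f v)"
    by (intro linear_compose_sub f(1) linear_ident)
  moreover have "v - f v = 0 \<longleftrightarrow> v \<in> B" for v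
    using fid[of v] f(3) sB by (metis eq_iff_diff_eq_0 image_ident rangeI)
  ultimately show thesis using that by blast
qed

lemma qbasis_project:
  assumes q: "qbasis X A B" and B: "subspace B" and p: "Vector_Spaces.linear scale scale p" "\<And>v. p v = 0 \<longleftrightarrow> v \<in> B"
  shows "card X = dim (p ` A)"
proof -
  interpret p: Vector_Spaces.linear scale scale p by fact
  have fin: "finite X" and XA: "X \<subseteq> A" and sp: "A \<subseteq> span X + B"
    and ind: "\<And>c. (\<Sum>x\<in>X. scale (c x) x) \<in> B \<Longrightarrow> \<forall>x\<in>X. c x = 0"
    using q unfolding qbasis_def by auto
  have inj: "inj_on p X"
  proof (rule inj_onI, rule ccontr)
    fix a b assume ab: "a \<in> X" "b \<in> X" "p a = p b" "a \<noteq> b"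
    let ?c = "\<lambda>x. if x = a then 1 else if x = b then - 1 else 0"
    have "(\<Sum>x\<in>X. scale (?c x) x) = (\<Sum>x\<in>{a,b}. scale (?c x) x)"
      using fin ab by (intro sum.mono_neutral_right) auto
    also have "\<dots> = a - b" using ab by simp
    finally have "(\<Sum>x\<in>X. scale (?c x) x) \<in> B"
      using p(2)[of "a - b"] ab(3) by (simp add: p.diff)
    from ind[OF this] ab show False by fastforce
  qed
  have indep: "independent (p ` X)"
  proof (rule independent_if_scalars_zero)
    show "finite (p ` X)" using fin by simp
    fix c y assume 0: "(\<Sum>x\<in>p ` X. scale (c x) x) = 0" and y: "y \<in> p ` X"
    have "p (\<Sum>x\<in>X. scale (c (p x)) x) = 0"
      using 0 by (simp add: p.sum p.scale sum.reindex[OF inj])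
    then have "(\<Sum>x\<in>X. scale (c (p x)) x) \<in> B" using p(2) by blast
    from ind[OF this] y show "c y = 0" by auto
  qed
  have "p ` A \<subseteq> span (p ` X)"
  proof
    fix y assume "y \<in> p ` A"
    then obtain a where a: "a \<in> A" "y = p a" by auto
    then obtain u b where "u \<in> span X" "b \<in> B" "a = u + b" using sp by (auto simp: set_plus_def)
    then have "y = p u" using a p(2)[of b] by (simp add: p.add)
    then show "y \<in> span (p ` X)" using \<open>u \<in> span X\<close> by (simp add: p.span_image)
  qed
  then have "card (p ` X) = dim (p ` A)"
    using basis_card_eq_dim indep XA by (metis image_mono)
  then show ?thesis using card_image[OF inj] by simp
qed

lemma qbasis_card_eq:
  assumes "qbasis X A B" "qbasis Y A B" "subspace B"
  shows "card X = card Y"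
  using exists_projection[OF assms(3)] qbasis_project assms by metis

lemma rd_qbasis: "subspace B \<Longrightarrow> qbasis X A B \<Longrightarrow> rd A B = enat (card X)"
  unfolding rd_def using qbasis_card_eq by (metis someI)

lemma fd_qbasis:
  assumes "fd A B" and B: "subspace B"
  shows "\<exists>X. qbasis X A B"
proof -
  obtain S where S: "finite S" "A \<subseteq> span S + B" using assms unfolding fd_def by auto
  obtain p where p: "Vector_Spaces.linear scale scale p" "\<And>v. p v = 0 \<longleftrightarrow> v \<in> B" using exists_projection[OF B] by blast
  interpret p: Vector_Spaces.linear scale scale p by fact
  obtain Y where Y: "Y \<subseteq> p ` A" "independent Y" "p ` A \<subseteq> span Y"
    using maximal_independent_subset by blast
  have "p ` A \<subseteq> span (p ` S)"
  proof
    fix y assume "y \<in> p ` A"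
    then obtain a where a: "a \<in> A" "y = p a" by auto
    then obtain u b where "u \<in> span S" "b \<in> B" "a = u + b" using S by (auto simp: set_plus_def)
    then have "y = p u" using a p(2)[of b] by (simp add: p.add)
    then show "y \<in> span (p ` S)" using \<open>u \<in> span S\<close> by (simp add: p.span_image)
  qed
  then have finY: "finite Y"
    using independent_span_bound[of "p ` S" Y] S Y by auto
  have "\<forall>y\<in>Y. \<exists>a. a \<in> A \<and> p a = y" using Y(1) by auto
  then obtain g where g: "\<And>y. y \<in> Y \<Longrightarrow> g y \<in> A \<and> p (g y) = y"
    using bchoice by metis
  have injg: "inj_on g Y" using g by (metis inj_onI)
  have "qbasis (g ` Y) A B"
    unfolding qbasis_def
  proof (intro conjI allI impI)
    show "finite (g ` Y)" "g ` Y \<subseteq> A" using finY g by auto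
    show "A \<subseteq> span (g ` Y) + B"
    proof
      fix a assume a: "a \<in> A"
      then have "p a \<in> span (p ` g ` Y)" using Y(3) g by (auto simp: image_image cong: image_cong)
      then obtain u where u: "u \<in> span (g ` Y)" "p a = p u"
        by (auto simp: p.span_image)
      then have "a - u \<in> B" using p(2)[of "a - u"] by (simp add: p.diff)
      then show "a \<in> span (g ` Y) + B" using set_plus_intro[OF u(1)] by fastforce
    qed
    fix c assume "(\<Sum>x\<in>g ` Y. scale (c x) x) \<in> B"
    then have "p (\<Sum>x\<in>g ` Y. scale (c x) x) = 0" using p(2) by blast
    then have 0: "(\<Sum>y\<in>Y. scale (c (g y)) y) = 0"
      using g by (simp add: p.sum p.scale sum.reindex[OF injg] cong: sum.cong)
    have "\<forall>y\<in>Y. c (g y) = 0"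
      using iffD1[OF independent_explicit_finite_subsets Y(2), rule_format, OF order_refl finY, of "\<lambda>y. c (g y)"] 0 by blast
    then show "\<forall>x\<in>g ` Y. c x = 0" by auto
  qed
  then show ?thesis ..
qed

lemma qbasis_fd: "qbasis X A B \<Longrightarrow> fd A B"
  unfolding qbasis_def fd_def by auto

lemma rd_finite_iff: "subspace B \<Longrightarrow> rd A B \<noteq> \<infinity> \<longleftrightarrow> fd A B"
  unfolding rd_def using fd_qbasis[of A B] qbasis_fd[of _ A B] by (auto split: if_splits)

lemma fd_mono: "fd A B \<Longrightarrow> A' \<subseteq> A \<Longrightarrow> B \<subseteq> B' \<Longrightarrow> fd A' B'"
  unfolding fd_def by (meson order_trans set_plus_mono2 order_refl)

lemma rd_zero_iff:
  assumes "subspace A" "subspace B"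
  shows "rd A B = 0 \<longleftrightarrow> A \<subseteq> B"
proof
  assume "rd A B = 0"
  then obtain X where X: "qbasis X A B" "card X = 0"
    unfolding rd_def by (metis i0_ne_infinity enat_0_iff(1) someI)
  then have "X = {}" by (simp add: qbasis_def)
  then show "A \<subseteq> B" using X by (auto simp: qbasis_def)
next
  assume "A \<subseteq> B"
  then have "qbasis {} A B" unfolding qbasis_def by auto
  then show "rd A B = 0" using rd_qbasis[OF assms(2)] by (metis card.empty enat_0_iff(1))
qed

text \<open>A basis of \<open>B\<close> modulo \<open>C\<close> followed by one of \<open>A\<close>
  modulo \<open>B + C\<close> is a basis of \<open>A + B\<close> modulo \<open>C\<close>; if one
  part is infinite, so is the total. Every exact sequence below reduces to this.\<close>

lemma rd_plus:
  assumes A: "subspace A" and B: "subspace B" and C: "subspace C"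
  shows "rd (A + B) C = rd B C + rd A (B + C)"
proof (cases "fd B C \<and> fd A (B + C)")
  case True
  have BC: "subspace (B + C)" using B C subspace_plus by auto
  obtain Y where Y: "qbasis Y B C" using True fd_qbasis[OF _ C] by blast
  obtain X where X: "qbasis X A (B + C)" using True fd_qbasis[OF _ BC] by blast
  have Xf: "finite X" "X \<subseteq> A" "A \<subseteq> span X + (B + C)"
    "\<And>c. (\<Sum>x\<in>X. scale (c x) x) \<in> B + C \<Longrightarrow> \<forall>x\<in>X. c x = 0"
    using X unfolding qbasis_def by auto
  have Yf: "finite Y" "Y \<subseteq> B" "B \<subseteq> span Y + C"
    "\<And>c. (\<Sum>x\<in>Y. scale (c x) x) \<in> C \<Longrightarrow> \<forall>x\<in>Y. c x = 0"
    using Y unfolding qbasis_def by auto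
  have disj: "X \<inter> Y = {}"
  proof (rule ccontr)
    assume "X \<inter> Y \<noteq> {}"
    then obtain z where z: "z \<in> X" "z \<in> Y" by auto
    have "(\<Sum>x\<in>X. scale (if x = z then 1 else 0) x) = (\<Sum>x\<in>{z}. x)"
      using Xf z by (intro sum.mono_neutral_cong_right) auto
    then have "(\<Sum>x\<in>X. scale (if x = z then 1 else 0) x) = z" by simp
    then have "(\<Sum>x\<in>X. scale (if x = z then 1 else 0) x) \<in> B + C"
      using z Yf(2) subset_plus_left[OF C, of B] by auto
    from Xf(4)[OF this] z show False by auto
  qed
  have "qbasis (X \<union> Y) (A + B) C"
    unfolding qbasis_def
  proof (intro conjI allI impI)
    show "finite (X \<union> Y)" using Xf Yf by auto
    show "X \<union> Y \<subseteq> A + B" using Xf Yf subset_plus_left[OF B] subset_plus_right[OF A] by blast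
    show "A + B \<subseteq> span (X \<union> Y) + C"
    proof
      fix v assume "v \<in> A + B"
      then obtain a b where ab: "a \<in> A" "b \<in> B" "v = a + b" by (auto simp: set_plus_def)
      obtain u b' c where u: "u \<in> span X" "b' \<in> B" "c \<in> C" "a = u + (b' + c)"
        using ab Xf(3) by (auto simp: set_plus_def)
      have "b + b' \<in> B" using ab u B subspace_add by auto
      then obtain w c' where w: "w \<in> span Y" "c' \<in> C" "b + b' = w + c'" using Yf(3) by (auto simp: set_plus_def)
      have "v = (u + w) + (c + c')" 
      proof -
        have "v = u + c + (b + b')" using ab u by (simp add: ac_simps)
        then show ?thesis using w by (simp add: ac_simps)
      qed
      moreover have "u + w \<in> span (X \<union> Y)" using u w by (auto simp: span_Un)
      moreover have "c + c' \<in> C" using u w C subspace_add by auto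
      ultimately show "v \<in> span (X \<union> Y) + C" by blast
    qed
    fix c assume c: "(\<Sum>x\<in>X \<union> Y. scale (c x) x) \<in> C"
    have eq: "(\<Sum>x\<in>X \<union> Y. scale (c x) x) = (\<Sum>x\<in>X. scale (c x) x) + (\<Sum>x\<in>Y. scale (c x) x)"
      using Xf Yf disj by (simp add: sum.union_disjoint)
    have yB: "- (\<Sum>x\<in>Y. scale (c x) x) \<in> B"
      using Yf(2) B by (intro subspace_neg subspace_sum subspace_scale) auto
    have "(\<Sum>x\<in>X. scale (c x) x) = - (\<Sum>x\<in>Y. scale (c x) x) + (\<Sum>x\<in>X \<union> Y. scale (c x) x)"
      using eq by simp
    then have "(\<Sum>x\<in>X. scale (c x) x) \<in> B + C" using set_plus_intro[OF yB c] by simp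
    from Xf(4)[OF this] have X0: "\<forall>x\<in>X. c x = 0" .
    then have "(\<Sum>x\<in>Y. scale (c x) x) \<in> C" using c eq by simp
    from Yf(4)[OF this] X0 show "\<forall>x\<in>X \<union> Y. c x = 0" by auto
  qed
  then have "rd (A + B) C = enat (card (X \<union> Y))" using rd_qbasis[OF C] by blast
  also have "card (X \<union> Y) = card Y + card X" using Xf Yf disj by (simp add: card_Un_disjoint)
  finally show ?thesis using rd_qbasis[OF C Y] rd_qbasis[OF BC X] by simp
next
  case False
  have BC: "subspace (B + C)" using B C subspace_plus by auto
  have "\<not> fd (A + B) C"
    using False fd_mono[of "A + B" C B C] fd_mono[of "A + B" C A "B + C"]
      subset_plus_left[OF B, of A] subset_plus_right[OF A, of B] subset_plus_right[OF B, of C] by auto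
  then have "rd (A + B) C = \<infinity>" using rd_finite_iff[OF C, of "A + B"] by blast
  moreover have "rd B C = \<infinity> \<or> rd A (B + C) = \<infinity>"
    using False rd_finite_iff[OF C, of B] rd_finite_iff[OF BC, of A] by blast
  ultimately show ?thesis by auto
qed

text \<open>Only the trace of \<open>B\<close> on \<open>A\<close> matters: if an element of
  \<open>A\<close> is a combination of elements of \<open>A\<close> plus a correction, the
  correction lies in \<open>A\<close> again.\<close>

lemma rd_cong:
  assumes B: "subspace B" "subspace B'" and A: "subspace A"
    and eq: "\<And>v. v \<in> A \<Longrightarrow> v \<in> B \<longleftrightarrow> v \<in> B'"
  shows "rd A B = rd A B'"
proof -
  have *: "A \<subseteq> span X + B \<longleftrightarrow> A \<subseteq> span X + B'" if "X \<subseteq> A" for X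
  proof -
    have "b \<in> A" if "u + b \<in> A" "u \<in> span X" for u b
    proof -
      have "u \<in> A" using that \<open>X \<subseteq> A\<close> A span_minimal by blast
      then show ?thesis using that A subspace_diff by (metis add_diff_cancel_left')
    qed
    then show ?thesis using eq by (auto simp: set_plus_def subset_eq) (metis (no_types))+
  qed
  have "qbasis X A B \<longleftrightarrow> qbasis X A B'" for X
  proof (cases "X \<subseteq> A")
    case True
    then have "(\<Sum>x\<in>X. scale (c x) x) \<in> A" for c
      using A by (intro subspace_sum subspace_scale) auto
    then show ?thesis unfolding qbasis_def using eq *[OF True] by auto
  qed (auto simp: qbasis_def)
  then show ?thesis unfolding rd_def by simp
qed

lemma rd_inter: "subspace A \<Longrightarrow> subspace B \<Longrightarrow> rd A (A \<inter> B) = rd A B"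
  by (rule rd_cong) (auto intro: subspace_inter)

lemma rd_cong_left:
  assumes "subspace A" "subspace A'" "subspace B" "A \<subseteq> A' + B" "A' \<subseteq> A + B"
  shows "rd A B = rd A' B"
proof -
  have *: "rd (A + B) B = rd A B" if "subspace A" for A
  proof -
    have "rd B B = 0" using assms rd_zero_iff by auto
    then show ?thesis using rd_plus[OF that assms(3,3)] plus_absorb[OF assms(3,3)] by simp
  qed
  have "A + B = A' + B"
  proof
    show "A + B \<subseteq> A' + B" using assms plus_subset[of "A' + B" A B] subspace_plus subset_plus_right by auto
    show "A' + B \<subseteq> A + B" using assms plus_subset[of "A + B" A' B] subspace_plus subset_plus_right by auto
  qed
  then show ?thesis using *[OF assms(1)] *[OF assms(2)] by simp
qed

lemma rd_chain: 
  assumes "subspace A" "subspace B" "subspace C" "B \<subseteq> A"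
  shows "rd A C = rd B C + rd A (B + C)"
  using rd_plus[OF assms(1-3)] plus_absorb[OF assms(1,2,4)] by simp

lemma rd_mono_left:
  assumes "subspace A" "subspace A'" "subspace B" "A \<subseteq> A'"
  shows "rd A B \<le> rd A' B"
  using rd_chain[OF assms(2,1,3,4)] by simp

lemma rd_mono_right:
  assumes "subspace A" "subspace B" "subspace B'" "B \<subseteq> B'"
  shows "rd A B' \<le> rd A B"
proof -
  have "rd A B = rd (A \<inter> B') B + rd A ((A \<inter> B') + B)"
    using assms by (intro rd_chain) (auto intro: subspace_inter)
  also have "rd A ((A \<inter> B') + B) = rd A B'"
  proof (rule rd_cong)
    fix v assume "v \<in> A"
    show "v \<in> (A \<inter> B') + B \<longleftrightarrow> v \<in> B'"
    proof
      assume "v \<in> (A \<inter> B') + B"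
      then show "v \<in> B'" using plus_subset[of B' "A \<inter> B'" B] assms by auto
    next
      assume "v \<in> B'"
      then show "v \<in> (A \<inter> B') + B" using \<open>v \<in> A\<close> subset_plus_left[OF assms(2), of "A \<inter> B'"] by auto
    qed
  qed (use assms in \<open>auto intro: subspace_inter subspace_plus\<close>)
  finally show ?thesis by simp
qed

lemma rd_subadd:
  assumes "subspace A" "subspace B" "subspace C"
  shows "rd (A + B) C \<le> rd A C + rd B C"
  using rd_plus[OF assms] rd_mono_right[of A C "B + C"] assms subspace_plus subset_plus_right
  by (metis add.commute add_left_mono)

lemma subspace_set_sum: "(\<And>i. i \<in> I \<Longrightarrow> subspace (A i)) \<Longrightarrow> subspace (\<Sum>i\<in>I. A i)"
  by (induction I rule: infinite_finite_induct) (auto intro: subspace_plus simp: subspace_single_0)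

lemma subset_set_sum:
  assumes "finite I" "\<And>i. i \<in> I \<Longrightarrow> subspace (A i)" "i \<in> I"
  shows "A i \<subseteq> (\<Sum>i\<in>I. A i)"
proof -
  have "(\<Sum>i\<in>I. A i) = A i + (\<Sum>i\<in>I - {i}. A i)" using assms by (simp add: sum.remove)
  moreover have "subspace (\<Sum>i\<in>I - {i}. A i)" using assms by (intro subspace_set_sum) auto
  ultimately show ?thesis using subset_plus_left by metis
qed

lemma set_sum_subset:
  assumes "finite I" "subspace C" "\<And>i. i \<in> I \<Longrightarrow> A i \<subseteq> C"
  shows "(\<Sum>i\<in>I. A i) \<subseteq> C"
  using assms(1,3)
proof (induction I)
  case (insert i I)
  then show ?case using plus_subset[OF assms(2), of "A i" "\<Sum>i\<in>I. A i"] by simp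
qed (use assms(2) subspace_0 in auto)

lemma rd_set_sum_le:
  assumes "finite I" "\<And>i. i \<in> I \<Longrightarrow> subspace (A i)" "subspace C"
  shows "rd (\<Sum>i\<in>I. A i) C \<le> (\<Sum>i\<in>I. rd (A i) C)"
  using assms(1,2)
proof (induction I)
  case empty
  have "rd {0} C = 0" using assms(3) by (subst rd_zero_iff) (auto simp: subspace_single_0 subspace_0)
  then show ?case by simp
next
  case (insert i I)
  then have "rd (\<Sum>i\<in>insert i I. A i) C \<le> rd (A i) C + rd (\<Sum>i\<in>I. A i) C"
    using rd_subadd[of "A i" "\<Sum>i\<in>I. A i" C] subspace_set_sum[of I A] assms(3) by simp
  also have "\<dots> \<le> rd (A i) C + (\<Sum>i\<in>I. rd (A i) C)" using insert by (intro add_left_mono) auto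
  finally show ?case using insert by simp
qed

text \<open>Existence and uniqueness of coefficients amount to spanning and independence modulo
  \<open>W\<close>; \<open>extensional X\<close> removes the freedom of coefficients outside
  \<open>X\<close>.\<close>

lemma quot_dim_eq_rd:
  fixes V W :: "'b set"
  assumes V: "subspace V" and W: "subspace W" and fd: "fd V W"
  shows "enat (THE n. \<exists>X. finite X \<and> X \<subseteq> V \<and> card X = n \<and>
        (\<forall>v\<in>V. \<exists>!c. c \<in> extensional X \<and> v - (\<Sum>x\<in>X. scale (c x) x) \<in> W)) = rd V W"
proof -
  have iff: "finite X \<and> X \<subseteq> V \<and> (\<forall>v\<in>V. \<exists>!c. c \<in> extensional X \<and> v - (\<Sum>x\<in>X. scale (c x) x) \<in> W)
      \<longleftrightarrow> qbasis X V W" for X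
  proof
    assume L: "finite X \<and> X \<subseteq> V \<and> (\<forall>v\<in>V. \<exists>!c. c \<in> extensional X \<and> v - (\<Sum>x\<in>X. scale (c x) x) \<in> W)"
    show "qbasis X V W" unfolding qbasis_def
    proof (intro conjI allI impI)
      show "finite X" "X \<subseteq> V" using L by auto
      show "V \<subseteq> span X + W"
      proof
        fix v assume "v \<in> V"
        then obtain c where "v - (\<Sum>x\<in>X. scale (c x) x) \<in> W" using L by metis
        moreover have "(\<Sum>x\<in>X. scale (c x) x) \<in> span X"
          by (intro span_sum span_scale span_base)
        ultimately show "v \<in> span X + W" 
          using set_plus_intro[of "(\<Sum>x\<in>X. scale (c x) x)" "span X" "v - (\<Sum>x\<in>X. scale (c x) x)" W] by simp
      qed
      fix c assume c: "(\<Sum>x\<in>X. scale (c x) x) \<in> W"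
      \<comment> \<open>Independence is the uniqueness of the coefficients of the vector 0.\<close>
      have ex: "\<exists>!c. c \<in> extensional X \<and> 0 - (\<Sum>x\<in>X. scale (c x) x) \<in> W"
        using L V subspace_0 by blast
      have e1: "restrict c X \<in> extensional X \<and> 0 - (\<Sum>x\<in>X. scale (restrict c X x) x) \<in> W"
        using c W by (simp add: subspace_neg cong: sum.cong)
      have e2: "restrict (\<lambda>_. 0) X \<in> extensional X \<and> 0 - (\<Sum>x\<in>X. scale (restrict (\<lambda>_. 0) X x) x) \<in> W"
        using W by (simp add: subspace_0 cong: sum.cong)
      have "restrict c X = restrict (\<lambda>_. 0) X" using ex e1 e2 by blast
      then show "\<forall>x\<in>X. c x = 0" by (metis restrict_apply')
    qed
  next
    assume q: "qbasis X V W"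
    then have X: "finite X" "X \<subseteq> V" "V \<subseteq> span X + W"
      "\<And>c. (\<Sum>x\<in>X. scale (c x) x) \<in> W \<Longrightarrow> \<forall>x\<in>X. c x = 0" unfolding qbasis_def by auto
    have "\<exists>!c. c \<in> extensional X \<and> v - (\<Sum>x\<in>X. scale (c x) x) \<in> W" if v: "v \<in> V" for v
    proof -
      obtain u w where u: "u \<in> span X" "w \<in> W" "v = u + w" using v X(3) by (auto simp: set_plus_def)
      obtain c where c: "u = (\<Sum>x\<in>X. scale (c x) x)" using u(1) span_finite[OF X(1)] by auto
      show ?thesis
      proof (rule ex1I[of _ "restrict c X"])
        show "restrict c X \<in> extensional X \<and> v - (\<Sum>x\<in>X. scale (restrict c X x) x) \<in> W"
          using u c by (simp cong: sum.cong)
        fix c' assume c': "c' \<in> extensional X \<and> v - (\<Sum>x\<in>X. scale (c' x) x) \<in> W"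
        have "(\<Sum>x\<in>X. scale (c' x - c x) x) = w - (v - (\<Sum>x\<in>X. scale (c' x) x))"
          using u c by (simp add: scale_left_diff_distrib sum_subtractf)
        also have "\<dots> \<in> W" using u c' W subspace_diff by blast
        finally have "\<forall>x\<in>X. c' x - c x = 0" by (rule X(4))
        then show "c' = restrict c X" using c' by (intro extensionalityI[of _ X]) auto
      qed
    qed
    then show "finite X \<and> X \<subseteq> V \<and> (\<forall>v\<in>V. \<exists>!c. c \<in> extensional X \<and> v - (\<Sum>x\<in>X. scale (c x) x) \<in> W)"
      using X by auto
  qed
  obtain X where X: "qbasis X V W" using fd_qbasis fd W by blast
  have "(THE n. \<exists>X. finite X \<and> X \<subseteq> V \<and> card X = n \<and>
        (\<forall>v\<in>V. \<exists>!c. c \<in> extensional X \<and> v - (\<Sum>x\<in>X. scale (c x) x) \<in> W)) = card X"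
  proof (rule the_equality)
    show "\<exists>X'. finite X' \<and> X' \<subseteq> V \<and> card X' = card X \<and>
        (\<forall>v\<in>V. \<exists>!c. c \<in> extensional X' \<and> v - (\<Sum>x\<in>X'. scale (c x) x) \<in> W)"
      using iffD2[OF iff X] by (intro exI[of _ X]) simp
    fix n assume "\<exists>X. finite X \<and> X \<subseteq> V \<and> card X = n \<and>
        (\<forall>v\<in>V. \<exists>!c. c \<in> extensional X \<and> v - (\<Sum>x\<in>X. scale (c x) x) \<in> W)"
    then obtain Y where Y: "finite Y \<and> Y \<subseteq> V \<and> (\<forall>v\<in>V. \<exists>!c. c \<in> extensional Y \<and> v - (\<Sum>x\<in>Y. scale (c x) x) \<in> W)"
      "card Y = n" by (elim exE conjE) simp
    show "n = card X" using qbasis_card_eq[OF iffD1[OF iff Y(1)] X W] Y(2) by simp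
  qed
  then show ?thesis using rd_qbasis[OF W X] by simp
qed

end

text \<open>By the condition on \<open>A\<close>, the map induces an isomorphism of \<open>A\<close>
  modulo \<open>B\<close> onto its image modulo \<open>B'\<close>. Two scalar actions are allowed
  because polynomials are later compared with cochains.\<close>

lemma rd_image:
  fixes s1 :: "'a::field \<Rightarrow> 'b::ab_group_add \<Rightarrow> 'b" and s2 :: "'a \<Rightarrow> 'c::ab_group_add \<Rightarrow> 'c"
  assumes f: "Vector_Spaces.linear s1 s2 f"
    and A: "module.subspace s1 A" and B: "module.subspace s1 B" and B': "module.subspace s2 B'"
    and eq: "\<And>v. v \<in> A \<Longrightarrow> f v \<in> B' \<longleftrightarrow> v \<in> B"
  shows "relative_dim.rd s2 (f ` A) B' = relative_dim.rd s1 A B"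
proof -
  interpret f: Vector_Spaces.linear s1 s2 f by fact
  interpret v1: relative_dim s1 by unfold_locales
  interpret v2: relative_dim s2 by unfold_locales
  have sA: "f.vs2.subspace (f ` A)" using A by (simp add: f.subspace_image)
  have img: "v2.qbasis (f ` X) (f ` A) B' \<and> inj_on f X" if X: "v1.qbasis X A B" for X
  proof -
    have Xf: "finite X" "X \<subseteq> A" "A \<subseteq> f.vs1.span X + B"
      "\<And>c. (\<Sum>x\<in>X. s1 (c x) x) \<in> B \<Longrightarrow> \<forall>x\<in>X. c x = 0"
      using X unfolding v1.qbasis_def by auto
    have inj: "inj_on f X"
    proof (rule inj_onI, rule ccontr)
      fix a b assume ab: "a \<in> X" "b \<in> X" "f a = f b" "a \<noteq> b"
      let ?c = "\<lambda>x. if x = a then 1 else if x = b then - 1 else 0"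
      have "(\<Sum>x\<in>X. s1 (?c x) x) = (\<Sum>x\<in>{a,b}. s1 (?c x) x)"
        using Xf(1) ab by (intro sum.mono_neutral_right) auto
      also have "\<dots> = a - b" using ab by simp
      finally have e: "(\<Sum>x\<in>X. s1 (?c x) x) = a - b" .
      have "a - b \<in> A" using ab Xf(2) A f.vs1.subspace_diff by blast
      moreover have "f (a - b) \<in> B'" using ab B' by (simp add: f.diff f.vs2.subspace_0)
      ultimately have "(\<Sum>x\<in>X. s1 (?c x) x) \<in> B"
        using eq e by simp
      from Xf(4)[OF this] ab show False by fastforce
    qed
    have "v2.qbasis (f ` X) (f ` A) B'"
      unfolding v2.qbasis_def
    proof (intro conjI allI impI)
      show "finite (f ` X)" "f ` X \<subseteq> f ` A" using Xf by auto
      show "f ` A \<subseteq> f.vs2.span (f ` X) + B'"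
      proof
        fix y assume "y \<in> f ` A"
        then obtain a where a: "a \<in> A" "y = f a" by auto
        then obtain u b where u: "u \<in> f.vs1.span X" "b \<in> B" "a = u + b" using Xf(3) by (auto simp: set_plus_def)
        have "u \<in> A" using u Xf(2) A f.vs1.span_minimal by blast
        then have "b \<in> A" using a u A f.vs1.subspace_diff by (metis add_diff_cancel_left')
        then have "f b \<in> B'" using u eq by auto
        moreover have "f u \<in> f.vs2.span (f ` X)" using u by (simp add: f.span_image)
        ultimately show "y \<in> f.vs2.span (f ` X) + B'" using a u by (auto simp: f.add)
      qed
      fix c assume "(\<Sum>x\<in>f ` X. s2 (c x) x) \<in> B'"
      then have "f (\<Sum>x\<in>X. s1 (c (f x)) x) \<in> B'"
        by (simp add: f.sum f.scale sum.reindex[OF inj])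
      moreover have "(\<Sum>x\<in>X. s1 (c (f x)) x) \<in> A"
        using Xf(2) A by (intro f.vs1.subspace_sum f.vs1.subspace_scale) auto
      ultimately have "(\<Sum>x\<in>X. s1 (c (f x)) x) \<in> B" using eq by auto
      from Xf(4)[OF this] show "\<forall>x\<in>f ` X. c x = 0" by auto
    qed
    then show ?thesis using inj by auto
  qed
  show ?thesis
  proof (cases "v1.fd A B")
    case True
    then obtain X where X: "v1.qbasis X A B" using v1.fd_qbasis B by blast
    then show ?thesis using img[OF X] v1.rd_qbasis[OF B X] v2.rd_qbasis[OF B', of "f ` X" "f ` A"]
      by (simp add: card_image)
  next
    case False
    have "\<not> v2.fd (f ` A) B'"
    proof
      assume "v2.fd (f ` A) B'"
      then obtain Y where Y: "v2.qbasis Y (f ` A) B'" using v2.fd_qbasis[OF _ B'] by blast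
      then have Yf: "finite Y" "Y \<subseteq> f ` A" "f ` A \<subseteq> f.vs2.span Y + B'" unfolding v2.qbasis_def by auto
      obtain X where X: "finite X" "X \<subseteq> A" "Y = f ` X" using Yf(1,2) by (meson finite_subset_image)
      have "A \<subseteq> f.vs1.span X + B"
      proof
        fix a assume a: "a \<in> A"
        then obtain u b where u: "u \<in> f.vs2.span Y" "b \<in> B'" "f a = u + b" using Yf(3) by (auto simp: set_plus_def)
        then obtain w where w: "w \<in> f.vs1.span X" "u = f w" using X by (auto simp: f.span_image)
        have "w \<in> A" using w X A f.vs1.span_minimal by blast
        then have "a - w \<in> A" "f (a - w) \<in> B'" using a A u w by (auto simp: f.diff intro: f.vs1.subspace_diff)
        then have "a - w \<in> B" using eq by auto
        then show "a \<in> f.vs1.span X + B" using set_plus_intro[OF w(1)] by fastforce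
      qed
      then show False using False X unfolding v1.fd_def by auto
    qed
    then show ?thesis using False v1.rd_finite_iff[OF B] v2.rd_finite_iff[OF B'] by metis
  qed
qed

section \<open>Polynomials as a complex vector space\<close>

abbreviation Rg :: "nat \<Rightarrow> cpoly set" where "Rg r \<equiv> carrier (coord_ring r)"

abbreviation Rn :: "nat \<Rightarrow> nat \<Rightarrow> cpoly set" where "Rn r n \<equiv> Rg r \<inter> homog n"

lemma lookup_smul: "Poly_Mapping.lookup (smul a f) m = a * Poly_Mapping.lookup f m"
  unfolding smul_def mult_map_scale_conv_mult[symmetric]
  by (simp add: Poly_Mapping.map.rep_eq when_def)

interpretation pm: relative_dim "smul :: complex \<Rightarrow> ('m::comm_monoid_add \<Rightarrow>\<^sub>0 complex) \<Rightarrow> _"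
  by unfold_locales (auto intro!: poly_mapping_eqI simp: lookup_smul lookup_add algebra_simps)

lemma smul_mult_left: "smul a f * g = smul a (f * g)"
  by (simp add: smul_def mult.assoc)

lemma smul_mult_right: "f * smul a g = smul a (f * g)"
  for f :: "'m::comm_monoid_add \<Rightarrow>\<^sub>0 complex"
  by (simp add: smul_def mult.left_commute)

lemma poly_mapping_sum_singles:
  "f = (\<Sum>m\<in>Poly_Mapping.keys f. Poly_Mapping.single m (Poly_Mapping.lookup f m))"
  by (rule poly_mapping_eqI)
    (auto simp: lookup_sum lookup_single when_def not_in_keys_iff_lookup_eq_zero
      intro: sum.neutral)

section \<open>The graded ring\<close>

lemma Rg_iff: "f \<in> Rg r \<longleftrightarrow> (\<forall>m\<in>Poly_Mapping.keys f. Poly_Mapping.keys m \<subseteq> {..r})"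
  by (simp add: coord_ring_def)

lemma Rg_zero [simp]: "0 \<in> Rg r" and Rg_one [simp]: "1 \<in> Rg r"
  by (simp_all add: Rg_iff)

lemma Rg_add: "f \<in> Rg r \<Longrightarrow> g \<in> Rg r \<Longrightarrow> f + g \<in> Rg r"
  using keys_add[of f g] unfolding Rg_iff by blast

lemma Rg_mult: "f \<in> Rg r \<Longrightarrow> g \<in> Rg r \<Longrightarrow> f * g \<in> Rg r"
  unfolding Rg_iff
proof
  fix m assume fg: "\<forall>m\<in>Poly_Mapping.keys f. Poly_Mapping.keys m \<subseteq> {..r}"
    "\<forall>m\<in>Poly_Mapping.keys g. Poly_Mapping.keys m \<subseteq> {..r}" and "m \<in> Poly_Mapping.keys (f * g)"
  then obtain a b where "a \<in> Poly_Mapping.keys f" "b \<in> Poly_Mapping.keys g" "m = a + b"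
    using keys_mult[of f g] by auto
  then show "Poly_Mapping.keys m \<subseteq> {..r}" using fg keys_add[of a b] by blast
qed

lemma Rg_smul: "f \<in> Rg r \<Longrightarrow> smul a f \<in> Rg r"
  by (auto simp: Rg_iff in_keys_iff lookup_smul)

lemma Rg_subspace: "pm.subspace (Rg r)"
  by (simp add: pm.subspace_def Rg_add Rg_smul)

lemma Rg_power: "f \<in> Rg r \<Longrightarrow> f ^ k \<in> Rg r"
  by (induction k) (auto intro: Rg_mult)

lemma Rg_prod: "(\<And>i. i \<in> A \<Longrightarrow> f i \<in> Rg r) \<Longrightarrow> prod f A \<in> Rg r"
  by (induction A rule: infinite_finite_induct) (auto intro: Rg_mult)

lemma Rg_var: "i \<le> r \<Longrightarrow> var i \<in> Rg r"
  by (simp add: Rg_iff var_def)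

lemma mon_deg_eq: "finite A \<Longrightarrow> Poly_Mapping.keys m \<subseteq> A \<Longrightarrow> mon_deg m = (\<Sum>i\<in>A. Poly_Mapping.lookup m i)"
  unfolding mon_deg_def by (rule sum.mono_neutral_left) (auto simp: in_keys_iff)

lemma mon_deg_add: "mon_deg (m + m') = mon_deg m + mon_deg m'"
  using keys_add[of m m']
  by (simp add: mon_deg_eq[of "Poly_Mapping.keys m \<union> Poly_Mapping.keys m'"] lookup_add sum.distrib)

lemma mon_deg_zero [simp]: "mon_deg 0 = 0"
  by (simp add: mon_deg_def)

lemma mon_deg_single [simp]: "mon_deg (Poly_Mapping.single i n) = n"
  by (simp add: mon_deg_def)

lemma homog_mult: "f \<in> homog a \<Longrightarrow> g \<in> homog b \<Longrightarrow> f * g \<in> homog (a + b)"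
  using keys_mult[of f g] unfolding homog_def by (auto simp: mon_deg_add subset_eq)

lemma homog_subspace: "pm.subspace (homog n)"
  unfolding pm.subspace_def homog_def
  using keys_add by (fastforce simp: in_keys_iff lookup_smul)

lemma homog_one: "1 \<in> homog 0"
  by (simp add: homog_def)

lemma homog_power: "(f :: cpoly) \<in> homog a \<Longrightarrow> f ^ k \<in> homog (k * a)"
  by (induction k) (auto simp: homog_one intro: homog_mult)

lemma homog_var: "var i \<in> homog 1"
  by (simp add: homog_def var_def)

lemma Rn_subspace: "pm.subspace (Rn r n)"
  using Rg_subspace homog_subspace by (rule pm.subspace_inter)

lemma Rn_mult: "f \<in> Rn r a \<Longrightarrow> g \<in> Rn r b \<Longrightarrow> f * g \<in> Rn r (a + b)"
  using Rg_mult homog_mult by blast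

lemma Rn_var: "i \<le> r \<Longrightarrow> var i \<in> Rn r 1"
  using Rg_var homog_var by blast

lemma lookup_homog_component:
  "Poly_Mapping.lookup (homog_component t f) m = (if mon_deg m = t then Poly_Mapping.lookup f m else 0)"
proof -
  have "Poly_Mapping.lookup (homog_component t f) m =
      (\<Sum>k | k \<in> Poly_Mapping.keys f \<and> mon_deg k = t. if k = m then Poly_Mapping.lookup f k else 0)"
    by (simp add: homog_component_def lookup_sum lookup_single when_def)
  then show ?thesis by (auto simp: in_keys_iff)
qed

lemma homog_component_add: "homog_component t (f + g) = homog_component t f + homog_component t g"
  by (rule poly_mapping_eqI) (simp add: lookup_homog_component lookup_add)

lemma homog_component_zero [simp]: "homog_component t 0 = 0"
  by (rule poly_mapping_eqI) (simp add: lookup_homog_component)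

lemma homog_component_sum: "homog_component t (sum f A) = (\<Sum>a\<in>A. homog_component t (f a))"
  by (induction A rule: infinite_finite_induct) (auto simp: homog_component_add)

lemma homog_component_homog: "homog_component t f \<in> homog t"
  by (auto simp: homog_def in_keys_iff lookup_homog_component split: if_splits)

lemma homog_component_of_homog: "f \<in> homog u \<Longrightarrow> homog_component t f = (if t = u then f else 0)"
  by (rule poly_mapping_eqI) (auto simp: lookup_homog_component homog_def in_keys_iff)

lemma homog_component_Rg: "f \<in> Rg r \<Longrightarrow> homog_component t f \<in> Rg r"
  by (auto simp: Rg_iff in_keys_iff lookup_homog_component split: if_splits)

lemma homog_component_Rn: "f \<in> Rg r \<Longrightarrow> homog_component t f \<in> Rn r t"
  by (simp add: homog_component_Rg homog_component_homog)

lemma sum_homog_components: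
  assumes "finite A" "mon_deg ` Poly_Mapping.keys f \<subseteq> A"
  shows "f = (\<Sum>t\<in>A. homog_component t f)"
  by (rule poly_mapping_eqI) (use assms in \<open>auto simp: lookup_sum lookup_homog_component in_keys_iff image_subset_iff\<close>)

lemma homog_component_mult:
  assumes "a \<in> homog e"
  shows "homog_component t (a * g) = (if e \<le> t then a * homog_component (t - e) g else 0)"
proof -
  let ?A = "mon_deg ` Poly_Mapping.keys g"
  have fin: "finite ?A" by simp
  have "homog_component t (a * g) = homog_component t (\<Sum>u\<in>?A. a * homog_component u g)"
    using sum_homog_components[OF fin order_refl] by (simp add: sum_distrib_left[symmetric])
  also have "\<dots> = (\<Sum>u\<in>?A. homog_component t (a * homog_component u g))"
    by (rule homog_component_sum)
  also have "\<dots> = (\<Sum>u\<in>?A. if u + e = t then a * homog_component u g else 0)"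
    using homog_component_of_homog[OF homog_mult[OF assms homog_component_homog]]
    by (intro sum.cong) (auto simp: add.commute)
  also have "\<dots> = (if e \<le> t then a * homog_component (t - e) g else 0)"
  proof (cases "e \<le> t")
    case True
    have "(\<Sum>u\<in>?A. if u + e = t then a * homog_component u g else 0)
        = (\<Sum>u\<in>?A. if u = t - e then a * homog_component u g else 0)"
      using True by (intro sum.cong) auto
    also have "\<dots> = a * homog_component (t - e) g"
    proof (cases "t - e \<in> ?A")
      case False
      then have "homog_component (t - e) g = 0"
        by (intro poly_mapping_eqI; auto simp: lookup_homog_component not_in_keys_iff_lookup_eq_zero[symmetric]; metis imageI)
      then show ?thesis using False by (simp add: sum.neutral)
    qed simp
    finally show ?thesis using True by simp
  qed (auto intro: sum.neutral)
  finally show ?thesis .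
qed

definition monomials :: "nat \<Rightarrow> nat \<Rightarrow> (nat \<Rightarrow>\<^sub>0 nat) set" where
  "monomials r n = {m. Poly_Mapping.keys m \<subseteq> {..r} \<and> mon_deg m = n}"

lemma finite_monomials: "finite (monomials r n)"
proof -
  have "Poly_Mapping.lookup ` monomials r n
      \<subseteq> {f. \<forall>i. (i \<in> {..r} \<longrightarrow> f i \<in> {..n}) \<and> (i \<notin> {..r} \<longrightarrow> f i = 0)}"
  proof (clarify, intro conjI impI)
    fix m i assume m: "m \<in> monomials r n"
    show "Poly_Mapping.lookup m i = 0" if "i \<notin> {..r}" using that m by (auto simp: monomials_def in_keys_iff)
    assume "i \<in> {..r}"
    then have "Poly_Mapping.lookup m i \<le> (\<Sum>i\<in>{..r}. Poly_Mapping.lookup m i)" by (intro member_le_sum) auto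
    also have "\<dots> = n" using m mon_deg_eq[of "{..r}" m] by (simp add: monomials_def)
    finally show "Poly_Mapping.lookup m i \<in> {..n}" by simp
  qed
  then have "finite (Poly_Mapping.lookup ` monomials r n)"
    by (rule finite_subset) (rule finite_set_of_finite_funs, auto)
  then show ?thesis
    by (rule finite_imageD) (auto intro!: inj_onI poly_mapping_eqI)
qed

lemma Rn_monomials: "f \<in> Rn r n \<longleftrightarrow> Poly_Mapping.keys f \<subseteq> monomials r n"
  by (auto simp: Rg_iff homog_def monomials_def)

lemma fd_Rn:
  assumes B: "pm.subspace B"
  shows "pm.fd (Rn r n) B"
proof -
  let ?X = "(\<lambda>m. Poly_Mapping.single m (1::complex)) ` monomials r n"
  have "f \<in> pm.span ?X" if f: "f \<in> Rn r n" for f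
  proof -
    have "Poly_Mapping.single m (Poly_Mapping.lookup f m) \<in> pm.span ?X" if "m \<in> Poly_Mapping.keys f" for m
    proof -
      have "m \<in> monomials r n" using f that Rn_monomials by blast
      moreover have "Poly_Mapping.single m (Poly_Mapping.lookup f m) = smul (Poly_Mapping.lookup f m) (Poly_Mapping.single m 1)"
        by (simp add: smul_def mult_single)
      ultimately show ?thesis by (simp add: pm.span_base pm.span_scale)
    qed
    then show ?thesis by (subst poly_mapping_sum_singles) (rule pm.span_sum)
  qed
  then have "Rn r n \<subseteq> pm.span ?X + B" using pm.subset_plus_left[OF B] by blast
  then show ?thesis unfolding pm.fd_def using finite_monomials[of r n] by blast
qed

section \<open>Homogeneous ideals\<close>

lemma coord_ring_simps:
  "x \<oplus>\<^bsub>coord_ring r\<^esub> y = x + y" "x \<otimes>\<^bsub>coord_ring r\<^esub> y = x * y"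
  "\<zero>\<^bsub>coord_ring r\<^esub> = 0" "\<one>\<^bsub>coord_ring r\<^esub> = 1"
  by (simp_all add: coord_ring_def)

lemma ring_coord_ring: "ring (coord_ring r)"
proof -
  have inv: "\<exists>y\<in>Rg r. y + x = 0" if "x \<in> Rg r" for x
    using that Rg_subspace pm.subspace_neg by (intro bexI[of _ "- x"]) auto
  show ?thesis
    by (intro ringI abelian_groupI monoidI; simp add: coord_ring_simps Rg_add Rg_mult inv)
      (simp_all add: algebra_simps)
qed

lemma cring_coord_ring: "cring (coord_ring r)"
  using ring_coord_ring
  by (intro cringI comm_monoid.intro comm_monoid_axioms.intro ring.is_abelian_group ring.is_monoid)
    (auto simp: coord_ring_simps algebra_simps)

lemma ideal_coord_ring_iff:
  "ideal I (coord_ring r) \<longleftrightarrow> I \<subseteq> Rg r \<and> 0 \<in> I \<and> (\<forall>f\<in>I. \<forall>g\<in>I. f + g \<in> I) \<and> (\<forall>f\<in>I. \<forall>g\<in>Rg r. g * f \<in> I)"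
    (is "_ \<longleftrightarrow> ?P")
proof
  assume "ideal I (coord_ring r)"
  then interpret ideal I "coord_ring r" .
  show ?P using a_subset additive_subgroup.a_closed[OF is_additive_subgroup] I_l_closed
      additive_subgroup.zero_closed[OF is_additive_subgroup]
    by (simp add: coord_ring_simps)
next
  assume P: ?P
  have inv: "- x \<in> I" if "x \<in> I" for x
  proof -
    have "- 1 \<in> Rg r" using Rg_subspace pm.subspace_neg Rg_one by blast
    then show ?thesis using P that by (metis mult_minus1)
  qed
  show "ideal I (coord_ring r)"
  proof (intro idealI ring_coord_ring)
    have ai: "inv\<^bsub>add_monoid (coord_ring r)\<^esub> x = - x" if "x \<in> I" for x
    proof -
      interpret ring "coord_ring r" by (rule ring_coord_ring)
      have "\<ominus>\<^bsub>coord_ring r\<^esub> x = - x"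
        using that P inv by (intro minus_equality) (auto simp: coord_ring_def)
      then show ?thesis by (simp add: a_inv_def)
    qed
    show "subgroup I (add_monoid (coord_ring r))"
    proof (intro group.subgroupI abelian_group.a_group ring.is_abelian_group ring_coord_ring)
      show "inv\<^bsub>add_monoid (coord_ring r)\<^esub> x \<in> I" if "x \<in> I" for x
        using ai[OF that] inv[OF that] by simp
      show "I \<noteq> {}" using P by blast
    qed (use P in \<open>auto simp: coord_ring_def\<close>)
  qed (use P in \<open>auto simp: coord_ring_def mult.commute\<close>)
qed

lemma homogeneous_ideal_iff:
  "homogeneous_ideal r I \<longleftrightarrow> I \<subseteq> Rg r \<and> 0 \<in> I \<and> (\<forall>f\<in>I. \<forall>g\<in>I. f + g \<in> I) \<and>
     (\<forall>f\<in>I. \<forall>g\<in>Rg r. g * f \<in> I) \<and> (\<forall>f\<in>I. \<forall>t. homog_component t f \<in> I)"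
  by (auto simp: homogeneous_ideal_def ideal_coord_ring_iff)

lemma
  assumes "homogeneous_ideal r I"
  shows hi_Rg: "I \<subseteq> Rg r" and hi_zero: "0 \<in> I" and hi_add: "f \<in> I \<Longrightarrow> g \<in> I \<Longrightarrow> f + g \<in> I"
    and hi_mult: "f \<in> I \<Longrightarrow> g \<in> Rg r \<Longrightarrow> g * f \<in> I"
    and hi_comp: "f \<in> I \<Longrightarrow> homog_component t f \<in> I"
  using assms unfolding homogeneous_ideal_iff by auto

lemma hi_subspace: "homogeneous_ideal r I \<Longrightarrow> pm.subspace I"
  unfolding pm.subspace_def smul_def by (auto simp: Rg_iff intro!: hi_zero hi_add hi_mult)

lemma hi_mult': "homogeneous_ideal r I \<Longrightarrow> f \<in> I \<Longrightarrow> g \<in> Rg r \<Longrightarrow> f * g \<in> I"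
  using hi_mult by (metis mult.commute)

lemma hi_diff: "homogeneous_ideal r I \<Longrightarrow> f \<in> I \<Longrightarrow> g \<in> I \<Longrightarrow> f - g \<in> I"
  using hi_subspace pm.subspace_diff by blast

lemma hi_sum: "homogeneous_ideal r I \<Longrightarrow> (\<And>x. x \<in> A \<Longrightarrow> f x \<in> I) \<Longrightarrow> sum f A \<in> I"
  using hi_subspace pm.subspace_sum by blast

lemma hi_comp_iff: "homogeneous_ideal r I \<Longrightarrow> f \<in> I \<longleftrightarrow> (\<forall>t. homog_component t f \<in> I)"
  using hi_comp hi_sum sum_homog_components[OF finite_imageI[OF finite_keys] order_refl]
  by metis

lemma hi_subsetI:
  assumes "homogeneous_ideal r I" "homogeneous_ideal r J" "\<And>t. I \<inter> homog t \<subseteq> J"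
  shows "I \<subseteq> J"
proof
  fix f assume "f \<in> I"
  then have "homog_component t f \<in> J" for t
    using assms(3) hi_comp[OF assms(1)] homog_component_homog by blast
  then show "f \<in> J" using hi_comp_iff[OF assms(2)] by blast
qed

text \<open>Together with \<open>adj\<close>, this gives the outer terms of \<open>0 \<rightarrow>
  R/(I : a)(-e) \<rightarrow> R/I \<rightarrow> R/(I + (a)) \<rightarrow> 0\<close> for
  \<open>a\<close> of degree \<open>e\<close>. Both ideals contain \<open>I\<close>, so Noetherian
  induction applies whenever they are strictly larger.\<close>

definition colon :: "nat \<Rightarrow> cpoly set \<Rightarrow> cpoly \<Rightarrow> cpoly set" where
  "colon r I a = {f \<in> Rg r. a * f \<in> I}"

definition adj :: "nat \<Rightarrow> cpoly set \<Rightarrow> cpoly \<Rightarrow> cpoly set" where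
  "adj r I a = I + a *o Rg r"

lemma colon_hi:
  assumes I: "homogeneous_ideal r I" and a: "a \<in> Rn r e"
  shows "homogeneous_ideal r (colon r I a)"
proof -
  have "homog_component t f \<in> colon r I a" if f: "f \<in> colon r I a" for f t
  proof -
    have "homog_component (e + t) (a * f) \<in> I" using f hi_comp[OF I] by (auto simp: colon_def)
    then show ?thesis using f a homog_component_Rg homog_component_mult[of a e "e + t" f] by (auto simp: colon_def)
  qed
  moreover have "a * (g * f) \<in> I" if "a * f \<in> I" "g \<in> Rg r" for f g
    using hi_mult[OF I that] by (simp add: mult.left_commute)
  ultimately show ?thesis
    unfolding homogeneous_ideal_iff
    by (auto simp: colon_def distrib_left hi_zero[OF I] Rg_add Rg_mult hi_add[OF I] hi_mult[OF I])
qed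

lemma colon_mono: "homogeneous_ideal r I \<Longrightarrow> a \<in> Rg r \<Longrightarrow> I \<subseteq> colon r I a"
  using hi_Rg hi_mult by (auto simp: colon_def)

lemma adj_hi:
  assumes I: "homogeneous_ideal r I" and a: "a \<in> Rn r e"
  shows "homogeneous_ideal r (adj r I a)"
  unfolding homogeneous_ideal_iff
proof (intro conjI ballI allI)
  show "adj r I a \<subseteq> Rg r"
    using a hi_Rg[OF I] by (auto simp: adj_def set_plus_def elt_set_times_def intro!: Rg_add Rg_mult)
  show "0 \<in> adj r I a" using set_plus_intro[OF hi_zero[OF I] set_times_intro2[OF Rg_zero]] by (simp add: adj_def)
  fix f assume f: "f \<in> adj r I a"
  then obtain i g where ig: "i \<in> I" "g \<in> Rg r" "f = i + a * g"
    by (auto simp: adj_def set_plus_def elt_set_times_def)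
  have in_adj: "i' + a * g' \<in> adj r I a" if "i' \<in> I" "g' \<in> Rg r" for i' g'
    using that by (auto simp: adj_def)
  { fix f' assume "f' \<in> adj r I a"
    then obtain i' g' where "i' \<in> I" "g' \<in> Rg r" "f' = i' + a * g'"
      by (auto simp: adj_def set_plus_def elt_set_times_def)
    then show "f + f' \<in> adj r I a" using in_adj[of "i + i'" "g + g'"] ig hi_add[OF I] Rg_add
      by (simp add: algebra_simps)
  next
    fix h assume "h \<in> Rg r"
    then show "h * f \<in> adj r I a" using in_adj[of "h * i" "h * g"] ig hi_mult[OF I] Rg_mult
      by (simp add: algebra_simps)
  next
    fix t
    show "homog_component t f \<in> adj r I a"
      using in_adj[of "homog_component t i" "if e \<le> t then homog_component (t - e) g else 0"] ig
        hi_comp[OF I] homog_component_Rg a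
      by (auto simp: homog_component_add homog_component_mult split: if_splits)
  }
qed

lemma adj_mono: "I \<subseteq> adj r I a"
  using set_plus_intro[OF _ set_times_intro2[OF Rg_zero], of _ I a r] by (auto simp: adj_def)

lemma adj_gen: "homogeneous_ideal r I \<Longrightarrow> a * g \<in> adj r I a" if "g \<in> Rg r"
  using set_plus_intro[OF hi_zero set_times_intro2[OF that], of r I a] by (auto simp: adj_def)

lemma adj_self: "homogeneous_ideal r I \<Longrightarrow> a \<in> adj r I a"
  using adj_gen[OF Rg_one, of r I a] by simp

lemma adj_least: "homogeneous_ideal r J \<Longrightarrow> I \<subseteq> J \<Longrightarrow> a \<in> J \<Longrightarrow> adj r I a \<subseteq> J"
  by (auto simp: adj_def set_plus_def elt_set_times_def intro!: hi_add hi_mult')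

lemma adj_elim:
  assumes "f \<in> adj r I a"
  obtains i g where "i \<in> I" "g \<in> Rg r" "f = i + a * g"
  using assms by (auto simp: adj_def set_plus_def elt_set_times_def)

text \<open>Components of degree \<open>t\<close> of any decomposition form a homogeneous one; below
  degree \<open>e\<close> the multiple of \<open>a\<close> drops out.\<close>

lemma adj_homog_elim:
  assumes I: "homogeneous_ideal r I" and a: "a \<in> Rn r e" and f: "f \<in> adj r I a" "f \<in> homog t"
  obtains i g where "i \<in> I \<inter> homog t" "f = i + a * g" "e \<le> t \<Longrightarrow> g \<in> Rn r (t - e)" "\<not> e \<le> t \<Longrightarrow> g = 0"
proof -
  obtain i g where ig: "i \<in> I" "g \<in> Rg r" "f = i + a * g" using f adj_elim by blast
  have "f = homog_component t i + a * (if e \<le> t then homog_component (t - e) g else 0)"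
    using homog_component_of_homog[OF f(2), of t] ig a by (auto simp: homog_component_add homog_component_mult split: if_splits)
  then show thesis
    using that[of "homog_component t i" "if e \<le> t then homog_component (t - e) g else 0"] hi_comp[OF I ig(1)]
      homog_component_homog homog_component_Rn[OF ig(2)] by auto
qed

lemma Rg_hi: "homogeneous_ideal r (Rg r)"
  unfolding homogeneous_ideal_iff by (auto intro: Rg_add Rg_mult homog_component_Rg)

lemma saturation_hi:
  assumes I: "homogeneous_ideal r I"
  shows "homogeneous_ideal r (saturation r I)"
proof -
  have up: "var i ^ k' * f \<in> I" if "var i ^ k * f \<in> I" "k \<le> k'" "i \<le> r" for i k k' f
  proof -
    have "var i ^ k' * f = var i ^ (k' - k) * (var i ^ k * f)"
      using that by (simp add: mult.assoc[symmetric] power_add[symmetric])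
    then show ?thesis using hi_mult[OF I that(1)] Rg_power Rg_var that by metis
  qed
  have "f + g \<in> saturation r I" if fg: "f \<in> saturation r I" "g \<in> saturation r I" for f g
  proof -
    obtain k l where k: "\<forall>i\<le>r. var i ^ k * f \<in> I" "\<forall>i\<le>r. var i ^ l * g \<in> I" "f \<in> Rg r" "g \<in> Rg r"
      using fg by (auto simp: saturation_def)
    then have "\<forall>i\<le>r. var i ^ max k l * (f + g) \<in> I"
      using up[OF _ max.cobounded1, of _ k f l] up[OF _ max.cobounded2, of _ l g k]
      by (auto simp: distrib_left hi_add[OF I])
    then show ?thesis using k Rg_add by (auto simp: saturation_def)
  qed
  moreover have "homog_component t f \<in> saturation r I" if f: "f \<in> saturation r I" for f t
  proof -
    obtain k where k: "\<forall>i\<le>r. var i ^ k * f \<in> I" "f \<in> Rg r" using f by (auto simp: saturation_def)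
    have "var i ^ k * homog_component t f \<in> I" if "i \<le> r" for i
    proof -
      have "var i ^ k \<in> homog k" using homog_power[OF homog_var, of i k] by simp
      then have "homog_component (k + t) (var i ^ k * f) = var i ^ k * homog_component t f"
        by (simp add: homog_component_mult)
      then show ?thesis using k that hi_comp[OF I] by metis
    qed
    then show ?thesis using k homog_component_Rg by (auto simp: saturation_def)
  qed
  moreover have "g * f \<in> saturation r I" if f: "f \<in> saturation r I" and g: "g \<in> Rg r" for f g
  proof -
    obtain k where k: "\<forall>i\<le>r. var i ^ k * f \<in> I" "f \<in> Rg r" using f by (auto simp: saturation_def)
    have "var i ^ k * (g * f) \<in> I" if "i \<le> r" for i
      using hi_mult[OF I _ g, of "var i ^ k * f"] k that by (simp add: mult.left_commute)
    then show ?thesis using k g Rg_mult by (auto simp: saturation_def)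
  qed
  ultimately show ?thesis
    unfolding homogeneous_ideal_iff using hi_zero[OF I] by (auto simp: saturation_def)
qed

lemma saturation_mono: "homogeneous_ideal r I \<Longrightarrow> I \<subseteq> saturation r I"
  using hi_Rg by (fastforce simp: saturation_def intro!: exI[of _ 0])

section \<open>Noetherian induction\<close>

text \<open>The maximum refers to the linear order that exponent vectors carry as a type; what
  matters is that addition of a fixed vector is monotone.\<close>

definition lead_mon :: "cpoly \<Rightarrow> (nat \<Rightarrow>\<^sub>0 nat)" where
  "lead_mon f = Max (Poly_Mapping.keys f)"

lemma lead_mon_in: "f \<noteq> 0 \<Longrightarrow> lead_mon f \<in> Poly_Mapping.keys f"
  by (simp add: lead_mon_def)

lemma keys_single_mult: "Poly_Mapping.keys (Poly_Mapping.single u (1::complex) * f) = (+) u ` Poly_Mapping.keys f"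
  for f :: cpoly
proof -
  have eq: "Poly_Mapping.single u 1 * f = (\<Sum>m\<in>Poly_Mapping.keys f. Poly_Mapping.single (u + m) (Poly_Mapping.lookup f m))"
    by (subst (1) poly_mapping_sum_singles) (simp add: sum_distrib_left mult_single)
  have l: "Poly_Mapping.lookup (Poly_Mapping.single u 1 * f) k
      = (\<Sum>m\<in>Poly_Mapping.keys f. if u + m = k then Poly_Mapping.lookup f m else 0)" for k
    by (simp add: eq lookup_sum lookup_single when_def)
  have l1: "Poly_Mapping.lookup (Poly_Mapping.single u 1 * f) (u + k) = Poly_Mapping.lookup f k" for k
    by (simp add: l in_keys_iff)
  have l2: "Poly_Mapping.lookup (Poly_Mapping.single u 1 * f) k = 0" if "k \<notin> (+) u ` Poly_Mapping.keys f" for k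
    unfolding l using that by (intro sum.neutral) auto
  show ?thesis
  proof
    show "Poly_Mapping.keys (Poly_Mapping.single u 1 * f) \<subseteq> (+) u ` Poly_Mapping.keys f"
      using l2 by (auto simp: in_keys_iff)
    show "(+) u ` Poly_Mapping.keys f \<subseteq> Poly_Mapping.keys (Poly_Mapping.single u 1 * f)"
      using l1 by (auto simp: in_keys_iff)
  qed
qed

lemma lead_mon_single_mult:
  assumes "f \<noteq> 0"
  shows "lead_mon (Poly_Mapping.single u 1 * f) = u + lead_mon f"
  unfolding lead_mon_def keys_single_mult
  by (rule mono_Max_commute[symmetric]) (use assms in \<open>auto intro: monoI add_left_mono\<close>)

text \<open>A monotone subsequence exists, and a nonincreasing sequence of naturals is constant from
  its minimum on.\<close>

lemma nat_seq_incseq_subseq: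
  fixes s :: "nat \<Rightarrow> nat"
  obtains \<phi> :: "nat \<Rightarrow> nat" where "strict_mono \<phi>" "mono (s \<circ> \<phi>)"
proof -
  obtain f where f: "strict_mono f" "monoseq (\<lambda>n. s (f n))" using seq_monosub[of s] by blast
  from f(2) consider "mono (\<lambda>n. s (f n))" | "antimono (\<lambda>n. s (f n))"
    unfolding monoseq_iff by blast
  then show thesis
  proof cases
    case 1
    then show ?thesis using that[of f] f(1) by (simp add: o_def)
  next
    case 2
    define N where "N = (ARG_MIN (\<lambda>n. s (f n)) n. True)"
    have N: "s (f N) \<le> s (f n)" for n unfolding N_def by (rule arg_min_nat_le) simp
    have "s (f (n + N)) = s (f N)" for n
      using N[of "n + N"] antimonoD[OF 2, of N "n + N"] by simp
    then have "mono (s \<circ> (\<lambda>n. f (n + N)))" by (intro monoI) simp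
    moreover have "strict_mono (\<lambda>n. f (n + N))" using f(1) by (auto simp: strict_mono_def)
    ultimately show ?thesis using that by blast
  qed
qed

text \<open>Subsequences extracted for one variable after the other make all exponents nondecreasing
  at once; then the second monomial is a multiple of the first.\<close>

lemma dickson:
  fixes m :: "nat \<Rightarrow> nat \<Rightarrow>\<^sub>0 nat"
  assumes "\<And>n. Poly_Mapping.keys (m n) \<subseteq> {..r}"
  obtains i j u where "i < j" "m j = u + m i" "Poly_Mapping.keys u \<subseteq> {..r}"
proof -
  have "\<exists>\<phi> :: nat \<Rightarrow> nat. strict_mono \<phi> \<and> (\<forall>i<k. mono (\<lambda>n. Poly_Mapping.lookup (m (\<phi> n)) i))" for k
  proof (induction k)
    case (Suc k)
    then obtain \<phi> :: "nat \<Rightarrow> nat" where \<phi>: "strict_mono \<phi>" "\<forall>i<k. mono (\<lambda>n. Poly_Mapping.lookup (m (\<phi> n)) i)" by blast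
    obtain \<psi> :: "nat \<Rightarrow> nat" where \<psi>: "strict_mono \<psi>" "mono ((\<lambda>n. Poly_Mapping.lookup (m (\<phi> n)) k) \<circ> \<psi>)"
      using nat_seq_incseq_subseq by blast
    have "mono (\<lambda>n. Poly_Mapping.lookup (m ((\<phi> \<circ> \<psi>) n)) i)" if "i < Suc k" for i
    proof (cases "i = k")
      case False
      then have "mono (\<lambda>n. Poly_Mapping.lookup (m (\<phi> n)) i)" using \<phi> that by auto
      then show ?thesis using strict_mono_mono[OF \<psi>(1)] by (auto simp: mono_def)
    qed (use \<psi> in \<open>simp add: o_def\<close>)
    then show ?case using strict_mono_o[OF \<phi>(1) \<psi>(1)] by blast
  qed (auto intro!: exI[of _ id] simp: strict_mono_def)
  then obtain \<phi> :: "nat \<Rightarrow> nat" where \<phi>: "strict_mono \<phi>" "\<forall>i<Suc r. mono (\<lambda>n. Poly_Mapping.lookup (m (\<phi> n)) i)" by blast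
  have le: "Poly_Mapping.lookup (m (\<phi> 0)) i \<le> Poly_Mapping.lookup (m (\<phi> 1)) i" for i
  proof (cases "i \<le> r")
    case True
    then show ?thesis using \<phi>(2) by (auto simp: mono_def)
  next
    case False
    then have "i \<notin> Poly_Mapping.keys (m (\<phi> 0))" using assms by auto
    then show ?thesis by (simp add: in_keys_iff)
  qed
  show thesis
  proof (rule that[of "\<phi> 0" "\<phi> 1" "m (\<phi> 1) - m (\<phi> 0)"])
    show "\<phi> 0 < \<phi> 1" using \<phi>(1) by (simp add: strict_mono_def)
    show "m (\<phi> 1) = m (\<phi> 1) - m (\<phi> 0) + m (\<phi> 0)"
      using le by (intro poly_mapping_eqI) (simp add: lookup_add lookup_minus)
    show "Poly_Mapping.keys (m (\<phi> 1) - m (\<phi> 0)) \<subseteq> {..r}"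
      using assms[of "\<phi> 1"] by (auto simp: in_keys_iff lookup_minus subset_eq)
  qed
qed

definition lead_mons :: "cpoly set \<Rightarrow> (nat \<Rightarrow>\<^sub>0 nat) set" where
  "lead_mons I = lead_mon ` {f \<in> I. f \<noteq> 0 \<and> (\<exists>t. f \<in> homog t)}"

text \<open>Among the homogeneous elements of \<open>J - I\<close> of some fixed degree, choose
  \<open>f\<close> with the least leading monomial. If some \<open>g\<close> in \<open>I\<close> had
  the same leading monomial, subtracting a multiple of \<open>g\<close> would leave an element of
  \<open>J - I\<close> with a smaller one.\<close>

lemma exists_new_lead_mon:
  assumes I: "homogeneous_ideal r I" and J: "homogeneous_ideal r J" and IJ: "I \<subset> J"
  shows "\<exists>f\<in>J. f \<noteq> 0 \<and> (\<exists>t. f \<in> homog t) \<and> lead_mon f \<notin> lead_mons I"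
proof -
  obtain t where t: "\<not> J \<inter> homog t \<subseteq> I" using hi_subsetI[OF J I] IJ by blast
  let ?S = "lead_mon ` (J \<inter> homog t - I)"
  have ne: "?S \<noteq> {}" using t by auto
  have nz: "f \<noteq> 0" if "f \<notin> I" for f using that hi_zero[OF I] by auto
  have "?S \<subseteq> monomials r t"
  proof
    fix m assume "m \<in> ?S"
    then obtain f where "f \<in> J" "f \<in> homog t" "f \<notin> I" "m = lead_mon f" by auto
    then show "m \<in> monomials r t" using lead_mon_in[OF nz] hi_Rg[OF J] Rn_monomials[of f r t] by blast
  qed
  then have fin: "finite ?S" using finite_monomials finite_subset by blast
  then have "Min ?S \<in> ?S" using ne by simp
  then obtain f where f: "f \<in> J" "f \<in> homog t" "f \<notin> I" "lead_mon f = Min ?S" by auto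
  have "lead_mon f \<notin> lead_mons I"
  proof
    assume "lead_mon f \<in> lead_mons I"
    then obtain g u where g: "g \<in> I" "g \<noteq> 0" "g \<in> homog u" "lead_mon g = lead_mon f" by (auto simp: lead_mons_def)
    have "u = t" using lead_mon_in[OF g(2)] lead_mon_in[OF nz[OF f(3)]] g f by (auto simp: homog_def)
    define c where "c = Poly_Mapping.lookup f (lead_mon f) / Poly_Mapping.lookup g (lead_mon f)"
    define h where "h = f - smul c g"
    have cI: "smul c g \<in> I" using g hi_subspace[OF I] pm.subspace_scale by blast
    have hJ: "h \<in> J \<inter> homog t" unfolding h_def
      using f g cI IJ \<open>u = t\<close> hi_diff[OF J, of f "smul c g"]
        pm.subspace_diff[OF homog_subspace, of f t "smul c g"] pm.subspace_scale[OF homog_subspace, of g t c]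
      by auto
    have hI: "h \<notin> I"
    proof
      assume "h \<in> I"
      then have "h + smul c g \<in> I" using hi_add[OF I] cI by blast
      then show False using f by (simp add: h_def)
    qed
    have "Poly_Mapping.lookup g (lead_mon f) \<noteq> 0" using lead_mon_in[OF g(2)] g by (simp add: in_keys_iff)
    then have "Poly_Mapping.lookup h (lead_mon f) = 0" by (simp add: h_def c_def lookup_minus lookup_smul)
    then have ne: "lead_mon h \<noteq> lead_mon f" using lead_mon_in[OF nz[OF hI]] by (metis in_keys_iff)
    have "Poly_Mapping.keys h \<subseteq> Poly_Mapping.keys f \<union> Poly_Mapping.keys g"
      by (auto simp: h_def in_keys_iff lookup_minus lookup_smul)
    then have "lead_mon h \<in> Poly_Mapping.keys f \<or> lead_mon h \<in> Poly_Mapping.keys g" using lead_mon_in[OF nz[OF hI]] by auto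
    then have "lead_mon h \<le> lead_mon f" using g(4) by (metis Max_ge finite_keys lead_mon_def)
    moreover have "lead_mon f \<le> lead_mon h" using f(4) fin hJ hI by auto
    ultimately show False using ne by simp
  qed
  then show ?thesis using f nz by blast
qed

text \<open>Each step of an infinite ascending chain contributes a leading monomial that is new at
  that step. By Dickson one of them is a multiple of an earlier one, so it was a leading monomial
  already.\<close>

lemma wf_homogeneous_ideals:
  "wf {(J, I). homogeneous_ideal r I \<and> homogeneous_ideal r J \<and> I \<subset> J}"
  unfolding wf_iff_no_infinite_down_chain
proof (rule notI, elim exE)
  fix K assume K: "\<forall>i. (K (Suc i), K i) \<in> {(J, I). homogeneous_ideal r I \<and> homogeneous_ideal r J \<and> I \<subset> J}"
  then have hi: "homogeneous_ideal r (K i)" and sub: "K i \<subset> K (Suc i)" for i by auto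
  have "K i \<le> K (Suc i)" for i using sub[of i] by blast
  then have mono: "i \<le> j \<Longrightarrow> K i \<subseteq> K j" for i j by (rule lift_Suc_mono_le)
  have "\<forall>i. \<exists>f. f \<in> K (Suc i) \<and> f \<noteq> 0 \<and> (\<exists>t. f \<in> homog t) \<and> lead_mon f \<notin> lead_mons (K i)"
    using exists_new_lead_mon[OF hi hi sub] by blast
  then obtain f where f: "\<And>i. f i \<in> K (Suc i)" "\<And>i. f i \<noteq> 0" "\<And>i. \<exists>t. f i \<in> homog t" "\<And>i. lead_mon (f i) \<notin> lead_mons (K i)"
    by metis
  have keys: "Poly_Mapping.keys (lead_mon (f n)) \<subseteq> {..r}" for n
  proof -
    have "f n \<in> Rg r" using f(1)[of n] hi_Rg[OF hi, of "Suc n"] by blast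
    then show ?thesis using lead_mon_in[OF f(2)[of n]] by (simp add: Rg_iff)
  qed
  obtain i j u where ij: "i < j" "lead_mon (f j) = u + lead_mon (f i)" "Poly_Mapping.keys u \<subseteq> {..r}"
    using dickson[of "\<lambda>n. lead_mon (f n)", OF keys] by blast
  let ?g = "Poly_Mapping.single u 1 * f i"
  have "Poly_Mapping.single u 1 \<in> Rg r" using ij by (simp add: Rg_iff)
  moreover have "f i \<in> K j" using f(1)[of i] mono[of "Suc i" j] ij by auto
  ultimately have "?g \<in> K j" using hi_mult[OF hi] by blast
  moreover obtain t where "f i \<in> homog t" using f(3) by blast
  then have "?g \<in> homog (mon_deg u + t)" by (intro homog_mult) (auto simp: homog_def)
  moreover have "?g \<noteq> 0" using f(2)[of i] keys_single_mult[of u "f i"] by (metis image_is_empty keys_eq_empty keys_zero lead_mon_in empty_iff)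
  ultimately have "lead_mon ?g \<in> lead_mons (K j)" by (auto simp: lead_mons_def)
  then show False using f(4)[of j] lead_mon_single_mult[OF f(2)] ij by simp
qed

lemma hi_induct [consumes 1, case_names step]:
  assumes I: "homogeneous_ideal r I"
    and step: "\<And>I. homogeneous_ideal r I \<Longrightarrow> (\<And>J. homogeneous_ideal r J \<Longrightarrow> I \<subset> J \<Longrightarrow> P J) \<Longrightarrow> P I"
  shows "P I"
  using I
proof (induction I rule: wf_induct_rule[OF wf_homogeneous_ideals[of r]])
  case (1 I)
  then show ?case using step[of I] by auto
qed

lemma primeideal_coord_ring_iff:
  assumes "homogeneous_ideal r I"
  shows "primeideal I (coord_ring r) \<longleftrightarrow>
    I \<noteq> Rg r \<and> (\<forall>a\<in>Rg r. \<forall>b\<in>Rg r. a * b \<in> I \<longrightarrow> a \<in> I \<or> b \<in> I)"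
proof
  assume "primeideal I (coord_ring r)"
  then interpret primeideal I "coord_ring r" .
  show "I \<noteq> Rg r \<and> (\<forall>a\<in>Rg r. \<forall>b\<in>Rg r. a * b \<in> I \<longrightarrow> a \<in> I \<or> b \<in> I)"
    using I_notcarr I_prime by (auto simp: coord_ring_simps)
next
  assume "I \<noteq> Rg r \<and> (\<forall>a\<in>Rg r. \<forall>b\<in>Rg r. a * b \<in> I \<longrightarrow> a \<in> I \<or> b \<in> I)"
  then show "primeideal I (coord_ring r)"
    using assms by (intro primeidealI cring_coord_ring) (auto simp: homogeneous_ideal_def coord_ring_simps)
qed

text \<open>Take the components of highest degree of \<open>a\<close> and of \<open>b\<close>
  outside \<open>I\<close>: in the corresponding component of \<open>a * b\<close> every other
  product has a factor in \<open>I\<close>. Hence a failure of primality is witnessed by homogeneous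
  elements, to which \<open>colon\<close> and \<open>adj\<close> apply.\<close>

lemma prime_or_split:
  assumes I: "homogeneous_ideal r I"
  obtains (prime) "primeideal I (coord_ring r)"
  | (whole) "I = Rg r"
  | (split) a b s t where "a \<in> Rn r s" "b \<in> Rn r t" "a \<notin> I" "b \<notin> I" "a * b \<in> I"
proof -
  have "\<exists>a b s t. a \<in> Rn r s \<and> b \<in> Rn r t \<and> a \<notin> I \<and> b \<notin> I \<and> a * b \<in> I"
    if np: "\<not> primeideal I (coord_ring r)" and nw: "I \<noteq> Rg r"
  proof -
    obtain a b where ab: "a \<in> Rg r" "b \<in> Rg r" "a * b \<in> I" "a \<notin> I" "b \<notin> I"
      using np nw primeideal_coord_ring_iff[OF I] by blast
    have top: "\<exists>t. homog_component t a \<notin> I \<and> (\<forall>u>t. homog_component u a \<in> I)" if "a \<notin> I" for a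
    proof -
      let ?T = "{t. homog_component t a \<notin> I}"
      have "?T \<subseteq> mon_deg ` Poly_Mapping.keys a"
      proof
        fix t assume "t \<in> ?T"
        then have "homog_component t a \<noteq> 0" using hi_zero[OF I] by auto
        then obtain m where "Poly_Mapping.lookup (homog_component t a) m \<noteq> 0"
          by (metis poly_mapping_eqI lookup_zero)
        then show "t \<in> mon_deg ` Poly_Mapping.keys a"
          by (auto simp: lookup_homog_component in_keys_iff split: if_splits)
      qed
      then have fin: "finite ?T" by (rule finite_subset) simp
      have "?T \<noteq> {}" using that hi_comp_iff[OF I, of a] by blast
      then have "Max ?T \<in> ?T" using fin by (rule Max_in[rotated])
      moreover have "\<forall>u>Max ?T. homog_component u a \<in> I" using fin by (metis Max_ge mem_Collect_eq leD)
      ultimately show ?thesis by blast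
    qed
    obtain t where t: "homog_component t a \<notin> I" "\<And>u. u > t \<Longrightarrow> homog_component u a \<in> I" using top[OF ab(4)] by blast
    obtain s where s: "homog_component s b \<notin> I" "\<And>u. u > s \<Longrightarrow> homog_component u b \<in> I" using top[OF ab(5)] by blast
    let ?A = "insert t (mon_deg ` Poly_Mapping.keys a)"
    have "a * b = (\<Sum>i\<in>?A. homog_component i a * b)"
      using sum_homog_components[of ?A a] by (simp add: sum_distrib_right[symmetric] subset_insertI)
    then have "homog_component (t + s) (a * b) = (\<Sum>i\<in>?A. if i \<le> t + s then homog_component i a * homog_component (t + s - i) b else 0)"
      by (simp only: homog_component_sum homog_component_mult[OF homog_component_homog])
    also have "\<dots> = homog_component t a * homog_component s b
        + (\<Sum>i\<in>?A - {t}. if i \<le> t + s then homog_component i a * homog_component (t + s - i) b else 0)"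
      by (subst sum.remove[of _ t]) auto
    finally have "homog_component t a * homog_component s b = homog_component (t + s) (a * b)
        - (\<Sum>i\<in>?A - {t}. if i \<le> t + s then homog_component i a * homog_component (t + s - i) b else 0)"
      by simp
    also have "\<dots> \<in> I"
    proof (intro hi_diff[OF I] hi_comp[OF I] ab hi_sum[OF I])
      fix i assume i: "i \<in> ?A - {t}"
      show "(if i \<le> t + s then homog_component i a * homog_component (t + s - i) b else 0) \<in> I"
      proof (cases "i \<le> t + s")
        case True
        from i consider "i > t" | "i < t" by fastforce
        then show ?thesis
        proof cases
          case 1
          then show ?thesis using True t(2) hi_mult'[OF I] homog_component_Rg[OF ab(2)] by simp
        next
          case 2
          then have "t + s - i > s" by simp
          then show ?thesis using True s(2) hi_mult[OF I] homog_component_Rg[OF ab(1)] by simp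
        qed
      qed (use hi_zero[OF I] in simp)
    qed
    finally show ?thesis using t s homog_component_Rn ab by blast
  qed
  then show thesis using that by blast
qed

section \<open>Laurent polynomials\<close>

abbreviation \<iota> :: "(nat \<Rightarrow>\<^sub>0 nat) \<Rightarrow> (nat \<Rightarrow>\<^sub>0 int)" where "\<iota> \<equiv> Poly_Mapping.map int"

lemma lookup_iota: "Poly_Mapping.lookup (\<iota> m) i = int (Poly_Mapping.lookup m i)"
  by (simp add: Poly_Mapping.map.rep_eq when_def)

lemma iota_add: "\<iota> (m + m') = \<iota> m + \<iota> m'"
  by (rule poly_mapping_eqI) (simp add: lookup_iota lookup_add)

lemma iota_inj: "\<iota> m = \<iota> m' \<longleftrightarrow> m = m'"
  by (metis lookup_iota of_nat_eq_iff poly_mapping_eqI)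

lemma mon_deg_iota: "mon_deg (\<iota> m) = int (mon_deg m)"
proof -
  have "Poly_Mapping.keys (\<iota> m) = Poly_Mapping.keys m" by (auto simp: in_keys_iff lookup_iota)
  then show ?thesis by (simp add: mon_deg_def lookup_iota)
qed

lemma lookup_laurent_of:
  "Poly_Mapping.lookup (laurent_of f) k = (\<Sum>m\<in>Poly_Mapping.keys f. if \<iota> m = k then Poly_Mapping.lookup f m else 0)"
  by (simp add: laurent_of_def lookup_sum lookup_single when_def)

lemma lookup_laurent_of_iota: "Poly_Mapping.lookup (laurent_of f) (\<iota> m) = Poly_Mapping.lookup f m"
  by (simp add: lookup_laurent_of iota_inj in_keys_iff)

lemma laurent_of_eqI:
  assumes "\<And>m. Poly_Mapping.lookup g (\<iota> m) = Poly_Mapping.lookup f m" "\<And>k. k \<notin> Set.range \<iota> \<Longrightarrow> Poly_Mapping.lookup g k = 0"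
  shows "g = laurent_of f"
proof (rule poly_mapping_eqI)
  fix k
  show "Poly_Mapping.lookup g k = Poly_Mapping.lookup (laurent_of f) k"
  proof (cases "k \<in> Set.range \<iota>")
    case False
    then have "Poly_Mapping.lookup (laurent_of f) k = 0" unfolding lookup_laurent_of by (intro sum.neutral) auto
    then show ?thesis using assms(2)[OF False] by simp
  qed (use assms(1) lookup_laurent_of_iota in auto)
qed

lemma lookup_laurent_of_outside: "k \<notin> Set.range \<iota> \<Longrightarrow> Poly_Mapping.lookup (laurent_of f) k = 0"
  unfolding lookup_laurent_of by (intro sum.neutral) auto

lemma laurent_of_inj [simp]: "laurent_of f = laurent_of g \<longleftrightarrow> f = g"
  by (metis lookup_laurent_of_iota poly_mapping_eqI)

lemma laurent_of_add: "laurent_of (f + g) = laurent_of f + laurent_of g"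
  by (rule laurent_of_eqI[symmetric]) (simp_all add: lookup_add lookup_laurent_of_iota lookup_laurent_of_outside)

lemma laurent_of_smul: "laurent_of (smul a f) = smul a (laurent_of f)"
  by (rule laurent_of_eqI[symmetric]) (simp_all add: lookup_smul lookup_laurent_of_iota lookup_laurent_of_outside)

lemma laurent_of_single: "laurent_of (Poly_Mapping.single m c) = Poly_Mapping.single (\<iota> m) c"
  by (cases "c = 0") (simp_all add: laurent_of_def)

lemma laurent_of_zero [simp]: "laurent_of 0 = 0"
  by (simp add: laurent_of_def)

lemma laurent_of_one [simp]: "laurent_of 1 = 1"
  using laurent_of_single[of 0 1] by (simp add: poly_mapping_eq_iff fun_eq_iff lookup_iota lookup_single when_def lookup_one)

lemma laurent_of_sum: "laurent_of (sum f A) = (\<Sum>a\<in>A. laurent_of (f a))"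
  by (induction A rule: infinite_finite_induct) (simp_all add: laurent_of_add)

lemma laurent_of_mult: "laurent_of (f * g) = laurent_of f * laurent_of g"
proof -
  have "f * g = (\<Sum>m\<in>Poly_Mapping.keys f. \<Sum>m'\<in>Poly_Mapping.keys g.
      Poly_Mapping.single (m + m') (Poly_Mapping.lookup f m * Poly_Mapping.lookup g m'))"
    by (subst poly_mapping_sum_singles[of f], subst poly_mapping_sum_singles[of g])
      (simp add: sum_product mult_single)
  then show ?thesis
    by (simp add: laurent_of_sum laurent_of_single iota_add)
      (simp add: laurent_of_def sum_product mult_single)
qed

lemma laurent_of_power: "laurent_of (f ^ k) = laurent_of f ^ k"
  by (induction k) (simp_all add: laurent_of_mult)

lemma laurent_of_homog_iff: "laurent_of f \<in> homog (int n) \<longleftrightarrow> f \<in> homog n"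
proof -
  have "Poly_Mapping.keys (laurent_of f) = \<iota> ` Poly_Mapping.keys f"
  proof
    show "Poly_Mapping.keys (laurent_of f) \<subseteq> \<iota> ` Poly_Mapping.keys f"
    proof
      fix k assume k: "k \<in> Poly_Mapping.keys (laurent_of f)"
      then obtain m where "k = \<iota> m" using lookup_laurent_of_outside[of k f] by (auto simp: in_keys_iff)
      then show "k \<in> \<iota> ` Poly_Mapping.keys f" using k by (auto simp: in_keys_iff lookup_laurent_of_iota)
    qed
    show "\<iota> ` Poly_Mapping.keys f \<subseteq> Poly_Mapping.keys (laurent_of f)"
      by (auto simp: in_keys_iff lookup_laurent_of_iota)
  qed
  then show ?thesis by (auto simp: homog_def mon_deg_iota)
qed

lemma laurent_of_homog_neg: "laurent_of f \<in> homog n \<Longrightarrow> n < 0 \<Longrightarrow> f = 0"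
proof -
  assume n: "laurent_of f \<in> homog n" "n < 0"
  have "m \<notin> Poly_Mapping.keys f" for m
  proof
    assume "m \<in> Poly_Mapping.keys f"
    then have "\<iota> m \<in> Poly_Mapping.keys (laurent_of f)" by (simp add: in_keys_iff lookup_laurent_of_iota)
    then show False using n by (auto simp: homog_def mon_deg_iota)
  qed
  then show "f = 0" by (metis keys_eq_empty equals0I lookup_zero poly_mapping_eqI in_keys_iff)
qed

text \<open>Each monomial of positive degree contains a variable. Generation in degree one is what
  lets statements propagate from degree \<open>n\<close> to \<open>n + 1\<close>.\<close>

lemma Rn_Suc_subset:
  "Rn r (Suc n) \<subseteq> (\<Sum>i\<le>r. var i *o Rn r n)"
proof
  fix f assume f: "f \<in> Rn r (Suc n)"
  have sub: "pm.subspace (var i *o Rn r n)" for i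
    unfolding pm.subspace_def elt_set_times_def
    using pm.subspace_0[OF Rn_subspace] pm.subspace_add[OF Rn_subspace] pm.subspace_scale[OF Rn_subspace]
    by (auto simp: distrib_left[symmetric] smul_mult_right[symmetric]) 
  have "Poly_Mapping.single m (Poly_Mapping.lookup f m) \<in> (\<Sum>i\<le>r. var i *o Rn r n)" if m: "m \<in> Poly_Mapping.keys f" for m
  proof -
    have mm: "m \<in> monomials r (Suc n)" using f m Rn_monomials by blast
    then have "m \<noteq> 0" by (auto simp: monomials_def)
    then obtain i where i: "i \<in> Poly_Mapping.keys m" by (metis keys_eq_empty equals0I lookup_zero poly_mapping_eqI in_keys_iff)
    define m' where "m' = m - Poly_Mapping.single i 1"
    have m': "m = Poly_Mapping.single i 1 + m'"
      using i by (intro poly_mapping_eqI) (auto simp: m'_def lookup_add lookup_minus lookup_single when_def in_keys_iff)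
    have "Poly_Mapping.keys m' \<subseteq> {..r}" using mm by (auto simp: monomials_def m'_def in_keys_iff lookup_minus subset_eq)
    moreover have "mon_deg m' = n" using mm m' by (simp add: monomials_def mon_deg_add)
    ultimately have "Poly_Mapping.single m' (Poly_Mapping.lookup f m) \<in> Rn r n"
      by (auto simp: Rg_iff homog_def)
    moreover have "Poly_Mapping.single m (Poly_Mapping.lookup f m) = var i * Poly_Mapping.single m' (Poly_Mapping.lookup f m)"
      unfolding var_def mult_single m'[symmetric] by simp
    ultimately have "Poly_Mapping.single m (Poly_Mapping.lookup f m) \<in> var i *o Rn r n" by auto
    moreover have "i \<le> r" using i mm by (auto simp: monomials_def)
    ultimately show ?thesis using pm.subset_set_sum[of "{..r}" "\<lambda>i. var i *o Rn r n" i] sub by auto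
  qed
  then show "f \<in> (\<Sum>i\<le>r. var i *o Rn r n)"
    using sub by (subst poly_mapping_sum_singles) (intro pm.subspace_sum pm.subspace_set_sum, auto)
qed

section \<open>Cohomology of complexes modulo subcomplexes\<close>

context relative_dim
begin

lemma subspace_image: "Vector_Spaces.linear scale scale f \<Longrightarrow> subspace A \<Longrightarrow> subspace (f ` A)"
proof -
  assume f: "Vector_Spaces.linear scale scale f" and A: "subspace A"
  interpret f: Vector_Spaces.linear scale scale f by fact
  show ?thesis using f.subspace_image[OF A] .
qed

text \<open>Elements of the quotient complex \<open>V / W\<close> are represented in
  \<open>V\<close>, so the differential of a cocycle only has to fall into \<open>W\<close>. Integer
  degrees keep \<open>q - 1\<close> meaningful at the left end.\<close>

definition cyc :: "('b \<Rightarrow> 'b) \<Rightarrow> (int \<Rightarrow> 'b set) \<Rightarrow> (int \<Rightarrow> 'b set) \<Rightarrow> int \<Rightarrow> 'b set" where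
  "cyc d V W q = {c \<in> V q. d c \<in> W (q + 1)}"

definition bnd :: "('b \<Rightarrow> 'b) \<Rightarrow> (int \<Rightarrow> 'b set) \<Rightarrow> (int \<Rightarrow> 'b set) \<Rightarrow> int \<Rightarrow> 'b set" where
  "bnd d V W q = d ` V (q - 1) + W q"

lemma
  assumes d: "Vector_Spaces.linear scale scale d" and V: "\<And>q. subspace (V q)" and W: "\<And>q. subspace (W q)"
  shows cyc_subspace: "subspace (cyc d V W q)" and bnd_subspace: "subspace (bnd d V W q)"
proof -
  interpret d: Vector_Spaces.linear scale scale d by fact
  show "subspace (cyc d V W q)" unfolding cyc_def subspace_def
    using subspace_0[OF V] subspace_0[OF W] subspace_add[OF V] subspace_add[OF W] subspace_scale[OF V] subspace_scale[OF W]
    by (auto simp: d.add d.scale d.zero)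
  show "subspace (bnd d V W q)" unfolding bnd_def
    by (intro subspace_plus subspace_image d V W)
qed

text \<open>
  The long exact sequence of \<open>0 \<rightarrow> U/(U \<inter> W) \<rightarrow> V/W \<rightarrow> V/(U + W) \<rightarrow> 0\<close>, split into the
  dimensions of the images of its three kinds of maps.
\<close>

lemma long_exact_sequence:
  fixes V W U :: "int \<Rightarrow> 'b set"
  assumes d: "Vector_Spaces.linear scale scale d"
    and V: "\<And>q. subspace (V q)" and W: "\<And>q. subspace (W q)" and U: "\<And>q. subspace (U q)"
    and WV: "\<And>q. W q \<subseteq> V q" and UV: "\<And>q. U q \<subseteq> V q"
    and dV: "\<And>q c. c \<in> V q \<Longrightarrow> d c \<in> V (q + 1)" and dW: "\<And>q c. c \<in> W q \<Longrightarrow> d c \<in> W (q + 1)"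
    and dU: "\<And>q c. c \<in> U q \<Longrightarrow> d c \<in> U (q + 1)" and dd: "\<And>c. d (d c) = 0"
  defines "UW \<equiv> \<lambda>q. U q \<inter> W q" and "QW \<equiv> \<lambda>q. U q + W q"
  defines "\<alpha> \<equiv> \<lambda>q. rd (cyc d U UW q) (bnd d V W q)"
    and "\<beta> \<equiv> \<lambda>q. rd (cyc d V W q) (bnd d V QW q)"
    and "\<rho> \<equiv> \<lambda>q. rd (cyc d U UW (q + 1) \<inter> bnd d V W (q + 1)) (bnd d U UW (q + 1))"
  shows "rd (cyc d U UW q) (bnd d U UW q) = \<alpha> q + \<rho> (q - 1)"
    and "rd (cyc d V QW q) (bnd d V QW q) = \<beta> q + \<rho> q"
    and "rd (cyc d V W q) (bnd d V W q) = \<alpha> q + \<beta> q"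
proof -
  interpret d: Vector_Spaces.linear scale scale d by fact
  have UW: "subspace (UW q)" for q unfolding UW_def using U W subspace_inter by blast
  have QW: "subspace (QW q)" for q unfolding QW_def using U W subspace_plus by blast
  note sub = cyc_subspace[OF d] bnd_subspace[OF d]
  have WQ: "W q \<subseteq> QW q" and UQ: "U q \<subseteq> QW q" for q
    unfolding QW_def using subset_plus_right[OF U] subset_plus_left[OF W] by auto
  have dVim: "d ` V (q - 1) \<subseteq> V q" and dUim: "d ` U (q - 1) \<subseteq> U q" for q
    using dV[of _ "q - 1"] dU[of _ "q - 1"] by auto
  have bndV: "bnd d V W q \<subseteq> V q" for q
    unfolding bnd_def using dVim WV V by (intro plus_subset) auto
  have b: "d x + w \<in> bnd d V W q" if "x \<in> V (q - 1)" "w \<in> W q" for x w q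
    using that unfolding bnd_def by auto
  have zero: "0 \<in> V q" "0 \<in> W q" "0 \<in> U q" for q using V W U subspace_0 by blast+

  \<comment> \<open>\<open>\<alpha> q\<close> is the rank of the map from the cohomology of the
    subcomplex to that of \<open>V / W\<close>, \<open>\<beta> q\<close> the rank of the map on to
    the quotient complex, and \<open>\<rho> q\<close> the rank of the connecting map from degree
    \<open>q\<close> of the quotient to degree \<open>q + 1\<close> of the subcomplex.\<close>
  have UZ: "cyc d U UW q \<subseteq> cyc d V W q" for q
    using UV unfolding cyc_def UW_def by auto
  have BQ: "v \<in> cyc d U UW q + bnd d V W q \<longleftrightarrow> v \<in> bnd d V QW q" if v: "v \<in> cyc d V W q" for v q
  proof
    assume "v \<in> cyc d U UW q + bnd d V W q"
    then obtain u x w where "u \<in> U q" "x \<in> V (q - 1)" "w \<in> W q" "v = u + (d x + w)"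
      by (auto simp: set_plus_def cyc_def bnd_def)
    then have "v = d x + (u + w)" "u + w \<in> QW q" by (auto simp: QW_def)
    then show "v \<in> bnd d V QW q" using \<open>x \<in> V (q - 1)\<close> by (auto simp: bnd_def)
  next
    assume "v \<in> bnd d V QW q"
    then obtain x u w where x: "x \<in> V (q - 1)" "u \<in> U q" "w \<in> W q" "v = d x + (u + w)"
      by (auto simp: set_plus_def QW_def bnd_def)
    have "d u = d v - d w" using x(4) by (simp add: d.add dd)
    then have "d u \<in> W (q + 1)" using v dW[OF x(3)] W subspace_diff by (auto simp: cyc_def)
    then have "u \<in> cyc d U UW q" using x(2) dU by (auto simp: cyc_def UW_def)
    moreover have "v = u + (d x + w)" using x(4) by (simp add: ac_simps)
    ultimately show "v \<in> cyc d U UW q + bnd d V W q" using b[OF x(1,3)] by auto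
  qed
  show "rd (cyc d V W q) (bnd d V W q) = \<alpha> q + \<beta> q"
  proof -
    have "rd (cyc d V W q) (bnd d V W q)
      = \<alpha> q + rd (cyc d V W q) (cyc d U UW q + bnd d V W q)"
      unfolding \<alpha>_def by (intro rd_chain sub V W U UW UZ)
    also have "rd (cyc d V W q) (cyc d U UW q + bnd d V W q) = \<beta> q"
      unfolding \<beta>_def by (intro rd_cong subspace_plus sub V W U UW QW BQ)
    finally show ?thesis .
  qed
  have bUz: "bnd d U UW q \<subseteq> cyc d U UW q \<inter> bnd d V W q" for q
  proof
    fix v assume "v \<in> bnd d U UW q"
    then obtain x w where x: "x \<in> U (q - 1)" "w \<in> U q" "w \<in> W q" "v = d x + w"
      by (auto simp: set_plus_def UW_def bnd_def)
    then have "v \<in> U q" using dUim U subspace_add by blast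
    moreover have "d v = d w" using x by (simp add: d.add dd)
    moreover have "v \<in> bnd d V W q" using b[of x q w] x UV by auto
    ultimately show "v \<in> cyc d U UW q \<inter> bnd d V W q" using dU dW x by (auto simp: cyc_def UW_def)
  qed
  show "rd (cyc d U UW q) (bnd d U UW q) = \<alpha> q + \<rho> (q - 1)"
  proof -
    have "rd (cyc d U UW q) (bnd d U UW q) = \<rho> (q - 1)
      + rd (cyc d U UW q) (cyc d U UW q \<inter> bnd d V W q + bnd d U UW q)"
      unfolding \<rho>_def diff_add_cancel by (intro rd_chain subspace_inter sub V W U UW) auto
    also have "cyc d U UW q \<inter> bnd d V W q + bnd d U UW q = cyc d U UW q \<inter> bnd d V W q"
      by (intro plus_absorb subspace_inter sub V W U UW bUz)
    also have "rd (cyc d U UW q) (cyc d U UW q \<inter> bnd d V W q) = \<alpha> q"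
      unfolding \<alpha>_def by (intro rd_inter sub V W U UW)
    finally show ?thesis by (simp add: add.commute)
  qed
  have ZQ: "cyc d V W q \<subseteq> cyc d V QW q" for q using WQ by (auto simp: cyc_def)
  \<comment> \<open>The connecting map is induced by \<open>d\<close>: its image is
    \<open>U \<inter> (d V + W)\<close> modulo \<open>d U + W\<close>, and on elements of
    \<open>U\<close> this last space agrees with the coboundaries of the subcomplex.\<close>
  have "rd (cyc d V QW q) (cyc d V W q + bnd d V QW q) = \<rho> q"
  proof -
    let ?D = "d ` U q + W (q + 1)"
    have D: "subspace ?D" by (intro subspace_plus subspace_image d U W)
    have "rd (d ` cyc d V QW q) ?D = rd (cyc d V QW q) (cyc d V W q + bnd d V QW q)"
    proof (rule rd_image[OF d])
      fix v assume v: "v \<in> cyc d V QW q"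
      show "d v \<in> ?D \<longleftrightarrow> v \<in> cyc d V W q + bnd d V QW q"
      proof
        assume "d v \<in> ?D"
        then obtain u w where u: "u \<in> U q" "w \<in> W (q + 1)" "d v = d u + w" by (auto simp: set_plus_def)
        then have "v - u \<in> cyc d V W q" using v UV V by (auto simp: cyc_def d.diff intro: subspace_diff)
        moreover have "u \<in> bnd d V QW q"
          using subset_plus_right[OF subspace_image[OF d V], of "QW q" "q - 1"] UQ u by (auto simp: bnd_def)
        ultimately have "(v - u) + u \<in> cyc d V W q + bnd d V QW q" by blast
        then show "v \<in> cyc d V W q + bnd d V QW q" by simp
      next
        assume "v \<in> cyc d V W q + bnd d V QW q"
        then obtain z x u w where z: "z \<in> cyc d V W q" "u \<in> U q" "w \<in> W q" "v = z + (d x + (u + w))"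
          by (auto simp: set_plus_def bnd_def QW_def)
        then have "d v = d u + (d z + d w)" by (simp add: d.add dd ac_simps)
        moreover have "d z + d w \<in> W (q + 1)" using z dW W subspace_add by (auto simp: cyc_def)
        ultimately show "d v \<in> ?D" using z by auto
      qed
    qed (intro sub V W U QW subspace_plus D)+
    moreover have "rd (d ` cyc d V QW q) ?D = rd (U (q + 1) \<inter> bnd d V W (q + 1)) ?D"
    proof (rule rd_cong_left)
      show "d ` cyc d V QW q \<subseteq> U (q + 1) \<inter> bnd d V W (q + 1) + ?D"
      proof
        fix y assume "y \<in> d ` cyc d V QW q"
        then obtain c u w where c: "c \<in> V q" "y = d c" "u \<in> U (q + 1)" "w \<in> W (q + 1)" "d c = u + w"
          by (auto simp: cyc_def QW_def set_plus_def)
        have "u = d c + - w" using c by simp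
        moreover have "- w \<in> W (q + 1)" using c W subspace_neg by blast
        ultimately have "u \<in> bnd d V W (q + 1)" using b[of c "q + 1" "- w"] c by simp
        moreover have "w \<in> ?D" using c subset_plus_right[OF subspace_image[OF d U]] by blast
        ultimately show "y \<in> U (q + 1) \<inter> bnd d V W (q + 1) + ?D" using c by auto
      qed
      show "U (q + 1) \<inter> bnd d V W (q + 1) \<subseteq> d ` cyc d V QW q + ?D"
      proof
        fix u assume "u \<in> U (q + 1) \<inter> bnd d V W (q + 1)"
        then obtain c w where c: "u \<in> U (q + 1)" "c \<in> V q" "w \<in> W (q + 1)" "u = d c + w"
          by (auto simp: bnd_def set_plus_def)
        have "- w \<in> W (q + 1)" using c W subspace_neg by blast
        from set_plus_intro[OF c(1) this] have "c \<in> cyc d V QW q" using c(2,4) by (simp add: cyc_def QW_def)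
        moreover have "w \<in> ?D" using c subset_plus_right[OF subspace_image[OF d U]] by blast
        ultimately show "u \<in> d ` cyc d V QW q + ?D" using c by auto
      qed
    qed (intro sub V W U QW subspace_image d subspace_inter D)+
    moreover have "U (q + 1) \<inter> bnd d V W (q + 1) = cyc d U UW (q + 1) \<inter> bnd d V W (q + 1)"
    proof -
      have "u \<in> cyc d U UW (q + 1)" if u: "u \<in> U (q + 1)" "u \<in> bnd d V W (q + 1)" for u
      proof -
        obtain x w where "w \<in> W (q + 1)" "u = d x + w"
          using u(2) unfolding bnd_def by (elim set_plus_elim imageE) blast
        then have "d u \<in> W (q + 1 + 1)" using dW[of w "q + 1"] by (simp only: d.add dd add_0)
        then show ?thesis using u dU[OF u(1)] by (simp add: cyc_def UW_def)
      qed
      then show ?thesis by (auto simp: cyc_def)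
    qed
    moreover have "rd (cyc d U UW (q + 1) \<inter> bnd d V W (q + 1)) ?D = \<rho> q"
      unfolding \<rho>_def
    proof (rule rd_cong)
      fix v assume "v \<in> cyc d U UW (q + 1) \<inter> bnd d V W (q + 1)"
      then have v: "v \<in> U (q + 1)" by (auto simp: cyc_def)
      have "w \<in> U (q + 1)" if "v = d u + w" "u \<in> U q" for u w
      proof -
        have "w = v - d u" using that by simp
        then show ?thesis using v dU[OF that(2)] U subspace_diff by blast
      qed
      then show "v \<in> ?D \<longleftrightarrow> v \<in> bnd d U UW (q + 1)" by (auto simp: bnd_def UW_def set_plus_def)
    qed (intro sub V W U UW subspace_inter D)+
    ultimately show ?thesis by simp
  qed
  moreover have "rd (cyc d V QW q) (bnd d V QW q) = \<beta> q + rd (cyc d V QW q) (cyc d V W q + bnd d V QW q)"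
    unfolding \<beta>_def by (intro rd_chain sub V W QW ZQ)
  ultimately show "rd (cyc d V QW q) (bnd d V QW q) = \<beta> q + \<rho> q" by simp
qed

end

section \<open>Localizations\<close>

abbreviation xs :: "nat set \<Rightarrow> nat \<Rightarrow> claurent" where
  "xs J k \<equiv> laurent_of ((\<Prod>j\<in>J. var j) ^ k)"

text \<open>All twists \<open>n\<close> are needed, not only \<open>n = 0\<close>: multiplication by
  a form of degree \<open>e\<close> shifts the twist by \<open>e\<close>, and Serre vanishing
  concerns large \<open>n\<close>.\<close>

definition loc :: "int \<Rightarrow> cpoly set \<Rightarrow> nat set \<Rightarrow> claurent set" where
  "loc n I J = {f \<in> homog n. \<exists>k. \<exists>p\<in>I. f * xs J k = laurent_of p}"

lemma localization0_eq: "localization0 I J = loc 0 I J"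
  by (simp add: localization0_def loc_def)

lemma prod_var_Rg: "J \<subseteq> {..r} \<Longrightarrow> (\<Prod>j\<in>J. var j) ^ k \<in> Rg r"
  by (intro Rg_power Rg_prod Rg_var) auto

lemma xs_add: "xs J (k + l) = xs J k * xs J l"
  by (simp add: power_add laurent_of_mult)

lemma loc_elim:
  assumes "homogeneous_ideal r I" "J \<subseteq> {..r}" "f \<in> loc n I J"
  obtains k where "\<And>l. k \<le> l \<Longrightarrow> \<exists>p\<in>I. f * xs J l = laurent_of p"
proof -
  obtain k p where p: "p \<in> I" "f * xs J k = laurent_of p" using assms(3) by (auto simp: loc_def)
  have "\<exists>p\<in>I. f * xs J l = laurent_of p" if "k \<le> l" for l
  proof -
    have "f * xs J l = laurent_of (p * (\<Prod>j\<in>J. var j) ^ (l - k))"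
      using xs_add[of J k "l - k"] that p by (simp add: laurent_of_mult mult.assoc[symmetric])
    then show ?thesis using hi_mult'[OF assms(1) p(1)] prod_var_Rg[OF assms(2)] by blast
  qed
  then show thesis using that by blast
qed

lemma loc_subspace:
  assumes "homogeneous_ideal r I" "J \<subseteq> {..r}"
  shows "pm.subspace (loc n I J)"
  unfolding pm.subspace_def
proof (intro conjI ballI allI)
  show "0 \<in> loc n I J" using hi_zero[OF assms(1)] pm.subspace_0[OF homog_subspace] by (force simp: loc_def)
  fix f assume f: "f \<in> loc n I J"
  { fix g assume g: "g \<in> loc n I J"
    obtain k where k: "\<And>l. k \<le> l \<Longrightarrow> \<exists>p\<in>I. f * xs J l = laurent_of p" using loc_elim[OF assms f] by blast
    obtain k' where k': "\<And>l. k' \<le> l \<Longrightarrow> \<exists>p\<in>I. g * xs J l = laurent_of p" using loc_elim[OF assms g] by blast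
    obtain p p' where "p \<in> I" "p' \<in> I" "f * xs J (max k k') = laurent_of p" "g * xs J (max k k') = laurent_of p'"
      using k[of "max k k'"] k'[of "max k k'"] by auto
    then have "(f + g) * xs J (max k k') = laurent_of (p + p')" "p + p' \<in> I"
      using hi_add[OF assms(1)] by (auto simp: distrib_right laurent_of_add)
    moreover have "f + g \<in> homog n" using f g pm.subspace_add[OF homog_subspace] by (auto simp: loc_def)
    ultimately show "f + g \<in> loc n I J" by (auto simp: loc_def) }
  fix a
  obtain k p where p: "p \<in> I" "f * xs J k = laurent_of p" using f by (auto simp: loc_def)
  have "smul a f * xs J k = laurent_of (smul a p)" using p(2) by (simp add: smul_mult_left laurent_of_smul)
  moreover have "smul a p \<in> I" using p(1) hi_subspace[OF assms(1)] pm.subspace_scale by blast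
  moreover have "smul a f \<in> homog n" using f pm.subspace_scale[OF homog_subspace] by (auto simp: loc_def)
  ultimately show "smul a f \<in> loc n I J" by (auto simp: loc_def)
qed

lemma loc_mono_ideal: "I \<subseteq> I' \<Longrightarrow> loc n I J \<subseteq> loc n I' J"
  by (auto simp: loc_def)

lemma loc_mono:
  assumes "homogeneous_ideal r I" "J \<subseteq> K" "K \<subseteq> {..r}"
  shows "loc n I J \<subseteq> loc n I K"
proof
  fix f assume f: "f \<in> loc n I J"
  then obtain k p where p: "p \<in> I" "f * xs J k = laurent_of p" by (auto simp: loc_def)
  have fin: "finite K" using assms(3) finite_subset by blast
  have "(\<Prod>j\<in>K. var j) = (\<Prod>j\<in>J. var j) * (\<Prod>j\<in>K - J. var j)"
    using prod.subset_diff[OF assms(2) fin, of var] by (simp add: mult.commute)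
  then have "f * xs K k = laurent_of (p * (\<Prod>j\<in>K - J. var j) ^ k)"
    using p(2) by (simp add: power_mult_distrib laurent_of_mult mult.assoc[symmetric])
  moreover have "p * (\<Prod>j\<in>K - J. var j) ^ k \<in> I"
    using assms by (intro hi_mult'[OF assms(1) p(1)] prod_var_Rg) auto
  ultimately show "f \<in> loc n I K" using f by (auto simp: loc_def)
qed

lemma loc_smult:
  assumes I: "homogeneous_ideal r I" and x: "x \<in> Rn r e" and f: "f \<in> loc n I J"
  shows "laurent_of x * f \<in> loc (n + int e) I J"
proof -
  obtain k p where p: "p \<in> I" "f * xs J k = laurent_of p" using f by (auto simp: loc_def)
  have "laurent_of x * f * xs J k = laurent_of (x * p)" using p by (simp add: laurent_of_mult mult.assoc)
  moreover have "x * p \<in> I" using hi_mult[OF I p(1)] x by auto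
  moreover have "laurent_of x * f \<in> homog (int e + n)"
    using f x laurent_of_homog_iff by (intro homog_mult) (auto simp: loc_def)
  ultimately show ?thesis by (auto simp: loc_def add.commute)
qed

text \<open>Monomials are units among Laurent polynomials, so dividing by a power of
  \<open>x_J\<close> is multiplication by an element of known degree.\<close>

lemma xs_inverse: 
  assumes "finite J"
  obtains u where "xs J k * u = 1" "u \<in> homog (- int (k * card J))"
proof -
  define v :: claurent where "v = (\<Prod>j\<in>J. Poly_Mapping.single (Poly_Mapping.single j (- 1)) 1)"
  have map1: "\<iota> (Poly_Mapping.single j 1) = Poly_Mapping.single j 1" for j
    by (rule poly_mapping_eqI) (simp add: lookup_iota lookup_single when_def)
  have prod: "laurent_of (prod f J) = (\<Prod>j\<in>J. laurent_of (f j))" for f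
    by (induction J rule: infinite_finite_induct) (simp_all add: laurent_of_mult)
  have "laurent_of (var j) * Poly_Mapping.single (Poly_Mapping.single j (- 1)) 1 = 1" for j
    by (simp add: var_def laurent_of_single map1[unfolded One_nat_def] mult_single single_add[symmetric] del: single_one)
      simp
  then have "xs J 1 * v = 1" by (simp add: v_def prod prod.distrib[symmetric])
  then have "xs J k * v ^ k = 1" by (metis laurent_of_power power_mult_distrib power_one power_one_right)
  moreover have "v \<in> homog (- int (card J))" unfolding v_def using assms
  proof (induction J)
    case (insert j J)
    have "Poly_Mapping.single (Poly_Mapping.single j (- 1 :: int)) 1 \<in> homog (- 1)" by (simp add: homog_def)
    from homog_mult[OF this insert(3)] show ?case using insert(1,2) by (simp add: algebra_simps)
  qed (simp add: homog_one)
  then have "v ^ k \<in> homog (- int (k * card J))"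
  proof (induction k)
    case (Suc k)
    have "v * v ^ k \<in> homog (- int (card J) + - int (k * card J))" by (intro homog_mult Suc)
    then show ?case by (simp add: algebra_simps)
  qed (simp add: homog_one)
  ultimately show thesis using that by blast
qed

lemma xs_homog: "finite J \<Longrightarrow> xs J k \<in> homog (int (k * card J))"
proof -
  assume "finite J"
  then have "(\<Prod>j\<in>J. var j) \<in> homog (card J)"
  proof (induction J)
    case (insert j J)
    then show ?case using homog_mult[OF homog_var[of j] insert(3)] by simp
  qed (simp add: homog_one)
  then have "(\<Prod>j\<in>J. var j) ^ k \<in> homog (k * card J)" by (rule homog_power)
  then show ?thesis using laurent_of_homog_iff by blast
qed

text \<open>Clear the denominator, decompose the numerator into homogeneous parts, and divide
  again.\<close>

lemma loc_adj:
  assumes I: "homogeneous_ideal r I" and x: "x \<in> Rn r e" and J: "J \<subseteq> {..r}" and f: "f \<in> loc n (adj r I x) J"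
  obtains g f' where "g \<in> loc (n - int e) (Rg r) J" "f' \<in> loc n I J" "f = laurent_of x * g + f'"
proof -
  have fin: "finite J" using J finite_subset by blast
  obtain k p where p: "p \<in> adj r I x" "f * xs J k = laurent_of p" using f by (auto simp: loc_def)
  obtain u where u: "xs J k * u = 1" "u \<in> homog (- int (k * card J))" using xs_inverse[OF fin] by blast
  have fh: "f \<in> homog n" using f by (simp add: loc_def)
  have "laurent_of p \<in> homog (n + int (k * card J))"
    unfolding p(2)[symmetric] by (intro homog_mult xs_homog fin fh)
  note ph = this
  have fu: "f = laurent_of p * u" using p(2) u(1) by (metis mult.assoc mult.right_neutral)
  show thesis
  proof (cases "n + int (k * card J) < 0")
    \<comment> \<open>A numerator of negative degree vanishes.\<close>
    case True
    then have "p = 0" using laurent_of_homog_neg[OF ph] by simp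
    then have "f = laurent_of x * 0 + 0" using fu by simp
    then show ?thesis using that loc_subspace[OF I J] loc_subspace[OF Rg_hi J] pm.subspace_0 by metis
  next
    case False
    then obtain t where t: "n + int (k * card J) = int t" using zero_le_imp_eq_int[of "n + int (k * card J)"] by auto
    then have pt: "p \<in> homog t" using ph laurent_of_homog_iff by metis
    obtain i g where ig: "i \<in> I \<inter> homog t" "p = i + x * g" "e \<le> t \<Longrightarrow> g \<in> Rn r (t - e)" "\<not> e \<le> t \<Longrightarrow> g = 0"
      using adj_homog_elim[OF I x p(1) pt] by metis
    have n: "n = int t + - int (k * card J)" using t by simp
    have ux: "z * u * xs J k = z" for z :: claurent using u(1) by (simp add: mult.assoc mult.commute[of u])
    have "laurent_of i * u \<in> homog n" unfolding n
      using ig(1) laurent_of_homog_iff by (intro homog_mult u) auto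
    then have 1: "laurent_of i * u \<in> loc n I J"
      using ig(1) ux unfolding loc_def by blast
    have "laurent_of g * u \<in> homog (n - int e)"
    proof (cases "e \<le> t")
      case True
      then have "n - int e = int (t - e) + - int (k * card J)" using n by simp
      then show ?thesis using ig(3)[OF True] laurent_of_homog_iff homog_mult[OF _ u(2)] by (metis IntD2)
    next
      case False
      then show ?thesis using ig(4) pm.subspace_0[OF homog_subspace] by simp
    qed
    moreover have "g \<in> Rg r" using ig(3,4) by (cases "e \<le> t") auto
    ultimately have 2: "laurent_of g * u \<in> loc (n - int e) (Rg r) J"
      using ux unfolding loc_def by blast
    have "f = laurent_of x * (laurent_of g * u) + laurent_of i * u"
      using fu ig(2) by (simp add: laurent_of_add laurent_of_mult algebra_simps)
    then show ?thesis using that 1 2 by blast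
  qed
qed

lemma loc_colon:
  assumes I: "homogeneous_ideal r I" and x: "x \<in> Rn r e" and J: "J \<subseteq> {..r}" and f: "f \<in> loc n (Rg r) J"
  shows "laurent_of x * f \<in> loc (n + int e) I J \<longleftrightarrow> f \<in> loc n (colon r I x) J"
proof
  assume l: "laurent_of x * f \<in> loc (n + int e) I J"
  obtain k where k: "\<And>l. k \<le> l \<Longrightarrow> \<exists>p\<in>I. laurent_of x * f * xs J l = laurent_of p" using loc_elim[OF I J l] by blast
  obtain k' where k': "\<And>l. k' \<le> l \<Longrightarrow> \<exists>p\<in>Rg r. f * xs J l = laurent_of p" using loc_elim[OF Rg_hi J f] by blast
  obtain p p' where p: "p \<in> I" "p' \<in> Rg r" "laurent_of x * f * xs J (max k k') = laurent_of p"
      "f * xs J (max k k') = laurent_of p'"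
    using k[of "max k k'"] k'[of "max k k'"] by auto
  then have "laurent_of (x * p') = laurent_of p" by (simp add: laurent_of_mult mult.assoc)
  then have "x * p' = p" by simp
  then have "p' \<in> colon r I x" using p by (auto simp: colon_def)
  then show "f \<in> loc n (colon r I x) J" using p f by (auto simp: loc_def)
next
  assume "f \<in> loc n (colon r I x) J"
  then obtain k p where p: "p \<in> colon r I x" "f * xs J k = laurent_of p" by (auto simp: loc_def)
  then have "laurent_of x * f * xs J k = laurent_of (x * p)" "x * p \<in> I" by (auto simp: laurent_of_mult mult.assoc colon_def)
  moreover have "laurent_of x * f \<in> loc (n + int e) (Rg r) J" using loc_smult[OF Rg_hi x f] .
  ultimately show "laurent_of x * f \<in> loc (n + int e) I J" by (auto simp: loc_def)
qed

text \<open>A power of \<open>x_i\<close> cancels just the part of the denominator that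
  \<open>J\<close> does not permit. This later turns the contracting homotopy into a genuine
  cochain.\<close>

lemma loc_clear:
  assumes I: "homogeneous_ideal r I" and i: "i \<le> r" "i \<notin> J" and J: "J \<subseteq> {..r}" and f: "f \<in> loc n I (insert i J)"
  shows "\<exists>k. \<forall>l\<ge>k. laurent_of (var i ^ l) * f \<in> loc (n + int l) I J"
proof -
  have fin: "finite J" using J finite_subset by blast
  obtain k p where p: "p \<in> I" "f * xs (insert i J) k = laurent_of p" using f by (auto simp: loc_def)
  have "laurent_of (var i ^ l) * f \<in> loc (n + int l) I J" if "k \<le> l" for l
  proof -
    have "laurent_of (var i ^ l) * f * xs J k = laurent_of (var i ^ (l - k)) * (f * xs (insert i J) k)"
      using fin i that by (simp add: laurent_of_mult[symmetric] power_mult_distrib mult.assoc[symmetric])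
        (simp add: laurent_of_mult power_mult_distrib laurent_of_power mult.commute mult.left_commute power_add[symmetric])
    also have "\<dots> = laurent_of (var i ^ (l - k) * p)" using p by (simp add: laurent_of_mult)
    finally have "laurent_of (var i ^ l) * f * xs J k = laurent_of (var i ^ (l - k) * p)" .
    moreover have "var i ^ (l - k) * p \<in> I" using hi_mult[OF I p(1)] Rg_power Rg_var i by blast
    moreover have "laurent_of (var i ^ l) \<in> homog (int l)"
      using laurent_of_homog_iff homog_power[OF homog_var, of i l] by simp
    then have "laurent_of (var i ^ l) * f \<in> homog (int l + n)"
      using f by (intro homog_mult) (auto simp: loc_def)
    ultimately show ?thesis by (auto simp: loc_def add.commute)
  qed
  then show ?thesis by blast
qed

section \<open>The augmented Cech complex\<close>

abbreviation cscale :: "complex \<Rightarrow> (nat set \<Rightarrow> claurent) \<Rightarrow> nat set \<Rightarrow> claurent" where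
  "cscale \<equiv> \<lambda>a c J. smul a (c J)"

interpretation cc: relative_dim cscale
  by unfold_locales (auto simp: fun_eq_iff pm.scale_right_distrib pm.scale_left_distrib)

text \<open>
  Cochains are indexed by the size \<open>q\<close> of their index sets, so that degree \<open>q = 0\<close> is the augmentation
  \<open>R\<^sub>n\<close>, and \<open>p\<close>-cochains have \<open>q = p + 1\<close>; \<open>n\<close> is the internal degree.
\<close>

definition coch :: "nat \<Rightarrow> cpoly set \<Rightarrow> int \<Rightarrow> int \<Rightarrow> (nat set \<Rightarrow> claurent) set" where
  "coch r I n q = {c. \<forall>J. if J \<subseteq> {..r} \<and> int (card J) = q then c J \<in> loc n I J else c J = 0}"

lemma cochains_eq: "cochains r I p = coch r I 0 (int p + 1)"
  proof -
  have "card J = Suc p \<longleftrightarrow> int (card J) = int p + 1" for J :: "nat set" by linarith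
  then show ?thesis unfolding cochains_def coch_def localization0_eq by simp
qed

lemma coch_in: "c \<in> coch r I n q \<Longrightarrow> J \<subseteq> {..r} \<Longrightarrow> int (card J) = q \<Longrightarrow> c J \<in> loc n I J"
  unfolding coch_def by (drule CollectD, drule spec[of _ J]) simp

lemma coch_zero: "c \<in> coch r I n q \<Longrightarrow> \<not> J \<subseteq> {..r} \<or> int (card J) \<noteq> q \<Longrightarrow> c J = 0"
  unfolding coch_def by (drule CollectD, drule spec[of _ J]) (simp split: if_splits)

lemma coch_subspace: "homogeneous_ideal r I \<Longrightarrow> cc.subspace (coch r I n q)"
proof -
  assume I: "homogeneous_ideal r I"
  have "0 \<in> coch r I n q" using pm.subspace_0[OF loc_subspace[OF I]] by (simp add: coch_def)
  moreover have "b + c \<in> coch r I n q" if "b \<in> coch r I n q" "c \<in> coch r I n q" for b c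
    using coch_in[OF that(1)] coch_in[OF that(2)] coch_zero[OF that(1)] coch_zero[OF that(2)]
      pm.subspace_add[OF loc_subspace[OF I]] by (simp add: coch_def)
  moreover have "cscale a c \<in> coch r I n q" if "c \<in> coch r I n q" for a c
    using coch_in[OF that] coch_zero[OF that] pm.subspace_scale[OF loc_subspace[OF I]] by (simp add: coch_def)
  ultimately show ?thesis unfolding cc.subspace_def by blast
qed

lemma coch_mono: "I \<subseteq> I' \<Longrightarrow> coch r I n q \<subseteq> coch r I' n q"
  using loc_mono_ideal unfolding coch_def by (auto split: if_splits) blast

definition sgn_in :: "nat set \<Rightarrow> nat \<Rightarrow> claurent" where
  "sgn_in K j = (- 1) ^ card {i \<in> K. i < j}"

lemma sgn_in_sq: "sgn_in K j * sgn_in K j = 1"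
  by (simp add: sgn_in_def power_add[symmetric] mult_2[symmetric])

text \<open>Removing \<open>j\<close> lowers the position of the larger index \<open>l\<close> by
  one, whereas removing \<open>l\<close> does not move \<open>j\<close>.\<close>

lemma sgn_in_swap_less:
  assumes "finite K" "j \<in> K" "j < l"
  shows "sgn_in K j * sgn_in (K - {j}) l = - (sgn_in K l * sgn_in (K - {l}) j)"
proof -
  have "{i \<in> K. i < l} = insert j {i \<in> K - {j}. i < l}" using assms by auto
  then have "card {i \<in> K. i < l} = Suc (card {i \<in> K - {j}. i < l})" using assms(1) by simp
  moreover have "{i \<in> K - {l}. i < j} = {i \<in> K. i < j}" using assms by auto
  ultimately show ?thesis by (simp add: sgn_in_def)
qed

lemma sgn_in_swap:
  assumes "finite K" "j \<in> K" "l \<in> K" "j \<noteq> l"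
  shows "sgn_in K j * sgn_in (K - {j}) l = - (sgn_in K l * sgn_in (K - {l}) j)"
  using sgn_in_swap_less[OF assms(1,2), of l] sgn_in_swap_less[OF assms(1,3), of j] assms(4)
  by (cases "j < l") (auto simp: not_less)

lemma coboundary_eq: "coboundary r c K = (if K \<subseteq> {..r} then \<Sum>j\<in>K. sgn_in K j * c (K - {j}) else 0)"
  by (simp add: coboundary_def sgn_in_def)

lemma coboundary_linear: "Vector_Spaces.linear cscale cscale (coboundary r)"
  unfolding Vector_Spaces.linear_iff
proof (intro conjI allI cc.vector_space_axioms)
  fix b c
  show "coboundary r (b + c) = coboundary r b + coboundary r c"
    by (simp add: fun_eq_iff coboundary_eq distrib_left sum.distrib)
next
  fix a c
  show "coboundary r (cscale a c) = cscale a (coboundary r c)"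
    by (simp add: fun_eq_iff coboundary_eq smul_mult_right pm.scale_sum_right)
qed

text \<open>Omitting \<open>j\<close> and then \<open>l\<close> has the opposite sign of omitting
  \<open>l\<close> and then \<open>j\<close>, so the double sum equals its own negative.\<close>

lemma coboundary_coboundary: "coboundary r (coboundary r c) = 0"
proof (rule ext)
  fix K
  show "coboundary r (coboundary r c) K = 0 K"
  proof (cases "K \<subseteq> {..r}")
    case True
    have fin: "finite K" using True finite_subset by blast
    define t where "t j l = (if l \<noteq> j then sgn_in K j * sgn_in (K - {j}) l * c (K - {j} - {l}) else 0)" for j l
    have "(\<Sum>l\<in>K - {j}. sgn_in K j * sgn_in (K - {j}) l * c (K - {j} - {l})) = (\<Sum>l\<in>K. t j l)" if "j \<in> K" for j
      using fin by (intro sum.mono_neutral_cong_left) (auto simp: t_def)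
    then have S: "coboundary r (coboundary r c) K = (\<Sum>j\<in>K. \<Sum>l\<in>K. t j l)"
      using True by (simp add: coboundary_eq[of r _ K] coboundary_eq[of r c] sum_distrib_left mult.assoc subset_iff)
    have "t j l = - t l j" if "j \<in> K" "l \<in> K" for j l
      using sgn_in_swap[OF fin that] by (auto simp: t_def insert_commute Diff_insert2[symmetric] Diff_insert[symmetric])
    then have "(\<Sum>j\<in>K. \<Sum>l\<in>K. t j l) = (\<Sum>j\<in>K. \<Sum>l\<in>K. - t l j)"
      by (intro sum.cong refl)
    also have "\<dots> = - (\<Sum>j\<in>K. \<Sum>l\<in>K. t j l)" by (subst sum.swap) (simp add: sum_negf)
    finally have "(\<Sum>j\<in>K. \<Sum>l\<in>K. t j l) = - (\<Sum>j\<in>K. \<Sum>l\<in>K. t j l)" .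
    then have "(\<Sum>j\<in>K. \<Sum>l\<in>K. t j l) = 0"
      by (simp add: poly_mapping_eq_iff fun_eq_iff)
    then show ?thesis using S by simp
  qed (simp add: coboundary_eq)
qed

lemma coboundary_coch:
  assumes I: "homogeneous_ideal r I" and c: "c \<in> coch r I n q"
  shows "coboundary r c \<in> coch r I n (q + 1)"
  unfolding coch_def
proof (intro CollectI allI)
  fix K
  show "if K \<subseteq> {..r} \<and> int (card K) = q + 1 then coboundary r c K \<in> loc n I K else coboundary r c K = 0"
  proof (cases "K \<subseteq> {..r}")
    case True
    have fin: "finite K" using True finite_subset by blast
    have card: "int (card (K - {j})) = int (card K) - 1" if "j \<in> K" for j
      using that fin by (metis card_Suc_Diff1 add_diff_cancel_left' of_nat_Suc)
    show ?thesis
    proof (cases "int (card K) = q + 1")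
      case q: True
      have "sgn_in K j * c (K - {j}) \<in> loc n I K" if j: "j \<in> K" for j
      proof -
        have "c (K - {j}) \<in> loc n I (K - {j})"
          using card[OF j] q True by (intro coch_in[OF c]) auto
        then have "c (K - {j}) \<in> loc n I K" using loc_mono[OF I _ True, of "K - {j}" n] by blast
        moreover have "sgn_in K j = 1 \<or> sgn_in K j = - 1"
          by (simp add: sgn_in_def minus_one_power_iff)
        ultimately show ?thesis using pm.subspace_neg[OF loc_subspace[OF I True]] by auto
      qed
      then have "(\<Sum>j\<in>K. sgn_in K j * c (K - {j})) \<in> loc n I K"
        by (rule pm.subspace_sum[OF loc_subspace[OF I True]])
      then show ?thesis using True q by (simp add: coboundary_eq)
    next
      case q: False
      have "c (K - {j}) = 0" if "j \<in> K" for j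
        using card[OF that] q by (intro coch_zero[OF c]) auto
      then show ?thesis using True q by (simp add: coboundary_eq)
    qed
  qed (simp add: coboundary_eq)
qed

definition mult_cochain :: "cpoly \<Rightarrow> (nat set \<Rightarrow> claurent) \<Rightarrow> nat set \<Rightarrow> claurent" where
  "mult_cochain x c = (\<lambda>J. laurent_of x * c J)"

lemma mult_cochain_linear: "Vector_Spaces.linear cscale cscale (mult_cochain x)"
  unfolding Vector_Spaces.linear_iff
  by (intro conjI allI cc.vector_space_axioms) (auto simp: mult_cochain_def fun_eq_iff distrib_left smul_mult_right)

lemma mult_cochain_add: "mult_cochain x (b + c) = mult_cochain x b + mult_cochain x c"
  by (simp add: mult_cochain_def fun_eq_iff distrib_left)

lemma mult_cochain_inj: "x \<noteq> 0 \<Longrightarrow> mult_cochain x b = mult_cochain x c \<longleftrightarrow> b = c"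
  using laurent_of_inj[of x 0] by (auto simp: mult_cochain_def fun_eq_iff simp del: laurent_of_inj)

lemma mult_cochain_coboundary: "coboundary r (mult_cochain x c) = mult_cochain x (coboundary r c)"
  by (auto simp: fun_eq_iff coboundary_eq mult_cochain_def sum_distrib_left mult.left_commute)

lemma mult_cochain_coch:
  assumes I: "homogeneous_ideal r I" and x: "x \<in> Rn r e" and c: "c \<in> coch r I (n - int e) q"
  shows "mult_cochain x c \<in> coch r I n q"
  using loc_smult[OF I x, of _ "n - int e"] c by (auto simp: coch_def mult_cochain_def)

lemma mult_cochain_coch_colon:
  assumes I: "homogeneous_ideal r I" and x: "x \<in> Rn r e" and c: "c \<in> coch r (Rg r) (n - int e) q"
  shows "mult_cochain x c \<in> coch r I n q \<longleftrightarrow> c \<in> coch r (colon r I x) (n - int e) q"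
  using loc_colon[OF I x, of _ _ "n - int e"] c by (auto simp: coch_def mult_cochain_def split: if_splits)

text \<open>Localized elements decompose by \<open>loc_adj\<close>, independently for every index
  set. In the long exact sequence this identifies \<open>V / (U + W)\<close> with the complex of
  \<open>I + (x)\<close>.\<close>

lemma coch_adj:
  assumes I: "homogeneous_ideal r I" and x: "x \<in> Rn r e"
  shows "coch r (adj r I x) n q = mult_cochain x ` coch r (Rg r) (n - int e) q + coch r I n q"
proof
  show "coch r (adj r I x) n q \<subseteq> mult_cochain x ` coch r (Rg r) (n - int e) q + coch r I n q"
  proof
    fix c assume c: "c \<in> coch r (adj r I x) n q"
    have "\<exists>g f'. if J \<subseteq> {..r} \<and> int (card J) = q
        then g \<in> loc (n - int e) (Rg r) J \<and> f' \<in> loc n I J \<and> c J = laurent_of x * g + f' else g = 0 \<and> f' = 0" for J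
    proof (cases "J \<subseteq> {..r} \<and> int (card J) = q")
      case True
      then have "c J \<in> loc n (adj r I x) J" using c by (auto simp: coch_def)
      then show ?thesis using loc_adj[OF I x, of J "c J" n] True by metis
    next
      case False
      then show ?thesis unfolding if_not_P[OF False] by blast
    qed
    then obtain g f' where gf: "\<And>J. if J \<subseteq> {..r} \<and> int (card J) = q
        then g J \<in> loc (n - int e) (Rg r) J \<and> f' J \<in> loc n I J \<and> c J = laurent_of x * g J + f' J else g J = 0 \<and> f' J = 0"
      by metis
    have "c J = (mult_cochain x g + f') J" for J
      using gf[of J] c by (cases "J \<subseteq> {..r} \<and> int (card J) = q") (auto simp: mult_cochain_def coch_def)
    then have "c = mult_cochain x g + f'" by blast
    moreover have "g \<in> coch r (Rg r) (n - int e) q" "f' \<in> coch r I n q"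
      using gf by (auto simp: coch_def)
    ultimately show "c \<in> mult_cochain x ` coch r (Rg r) (n - int e) q + coch r I n q" by blast
  qed
  show "mult_cochain x ` coch r (Rg r) (n - int e) q + coch r I n q \<subseteq> coch r (adj r I x) n q"
  proof (rule cc.plus_subset[OF coch_subspace[OF adj_hi[OF I x]]])
    show "coch r I n q \<subseteq> coch r (adj r I x) n q" by (rule coch_mono[OF adj_mono])
    show "mult_cochain x ` coch r (Rg r) (n - int e) q \<subseteq> coch r (adj r I x) n q"
    proof (rule image_subsetI)
      fix c assume c: "c \<in> coch r (Rg r) (n - int e) q"
      have "colon r (adj r I x) x = Rg r" using adj_gen[OF _ I] by (auto simp: colon_def)
      then show "mult_cochain x c \<in> coch r (adj r I x) n q" using mult_cochain_coch_colon[OF adj_hi[OF I x] x c] c by simp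
    qed
  qed
qed

definition Zc where "Zc r I n = cc.cyc (coboundary r) (coch r (Rg r) n) (coch r I n)"
definition Bc where "Bc r I n = cc.bnd (coboundary r) (coch r (Rg r) n) (coch r I n)"
text \<open>Cohomology of the augmented complex in twist \<open>n\<close>, possibly infinite until
  \<open>good_exists\<close> rules that out.\<close>

definition hc :: "nat \<Rightarrow> cpoly set \<Rightarrow> int \<Rightarrow> int \<Rightarrow> enat" where "hc r I n q = cc.rd (Zc r I n q) (Bc r I n q)"
text \<open>The augmentation term, which is \<open>R/I\<close> in degree \<open>n\<close>. As a
  function on the integers it obeys the same shifted exact sequences as the cohomology.\<close>

definition Hc :: "nat \<Rightarrow> cpoly set \<Rightarrow> int \<Rightarrow> enat" where "Hc r I n = cc.rd (coch r (Rg r) n 0) (coch r I n 0)"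

lemma Zc_subspace: "homogeneous_ideal r I \<Longrightarrow> cc.subspace (Zc r I n q)"
  and Bc_subspace: "homogeneous_ideal r I \<Longrightarrow> cc.subspace (Bc r I n q)"
  unfolding Zc_def Bc_def
  by (intro cc.cyc_subspace cc.bnd_subspace coboundary_linear coch_subspace Rg_hi; simp)+

text \<open>A multiple \<open>x c\<close> takes values in \<open>I\<close> exactly when
  \<open>c\<close> takes values in \<open>I : x\<close>, so the subcomplex of multiples of
  \<open>x\<close> is the complex of \<open>I : x\<close> shifted by \<open>e\<close>.\<close>

lemma mult_cochain_cyc_bnd:
  fixes n :: int
  assumes I: "homogeneous_ideal r I" and x: "x \<in> Rn r e"
  defines "U \<equiv> \<lambda>q. mult_cochain x ` coch r (Rg r) (n - int e) q"
  defines "UW \<equiv> \<lambda>q. U q \<inter> coch r I n q"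
  shows "cc.cyc (coboundary r) U UW q = mult_cochain x ` Zc r (colon r I x) (n - int e) q"
    and "cc.bnd (coboundary r) U UW q = mult_cochain x ` Bc r (colon r I x) (n - int e) q"
proof -
  interpret mult_cochain: Vector_Spaces.linear cscale cscale "mult_cochain x" by (rule mult_cochain_linear)
  have UW: "UW q = mult_cochain x ` coch r (colon r I x) (n - int e) q" for q
  proof -
    have "coch r (colon r I x) (n - int e) q \<subseteq> coch r (Rg r) (n - int e) q"
      by (rule coch_mono) (auto simp: colon_def)
    then show ?thesis using mult_cochain_coch_colon[OF I x] by (auto simp: UW_def U_def)
  qed
  have dR: "coboundary r c \<in> coch r (Rg r) (n - int e) (q + 1)" if "c \<in> coch r (Rg r) (n - int e) q" for c q
    using coboundary_coch[OF Rg_hi that] .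
  show "cc.cyc (coboundary r) U UW q = mult_cochain x ` Zc r (colon r I x) (n - int e) q"
  proof -
    have "coboundary r (mult_cochain x c) \<in> UW (q + 1) \<longleftrightarrow> coboundary r c \<in> coch r (colon r I x) (n - int e) (q + 1)"
      if "c \<in> coch r (Rg r) (n - int e) q" for c
      using dR[OF that] mult_cochain_coch_colon[OF I x dR[OF that]] by (auto simp: UW_def U_def mult_cochain_coboundary)
    then show ?thesis by (auto simp: cc.cyc_def Zc_def U_def)
  qed
  have "coboundary r ` mult_cochain x ` A = mult_cochain x ` coboundary r ` A" for A
    by (simp add: image_image mult_cochain_coboundary)
  then show "cc.bnd (coboundary r) U UW q = mult_cochain x ` Bc r (colon r I x) (n - int e) q"
    unfolding cc.bnd_def Bc_def UW by (auto simp: U_def set_plus_def mult_cochain.add[symmetric] image_iff)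
qed

lemma rd_mult_cochain:
  assumes "x \<noteq> 0" "cc.subspace A" "cc.subspace B"
  shows "cc.rd (mult_cochain x ` A) (mult_cochain x ` B) = cc.rd A B"
proof (rule rd_image[OF mult_cochain_linear assms(2,3)])
  show "cc.subspace (mult_cochain x ` B)" by (rule cc.subspace_image[OF mult_cochain_linear assms(3)])
qed (use mult_cochain_inj[OF assms(1)] in auto)

text \<open>This is the long exact sequence of \<open>I : x\<close>, \<open>I\<close> and
  \<open>I + (x)\<close>, with \<open>\<alpha>\<close>, \<open>\<beta>\<close>,
  \<open>\<rho>\<close> the ranks of its maps. The last conclusion reads: if the connecting map into
  degree \<open>q\<close> is zero, multiplication by \<open>x\<close> is injective on the cohomology
  in degree \<open>q\<close>.\<close>

lemma hc_exact:
  assumes I: "homogeneous_ideal r I" and x: "x \<in> Rn r e" "x \<noteq> 0"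
  obtains \<alpha> \<beta> \<rho> :: "int \<Rightarrow> enat" where
    "\<And>q. hc r (colon r I x) (n - int e) q = \<alpha> q + \<rho> (q - 1)"
    "\<And>q. hc r (adj r I x) n q = \<beta> q + \<rho> q"
    "\<And>q. hc r I n q = \<alpha> q + \<beta> q"
    "\<And>q v. \<rho> (q - 1) = 0 \<Longrightarrow> v \<in> Zc r (colon r I x) (n - int e) q \<Longrightarrow> mult_cochain x v \<in> Bc r I n q
        \<Longrightarrow> v \<in> Bc r (colon r I x) (n - int e) q"
proof -
  define U where "U = (\<lambda>q. mult_cochain x ` coch r (Rg r) (n - int e) q)"
  define UW where "UW = (\<lambda>q. U q \<inter> coch r I n q)"
  define \<alpha> where "\<alpha> q = cc.rd (cc.cyc (coboundary r) U UW q) (cc.bnd (coboundary r) (coch r (Rg r) n) (coch r I n) q)" for q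
  define \<beta> where "\<beta> q = cc.rd (cc.cyc (coboundary r) (coch r (Rg r) n) (coch r I n) q) (cc.bnd (coboundary r) (coch r (Rg r) n) (\<lambda>q. U q + coch r I n q) q)" for q
  define \<rho> where "\<rho> q = cc.rd (cc.cyc (coboundary r) U UW (q + 1) \<inter> cc.bnd (coboundary r) (coch r (Rg r) n) (coch r I n) (q + 1))
      (cc.bnd (coboundary r) U UW (q + 1))" for q
  have C: "homogeneous_ideal r (colon r I x)" using colon_hi[OF I x(1)] .
  have U: "cc.subspace (U q)" for q
    unfolding U_def by (intro cc.subspace_image mult_cochain_linear coch_subspace Rg_hi)
  have UR: "U q \<subseteq> coch r (Rg r) n q" for q
    unfolding U_def using mult_cochain_coch[OF Rg_hi x(1)] by blast
  have dU: "coboundary r c \<in> U (q + 1)" if "c \<in> U q" for c q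
    using that coboundary_coch[OF Rg_hi] by (auto simp: U_def mult_cochain_coboundary)
  note les = cc.long_exact_sequence[where V = "coch r (Rg r) n" and W = "coch r I n" and U = U,
      OF coboundary_linear coch_subspace[OF Rg_hi] coch_subspace[OF I] U
      coch_mono[OF hi_Rg[OF I]] UR coboundary_coch[OF Rg_hi] coboundary_coch[OF I] dU coboundary_coboundary]
  have cb: "cc.cyc (coboundary r) U UW q = mult_cochain x ` Zc r (colon r I x) (n - int e) q"
    "cc.bnd (coboundary r) U UW q = mult_cochain x ` Bc r (colon r I x) (n - int e) q" for q
    unfolding U_def UW_def by (rule mult_cochain_cyc_bnd[OF I x(1)])+
  have adj: "coch r (adj r I x) n = (\<lambda>q. U q + coch r I n q)"
    unfolding U_def by (rule ext) (rule coch_adj[OF I x(1)])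
  show thesis
  proof (rule that)
    fix q
    show "hc r (colon r I x) (n - int e) q = \<alpha> q + \<rho> (q - 1)"
      using les(1)[of q] rd_mult_cochain[OF x(2) Zc_subspace[OF C] Bc_subspace[OF C], of "n - int e" q "n - int e" q] cb
      unfolding \<alpha>_def \<rho>_def hc_def UW_def by simp
    show "hc r (adj r I x) n q = \<beta> q + \<rho> q"
      using les(2)[of q] unfolding \<beta>_def \<rho>_def hc_def UW_def Zc_def Bc_def adj by simp
    show "hc r I n q = \<alpha> q + \<beta> q"
      using les(3)[of q] unfolding \<alpha>_def \<beta>_def hc_def UW_def Zc_def Bc_def by simp
    fix v assume r0: "\<rho> (q - 1) = 0" and v: "v \<in> Zc r (colon r I x) (n - int e) q" "mult_cochain x v \<in> Bc r I n q"
    have "mult_cochain x ` Zc r (colon r I x) (n - int e) q \<inter> Bc r I n q \<subseteq> mult_cochain x ` Bc r (colon r I x) (n - int e) q"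
      using r0 unfolding \<rho>_def cb diff_add_cancel Bc_def[of r I n, symmetric]
      by (subst (asm) cc.rd_zero_iff)
        (auto intro!: cc.subspace_inter cc.subspace_image mult_cochain_linear Zc_subspace Bc_subspace C I)
    then have "mult_cochain x v \<in> mult_cochain x ` Bc r (colon r I x) (n - int e) q" using v by blast
    then show "v \<in> Bc r (colon r I x) (n - int e) q" using mult_cochain_inj[OF x(2)] by auto
  qed
qed

lemma Hc_exact:
  assumes I: "homogeneous_ideal r I" and x: "x \<in> Rn r e" "x \<noteq> 0"
  shows "Hc r I n = Hc r (colon r I x) (n - int e) + Hc r (adj r I x) n"
proof -
  let ?V = "coch r (Rg r) n 0" and ?W = "coch r I n 0" and ?U = "mult_cochain x ` coch r (Rg r) (n - int e) 0"
  have C: "homogeneous_ideal r (colon r I x)" using colon_hi[OF I x(1)] .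
  have V: "cc.subspace ?V" and W: "cc.subspace ?W" and V': "cc.subspace (coch r (Rg r) (n - int e) 0)"
    using coch_subspace Rg_hi I by blast+
  have U: "cc.subspace ?U" by (intro cc.subspace_image mult_cochain_linear V')
  have UV: "?U \<subseteq> ?V" using mult_cochain_coch[OF Rg_hi x(1)] by blast
  have "Hc r I n = cc.rd ?U ?W + cc.rd ?V (?U + ?W)"
    unfolding Hc_def by (intro cc.rd_chain V U W UV)
  also have "cc.rd ?U ?W = Hc r (colon r I x) (n - int e)"
    unfolding Hc_def by (rule rd_image[OF mult_cochain_linear V' coch_subspace[OF C] W]) (rule mult_cochain_coch_colon[OF I x(1)])
  finally show ?thesis unfolding Hc_def coch_adj[OF I x(1)] .
qed

text \<open>The contracting homotopy of the complex over \<open>x_i \<noteq> 0\<close>. Its values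
  may still have \<open>x_i\<close> in the denominator, so it becomes a cochain only after
  multiplication by a power of \<open>x_i\<close>.\<close>

definition contraction :: "nat \<Rightarrow> nat \<Rightarrow> (nat set \<Rightarrow> claurent) \<Rightarrow> nat set \<Rightarrow> claurent" where
  "contraction r i c J = (if J \<subseteq> {..r} \<and> i \<notin> J then sgn_in J i * c (insert i J) else 0)"

text \<open>If \<open>i \<in> K\<close>, only the face opposite to \<open>i\<close> survives and
  returns \<open>c K\<close>. Otherwise \<open>c K\<close> comes from the face of
  \<open>insert i K\<close> that omits \<open>i\<close>, and the other faces cancel between the two
  terms.\<close>

lemma homotopy:
  assumes i: "i \<le> r" and c: "\<And>J. \<not> J \<subseteq> {..r} \<Longrightarrow> c J = 0"
  shows "coboundary r (contraction r i c) + contraction r i (coboundary r c) = c"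
proof (rule ext)
  fix K
  show "(coboundary r (contraction r i c) + contraction r i (coboundary r c)) K = c K"
  proof (cases "K \<subseteq> {..r}")
    case True
    have fin: "finite K" using True finite_subset by blast
    show ?thesis
    proof (cases "i \<in> K")
      case iK: True
      have ii: "sgn_in (K - {i}) i = sgn_in K i"
        unfolding sgn_in_def by (intro arg_cong[of _ _ "\<lambda>A. (- 1) ^ card A"]) auto
      have "coboundary r (contraction r i c) K = (\<Sum>j\<in>K. if j = i then sgn_in K i * (sgn_in (K - {i}) i * c K) else 0)"
        using True iK by (auto simp: coboundary_eq contraction_def insert_absorb intro!: sum.cong)
      also have "\<dots> = c K" using fin iK ii sgn_in_sq[of K i] by (simp add: mult.assoc[symmetric])
      finally show ?thesis using iK by (simp add: contraction_def)
    next
      case iK: False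
      let ?L = "insert i K"
      have L: "?L \<subseteq> {..r}" "finite ?L" using True i fin by auto
      have Li: "?L - {i} = K" using iK by auto
      have ii: "sgn_in ?L i = sgn_in K i"
        unfolding sgn_in_def by (intro arg_cong[of _ _ "\<lambda>A. (- 1) ^ card A"]) auto
      have 1: "coboundary r (contraction r i c) K = (\<Sum>j\<in>K. sgn_in K j * (sgn_in (K - {j}) i * c (?L - {j})))"
        unfolding coboundary_eq using True iK
        by (auto simp: contraction_def insert_Diff_if intro!: sum.cong)
      have "contraction r i (coboundary r c) K = sgn_in K i * (\<Sum>j\<in>?L. sgn_in ?L j * c (?L - {j}))"
        using True iK L by (simp add: contraction_def coboundary_eq)
      also have "\<dots> = sgn_in K i * (sgn_in ?L i * c K) + (\<Sum>j\<in>K. sgn_in K i * (sgn_in ?L j * c (?L - {j})))"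
        using fin iK Li by (simp add: distrib_left sum_distrib_left)
      also have "sgn_in K i * (sgn_in ?L i * c K) = c K" using ii sgn_in_sq[of K i] by (simp add: mult.assoc[symmetric])
      finally have 2: "contraction r i (coboundary r c) K = c K + (\<Sum>j\<in>K. sgn_in K i * (sgn_in ?L j * c (?L - {j})))" .
      have "sgn_in K j * (sgn_in (K - {j}) i * c (?L - {j})) + sgn_in K i * (sgn_in ?L j * c (?L - {j})) = 0" if j: "j \<in> K" for j
      proof -
        have ne: "j \<noteq> i" using j iK by auto
        have "sgn_in ?L j * sgn_in (?L - {j}) i = - (sgn_in ?L i * sgn_in (?L - {i}) j)"
          using L j ne by (intro sgn_in_swap) auto
        moreover have "sgn_in (?L - {j}) i = sgn_in (K - {j}) i"
          unfolding sgn_in_def by (intro arg_cong[of _ _ "\<lambda>A. (- 1) ^ card A"]) auto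
        ultimately have s: "sgn_in ?L j * sgn_in (K - {j}) i = - (sgn_in K i * sgn_in K j)" using ii Li by simp
        have "sgn_in K j * sgn_in (K - {j}) i
            = sgn_in K j * (sgn_in ?L j * sgn_in ?L j) * sgn_in (K - {j}) i" by (simp add: sgn_in_sq)
        also have "\<dots> = sgn_in K j * sgn_in ?L j * (sgn_in ?L j * sgn_in (K - {j}) i)" by (simp add: ac_simps)
        also have "\<dots> = - (sgn_in K i * sgn_in ?L j * (sgn_in K j * sgn_in K j))" unfolding s by (simp add: ac_simps)
        finally have "sgn_in K j * sgn_in (K - {j}) i = - (sgn_in K i * sgn_in ?L j)" by (simp add: sgn_in_sq)
        then show ?thesis by (simp add: mult.assoc[symmetric])
      qed
      then show ?thesis using 1 2 by (simp add: sum.distrib[symmetric])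
    qed
  qed (use c in \<open>simp add: coboundary_eq contraction_def\<close>)
qed

text \<open>There are finitely many index sets, so one exponent clears all denominators.\<close>

lemma contraction_clear:
  assumes I: "homogeneous_ideal r I" and i: "i \<le> r" and c: "c \<in> coch r I n q"
  shows "\<exists>k. \<forall>l\<ge>k. mult_cochain (var i ^ l) (contraction r i c) \<in> coch r I (n + int l) (q - 1)"
proof -
  have "\<exists>k. \<forall>l\<ge>k. laurent_of (var i ^ l) * contraction r i c J \<in> loc (n + int l) I J"
    if J: "J \<subseteq> {..r}" "int (card J) = q - 1" for J
  proof (cases "i \<in> J")
    case True
    then show ?thesis using pm.subspace_0[OF loc_subspace[OF I J(1)]] by (simp add: contraction_def)
  next
    case False
    have fin: "finite J" using J finite_subset by blast
    have "c (insert i J) \<in> loc n I (insert i J)"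
      using J i False fin by (intro coch_in[OF c]) auto
    then obtain k where k: "\<forall>l\<ge>k. laurent_of (var i ^ l) * c (insert i J) \<in> loc (n + int l) I J"
      using loc_clear[OF I i False J(1)] by blast
    have "sgn_in J i = 1 \<or> sgn_in J i = - 1" by (simp add: sgn_in_def minus_one_power_iff)
    then show ?thesis using k J False pm.subspace_neg[OF loc_subspace[OF I J(1)]]
      by (intro exI[of _ k]) (auto simp: contraction_def)
  qed
  then obtain k where k: "\<And>J l. J \<subseteq> {..r} \<Longrightarrow> int (card J) = q - 1 \<Longrightarrow> k J \<le> l
      \<Longrightarrow> laurent_of (var i ^ l) * contraction r i c J \<in> loc (n + int l) I J" by metis
  define m where "m = Max (insert 0 (k ` Pow {..r}))"
  have m: "k J \<le> m" if "J \<subseteq> {..r}" for J unfolding m_def using that by (intro Max_ge) auto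
  have "mult_cochain (var i ^ l) (contraction r i c) \<in> coch r I (n + int l) (q - 1)" if l: "m \<le> l" for l
    unfolding coch_def
  proof (intro CollectI allI)
    fix J
    have "contraction r i c J = 0" if "J \<subseteq> {..r}" "int (card J) \<noteq> q - 1"
    proof (cases "i \<in> J")
      case False
      have "finite J" using that finite_subset by blast
      then have "int (card (insert i J)) \<noteq> q" using that False by simp
      then show ?thesis using coch_zero[OF c, of "insert i J"] by (simp add: contraction_def)
    qed (simp add: contraction_def)
    moreover have "contraction r i c J = 0" if "\<not> J \<subseteq> {..r}" using that by (simp add: contraction_def)
    ultimately show "if J \<subseteq> {..r} \<and> int (card J) = q - 1 then mult_cochain (var i ^ l) (contraction r i c) J \<in> loc (n + int l) I J
        else mult_cochain (var i ^ l) (contraction r i c) J = 0"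
      using k[of J l] m[of J] l by (auto simp: mult_cochain_def)
  qed
  then show ?thesis by blast
qed

text \<open>Multiply the homotopy identity by a high power of \<open>x_i\<close>: the first term
  becomes a coboundary, and the second takes values in \<open>I\<close> because the coboundary of
  \<open>c\<close> does. So every class is killed by a power of each variable.\<close>

lemma Zc_torsion:
  assumes I: "homogeneous_ideal r I" and i: "i \<le> r" and c: "c \<in> Zc r I n q"
  shows "\<exists>k. mult_cochain (var i ^ k) c \<in> Bc r I (n + int k) q"
proof -
  interpret d: Vector_Spaces.linear cscale cscale "coboundary r" by (rule coboundary_linear)
  have c: "c \<in> coch r (Rg r) n q" "coboundary r c \<in> coch r I n (q + 1)" using c by (auto simp: Zc_def cc.cyc_def)
  obtain k where k: "\<forall>l\<ge>k. mult_cochain (var i ^ l) (contraction r i c) \<in> coch r (Rg r) (n + int l) (q - 1)"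
    using contraction_clear[OF Rg_hi i c(1)] by blast
  obtain k' where k': "\<forall>l\<ge>k'. mult_cochain (var i ^ l) (contraction r i (coboundary r c)) \<in> coch r I (n + int l) (q + 1 - 1)"
    using contraction_clear[OF I i c(2)] by blast
  let ?l = "max k k'"
  have "c J = 0" if "\<not> J \<subseteq> {..r}" for J using coch_zero[OF c(1)] that by blast
  then have "coboundary r (contraction r i c) + contraction r i (coboundary r c) = c" using homotopy[OF i, of c] by simp
  from arg_cong[OF this, of "mult_cochain (var i ^ ?l)"]
  have "mult_cochain (var i ^ ?l) c = mult_cochain (var i ^ ?l) (coboundary r (contraction r i c)) + mult_cochain (var i ^ ?l) (contraction r i (coboundary r c))"
    by (simp only: mult_cochain_add)
  then have "mult_cochain (var i ^ ?l) c = coboundary r (mult_cochain (var i ^ ?l) (contraction r i c)) + mult_cochain (var i ^ ?l) (contraction r i (coboundary r c))"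
    by (simp add: mult_cochain_coboundary)
  moreover have "mult_cochain (var i ^ ?l) (contraction r i c) \<in> coch r (Rg r) (n + int ?l) (q - 1)"
    "mult_cochain (var i ^ ?l) (contraction r i (coboundary r c)) \<in> coch r I (n + int ?l) q" using k k' by auto
  ultimately have "mult_cochain (var i ^ ?l) c \<in> Bc r I (n + int ?l) q" by (auto simp: Bc_def cc.bnd_def)
  then show ?thesis by blast
qed

section \<open>The Hilbert polynomial and the Euler characteristic\<close>

lemma var_nonzero: "var i \<noteq> 0"
proof
  assume "var i = 0"
  then have "Poly_Mapping.lookup (var i) (Poly_Mapping.single i 1) = 0" by simp
  then show False by (simp add: var_def)
qed

lemma hc_zero:
  assumes I: "homogeneous_ideal r I" and q: "q < 0 \<or> int r + 1 < q"
  shows "hc r I n q = 0"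
proof -
  have "c = 0" if c: "c \<in> coch r (Rg r) n q" for c
  proof
    fix J
    have "int (card J) \<le> int r + 1" if "J \<subseteq> {..r}" using card_mono[OF _ that] by simp
    then have "\<not> J \<subseteq> {..r} \<or> int (card J) \<noteq> q" using q by auto
    then show "c J = 0 J" using coch_zero[OF c] by simp
  qed
  then have "Zc r I n q \<subseteq> Bc r I n q"
    using cc.subspace_0[OF Bc_subspace[OF I]] by (auto simp: Zc_def cc.cyc_def)
  then show ?thesis
    unfolding hc_def using cc.rd_zero_iff[OF Zc_subspace[OF I] Bc_subspace[OF I]] by blast
qed

lemma card_0_iff: "J \<subseteq> {..r} \<and> int (card J) = 0 \<longleftrightarrow> J = {}" for J :: "nat set"
  using finite_subset[of J "{..r}"] by auto

lemma loc_empty: "loc n I {} = {f \<in> homog n. \<exists>p\<in>I. f = laurent_of p}"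
  by (simp add: loc_def)

lemma Hc_eq: "homogeneous_ideal r I \<Longrightarrow> Hc r I (int n) = pm.rd (Rn r n) I"
proof -
  assume I: "homogeneous_ideal r I"
  define \<psi> :: "cpoly \<Rightarrow> nat set \<Rightarrow> claurent" where "\<psi> f J = (if J = {} then laurent_of f else 0)" for f J
  have coch0: "c \<in> coch r I' (int n) 0 \<longleftrightarrow> (\<exists>f. c = \<psi> f \<and> f \<in> I' \<inter> homog n)" for c I'
  proof
    assume c: "c \<in> coch r I' (int n) 0"
    then have "c {} \<in> loc (int n) I' {}" by (intro coch_in[OF c]) auto
    then obtain p where p: "p \<in> I'" "c {} = laurent_of p" "laurent_of p \<in> homog (int n)" by (auto simp: loc_empty)
    have "c J = \<psi> p J" for J using coch_zero[OF c, of J] p card_0_iff[of J r] by (cases "J = {}") (auto simp: \<psi>_def)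
    then show "\<exists>f. c = \<psi> f \<and> f \<in> I' \<inter> homog n" using p laurent_of_homog_iff by blast
  next
    assume "\<exists>f. c = \<psi> f \<and> f \<in> I' \<inter> homog n"
    then obtain f where "c = \<psi> f" "f \<in> I'" "f \<in> homog n" by auto
    then show "c \<in> coch r I' (int n) 0"
      unfolding coch_def card_0_iff by (auto simp: \<psi>_def loc_empty laurent_of_homog_iff)
  qed
  have lin: "Vector_Spaces.linear smul cscale \<psi>"
    unfolding Vector_Spaces.linear_iff
    by (intro conjI allI cc.vector_space_axioms pm.vector_space_axioms)
      (auto simp: \<psi>_def fun_eq_iff laurent_of_add laurent_of_smul)
  have inj: "\<psi> f = \<psi> g \<Longrightarrow> f = g" for f g
    by (drule fun_cong[of _ _ "{}"]) (simp add: \<psi>_def)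
  have "cc.rd (\<psi> ` Rn r n) (coch r I (int n) 0) = pm.rd (Rn r n) I"
  proof (rule rd_image[OF lin Rn_subspace hi_subspace[OF I] coch_subspace[OF I]])
    fix v assume "v \<in> Rn r n"
    then show "\<psi> v \<in> coch r I (int n) 0 \<longleftrightarrow> v \<in> I" unfolding coch0 using inj by blast
  qed
  moreover have "\<psi> ` Rn r n = coch r (Rg r) (int n) 0" using coch0[of _ "Rg r"] by blast
  ultimately show ?thesis by (simp add: Hc_def)
qed

lemma Hc_neg:
  assumes I: "homogeneous_ideal r I" and n: "n < 0"
  shows "Hc r I n = 0"
proof -
  have "c = 0" if c: "c \<in> coch r (Rg r) n 0" for c
  proof
    fix J
    have "c {} \<in> loc n (Rg r) {}" by (intro coch_in[OF c]) auto
    then have "c {} = 0" using laurent_of_homog_neg n by (fastforce simp: loc_empty)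
    then show "c J = 0 J" using coch_zero[OF c, of J] card_0_iff[of J r] by (cases "J = {}") auto
  qed
  then have "coch r (Rg r) n 0 \<subseteq> coch r I n 0" using cc.subspace_0[OF coch_subspace[OF I]] by auto
  then show ?thesis
    unfolding Hc_def using cc.rd_zero_iff[OF coch_subspace[OF Rg_hi] coch_subspace[OF I]] by blast
qed

lemma Hc_finite:
  assumes I: "homogeneous_ideal r I"
  shows "Hc r I n \<noteq> \<infinity>"
proof (cases "n < 0")
  case False
  then obtain k where "n = int k" using zero_le_imp_eq_int[of n] by auto
  then show ?thesis using Hc_eq[OF I] pm.rd_finite_iff[OF hi_subspace[OF I]] fd_Rn[OF hi_subspace[OF I]] by simp
qed (simp add: Hc_neg[OF I])

definition chi :: "nat \<Rightarrow> cpoly set \<Rightarrow> int \<Rightarrow> real" where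
  "chi r I n = (\<Sum>q\<le>Suc r. (- 1) ^ q * real (the_enat (hc r I n (int q))))"

lemma alternating_telescope:
  "(\<Sum>q\<le>N. (- 1) ^ q * (b (int q - 1) + b (int q))) = b (- 1) + (- 1) ^ N * (b (int N) :: real)"
  by (induction N) (simp_all add: algebra_simps)

lemma the_enat_add: "x \<noteq> \<infinity> \<Longrightarrow> y \<noteq> \<infinity> \<Longrightarrow> real (the_enat (x + y)) = real (the_enat x) + real (the_enat y)"
  by (cases x; cases y) simp_all

text \<open>In the alternating sum the ranks \<open>\<alpha>\<close> and \<open>\<beta>\<close> add
  up to the middle term, and the ranks \<open>\<rho>\<close> telescope.\<close>

lemma chi_exact:
  assumes I: "homogeneous_ideal r I" and x: "x \<in> Rn r e" "x \<noteq> 0"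
    and fC: "\<And>q. hc r (colon r I x) (n - int e) q \<noteq> \<infinity>" and fA: "\<And>q. hc r (adj r I x) n q \<noteq> \<infinity>"
  shows "chi r I n = chi r (colon r I x) (n - int e) + chi r (adj r I x) n"
proof -
  obtain \<alpha> \<beta> \<rho> :: "int \<Rightarrow> enat" where
    C: "\<And>q. hc r (colon r I x) (n - int e) q = \<alpha> q + \<rho> (q - 1)" and
    A: "\<And>q. hc r (adj r I x) n q = \<beta> q + \<rho> q" and
    E: "\<And>q. hc r I n q = \<alpha> q + \<beta> q"
    using hc_exact[OF I x, of n] by metis
  have fin: "\<alpha> q \<noteq> \<infinity>" "\<beta> q \<noteq> \<infinity>" "\<rho> q \<noteq> \<infinity>" for q
    using fC[of q] fA[of q] unfolding C[of q] A[of q] plus_eq_infty_iff_enat by simp_all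
  \<comment> \<open>The complex lives in degrees 0 to \<open>r + 1\<close>, so both ends of the
    telescoping sum are zero.\<close>
  have "\<rho> (- 1) = 0" using A[of "- 1"] hc_zero[OF adj_hi[OF I x(1)], of "- 1" n] by simp
  moreover have "\<rho> (int (Suc r)) = 0"
    using C[of "int r + 2"] hc_zero[OF colon_hi[OF I x(1)], of "int r + 2" "n - int e"] by (simp add: add.commute)
  ultimately have 0: "(\<Sum>q\<le>Suc r. (- 1) ^ q * (real (the_enat (\<rho> (int q - 1))) + real (the_enat (\<rho> (int q))))) = 0"
    by (subst alternating_telescope) (simp add: zero_enat_def)
  have "chi r (colon r I x) (n - int e) + chi r (adj r I x) n = chi r I n
    + (\<Sum>q\<le>Suc r. (- 1) ^ q * (real (the_enat (\<rho> (int q - 1))) + real (the_enat (\<rho> (int q)))))"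
    unfolding chi_def C A E sum.distrib[symmetric]
    by (intro sum.cong refl) (simp only: the_enat_add fin not_False_eq_True, simp add: algebra_simps)
  then show ?thesis using 0 by simp
qed

text \<open>
  By the augmentation, \<open>chi r I n\<close> is the dimension of \<open>(R/I)\<^sub>n\<close> minus the Euler characteristic of
  \<open>\<O>\<^sub>X(n)\<close>.  Hence \<open>good r I p\<close> says that \<open>p\<close> is this Euler characteristic, together with Serre vanishing.
\<close>

definition good :: "nat \<Rightarrow> cpoly set \<Rightarrow> real poly \<Rightarrow> bool" where
  "good r I p \<longleftrightarrow> (\<forall>n q. hc r I n q \<noteq> \<infinity>) \<and> (\<exists>n0. \<forall>n\<ge>n0. \<forall>q. hc r I n q = 0) \<and>
     (\<forall>n. chi r I n = real (the_enat (Hc r I n)) - poly p (real_of_int n))"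

text \<open>The difference of \<open>t ^ (n + 1) / (n + 1)\<close> is \<open>t ^ n\<close> up to
  lower powers, which have antidifferences by induction.\<close>

lemma antidifference_power: "\<exists>P :: real poly. \<forall>t. poly P t - poly P (t - 1) = t ^ n"
proof (induction n rule: less_induct)
  case (less n)
  then obtain P where P: "\<And>k t. k < n \<Longrightarrow> poly (P k) t - poly (P k) (t - 1) = (t :: real) ^ k" by metis
  define c where "c k = real (Suc n choose k) * (- 1) ^ (Suc n - k)" for k
  have "(t - 1) ^ Suc n = t ^ Suc n - real (Suc n) * t ^ n + (\<Sum>k<n. c k * t ^ k)" for t :: real
  proof -
    have "(t + (- 1)) ^ Suc n = (\<Sum>k\<le>Suc n. real (Suc n choose k) * t ^ k * (- 1) ^ (Suc n - k))"
      by (rule binomial_ring)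
    also have "\<dots> = (\<Sum>k\<le>Suc n. c k * t ^ k)" by (simp add: c_def mult.commute mult.left_commute)
    also have "\<dots> = (\<Sum>k<Suc (Suc n). c k * t ^ k)" by (simp add: lessThan_Suc_atMost)
    also have "\<dots> = (\<Sum>k<n. c k * t ^ k) + c n * t ^ n + c (Suc n) * t ^ Suc n" by simp
    finally show ?thesis by (simp add: c_def algebra_simps)
  qed
  then have key: "t ^ Suc n - (t - 1) ^ Suc n + (\<Sum>k<n. c k * t ^ k) = real (Suc n) * t ^ n" for t :: real
    by simp
  define Q where "Q = smult (1 / real (Suc n)) (monom 1 (Suc n) + (\<Sum>k<n. smult (c k) (P k)))"
  have "poly Q t - poly Q (t - 1) = t ^ n" for t
  proof -
    have "poly Q t - poly Q (t - 1)
      = (t ^ Suc n - (t - 1) ^ Suc n + (\<Sum>k<n. c k * (poly (P k) t - poly (P k) (t - 1)))) / real (Suc n)"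
      by (simp add: Q_def poly_monom poly_sum sum_subtractf right_diff_distrib diff_divide_distrib add_divide_distrib
          sum_divide_distrib del: power_Suc)
    also have "(\<Sum>k<n. c k * (poly (P k) t - poly (P k) (t - 1))) = (\<Sum>k<n. c k * t ^ k)"
      using P by (intro sum.cong) auto
    finally show ?thesis unfolding key by simp
  qed
  then show ?case by blast
qed

lemma antidifference: "\<exists>P :: real poly. \<forall>t. poly P t - poly P (t - 1) = poly g t"
proof -
  obtain P where P: "\<And>k t. poly (P k) t - poly (P k) (t - 1) = (t :: real) ^ k"
    using antidifference_power by metis
  have "poly (\<Sum>k\<le>degree g. smult (coeff g k) (P k)) t - poly (\<Sum>k\<le>degree g. smult (coeff g k) (P k)) (t - 1) = poly g t" for t
    using P by (simp add: poly_sum poly_altdef[of g] sum_subtractf[symmetric] right_diff_distrib[symmetric])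
  then show ?thesis by blast
qed

lemma int_step_const:
  assumes "\<And>n :: int. E n = E (n - 1)"
  shows "E n = E 0"
proof (induction n rule: int_induct[where k = 0])
  case (step1 i)
  then show ?case using assms[of "i + 1"] by simp
next
  case (step2 i)
  then show ?case using assms[of i] by simp
qed simp

text \<open>Here the subscheme is empty: at every nonempty \<open>J\<close> the localization of
  \<open>I\<close> is everything, so only the augmentation term remains, and it vanishes in positive
  degrees.\<close>

lemma good_all_vars:
  assumes I: "homogeneous_ideal r I" and v: "\<forall>i\<le>r. var i \<in> I"
  shows "good r I 0"
proof -
  have locJ: "loc n I J = loc n (Rg r) J" if J: "J \<subseteq> {..r}" "J \<noteq> {}" for n J
  proof
    show "loc n I J \<subseteq> loc n (Rg r) J" by (rule loc_mono_ideal[OF hi_Rg[OF I]])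
    show "loc n (Rg r) J \<subseteq> loc n I J"
    proof
      fix f assume f: "f \<in> loc n (Rg r) J"
      then obtain k p where p: "p \<in> Rg r" "f * xs J k = laurent_of p" by (auto simp: loc_def)
      have fin: "finite J" using J finite_subset by blast
      obtain j where j: "j \<in> J" using J by auto
      have "f * xs J (Suc k) = laurent_of (p * (\<Prod>j\<in>J. var j))"
        using p xs_add[of J k 1] by (simp add: laurent_of_mult mult.assoc[symmetric])
      moreover have "p * (\<Prod>j\<in>J. var j) = (p * (\<Prod>j\<in>J - {j}. var j)) * var j"
        using fin j by (simp add: prod.remove[OF fin j] ac_simps)
      moreover have "(p * (\<Prod>j\<in>J - {j}. var j)) * var j \<in> I"
        using J j v p by (intro hi_mult[OF I] Rg_mult Rg_prod Rg_var) auto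
      ultimately have "\<exists>q\<in>I. f * xs J (Suc k) = laurent_of q" by metis
      moreover have "f \<in> homog n" using f by (simp add: loc_def)
      ultimately show "f \<in> loc n I J" unfolding loc_def by blast
    qed
  qed
  have cochq: "coch r I n q = coch r (Rg r) n q" if "q \<noteq> 0" for n q
  proof -
    have "loc n I J = loc n (Rg r) J" if "J \<subseteq> {..r}" "int (card J) = q" for J
      using locJ[of J] that \<open>q \<noteq> 0\<close> by (cases "J = {}") auto
    then show ?thesis by (simp add: coch_def cong: if_cong conj_cong) 
  qed
  have h: "hc r I n q = (if q = 0 then Hc r I n else 0)" for n q
  proof (cases "q = 0")
    case True
    have "Zc r I n 0 = coch r (Rg r) n 0"
      unfolding Zc_def cc.cyc_def using cochq[of 1 n] coboundary_coch[OF Rg_hi, of _ r n 0] by auto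
    moreover have "coch r (Rg r) n (- 1) = {0}"
    proof -
      have "c = 0" if "c \<in> coch r (Rg r) n (- 1)" for c
        using coch_zero[OF that] by (intro ext) simp
      then show ?thesis using cc.subspace_0[OF coch_subspace[OF Rg_hi]] by blast
    qed
    then have "Bc r I n 0 = coch r I n 0"
      unfolding Bc_def cc.bnd_def using module_hom.zero[OF iffD2[OF module_hom_iff_linear coboundary_linear]] by simp
    ultimately show ?thesis using True by (simp add: hc_def Hc_def)
  next
    case False
    have "Zc r I n q \<subseteq> Bc r I n q"
    proof
      fix c assume "c \<in> Zc r I n q"
      then have "c \<in> coch r I n q" using cochq[OF False] by (simp add: Zc_def cc.cyc_def)
      then show "c \<in> Bc r I n q" unfolding Bc_def cc.bnd_def
        using cc.subset_plus_right[OF cc.subspace_image[OF coboundary_linear coch_subspace[OF Rg_hi]]] by blast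
    qed
    then show ?thesis
      using False cc.rd_zero_iff[OF Zc_subspace[OF I] Bc_subspace[OF I]] by (simp add: hc_def)
  qed
  have "Hc r I n = 0" if "n \<ge> 1" for n
  proof -
    have k: "n = int (Suc (nat (n - 1)))" using that by simp
    define k where "k = nat (n - 1)"
    note k = k[folded k_def]
    have "Rn r (Suc k) \<subseteq> I"
    proof -
      have "(\<Sum>i\<le>r. var i *o Rn r k) \<subseteq> I"
        using v by (intro pm.set_sum_subset hi_subspace[OF I]) (auto simp: elt_set_times_def intro!: hi_mult'[OF I])
      then show ?thesis using Rn_Suc_subset by blast
    qed
    then show ?thesis unfolding k Hc_eq[OF I] using pm.rd_zero_iff[OF Rn_subspace hi_subspace[OF I]] by blast
  qed
  then have "\<exists>n0. \<forall>n\<ge>n0. \<forall>q. hc r I n q = 0" by (intro exI[of _ 1]) (simp add: h)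
  moreover have "chi r I n = real (the_enat (Hc r I n))" for n
  proof -
    have "chi r I n = (\<Sum>q\<le>Suc r. if q = 0 then real (the_enat (Hc r I n)) else 0)"
      unfolding chi_def by (intro sum.cong) (auto simp: h zero_enat_def)
    then show ?thesis by simp
  qed
  moreover have "hc r I n q \<noteq> \<infinity>" for n q using Hc_finite[OF I, of n] i0_ne_infinity unfolding h by (cases "q = 0") (simp_all del: not_infinity_eq)
  ultimately show ?thesis unfolding good_def by simp
qed

lemma good_exact:
  assumes I: "homogeneous_ideal r I" and x: "x \<in> Rn r e" "x \<noteq> 0"
    and C: "good r (colon r I x) pc" and A: "good r (adj r I x) pa"
  shows "good r I (pcompose pc [:- real e, 1:] + pa)"
  unfolding good_def
proof (intro conjI allI)
  fix n q
  obtain \<alpha> \<beta> \<rho> :: "int \<Rightarrow> enat" where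
    "\<And>q. hc r (colon r I x) (n - int e) q = \<alpha> q + \<rho> (q - 1)"
    "\<And>q. hc r (adj r I x) n q = \<beta> q + \<rho> q" "\<And>q. hc r I n q = \<alpha> q + \<beta> q"
    using hc_exact[OF I x, of n] by metis
  then show "hc r I n q \<noteq> \<infinity>" using C A unfolding good_def by (metis plus_eq_infty_iff_enat)
next
  obtain n0 n1 where n: "\<And>n q. n0 \<le> n \<Longrightarrow> hc r (colon r I x) n q = 0" "\<And>n q. n1 \<le> n \<Longrightarrow> hc r (adj r I x) n q = 0"
    using C A unfolding good_def by blast
  have "hc r I n q = 0" if "max (n0 + int e) n1 \<le> n" for n q
  proof -
    obtain \<alpha> \<beta> \<rho> :: "int \<Rightarrow> enat" where
      "\<And>q. hc r (colon r I x) (n - int e) q = \<alpha> q + \<rho> (q - 1)"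
      "\<And>q. hc r (adj r I x) n q = \<beta> q + \<rho> q" "\<And>q. hc r I n q = \<alpha> q + \<beta> q"
      using hc_exact[OF I x, of n] by metis
    moreover have "hc r (colon r I x) (n - int e) q = 0" "hc r (adj r I x) n q = 0" using n that by auto
    ultimately show ?thesis by simp
  qed
  then show "\<exists>n0. \<forall>n\<ge>n0. \<forall>q. hc r I n q = 0" by blast
next
  fix n
  have "chi r I n = chi r (colon r I x) (n - int e) + chi r (adj r I x) n"
    using C A unfolding good_def by (intro chi_exact[OF I x]) auto
  moreover have "real (the_enat (Hc r I n)) = real (the_enat (Hc r (colon r I x) (n - int e))) + real (the_enat (Hc r (adj r I x) n))"
    unfolding Hc_exact[OF I x] by (intro the_enat_add Hc_finite colon_hi[OF I x(1)] adj_hi[OF I x(1)])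
  ultimately show "chi r I n = real (the_enat (Hc r I n)) - poly (pcompose pc [:- real e, 1:] + pa) (real_of_int n)"
    using C A unfolding good_def by (simp add: poly_pcompose)
qed

lemma Zc_mult_cochain:
  assumes I: "homogeneous_ideal r I" and x: "x \<in> Rn r e" and v: "v \<in> Zc r I n q"
  shows "mult_cochain x v \<in> Zc r I (n + int e) q"
  using v mult_cochain_coch[OF Rg_hi x, of v "n + int e" q] mult_cochain_coch[OF I x, of "coboundary r v" "n + int e" "q + 1"]
  by (simp add: Zc_def cc.cyc_def mult_cochain_coboundary)

text \<open>For large twists, injectivity of multiplication by the variable contradicts torsion
  unless the cohomology vanishes; finiteness then descends to all smaller twists, and the polynomial
  is an antidifference of \<open>g\<close>.\<close>

lemma good_regular:
  assumes I: "homogeneous_ideal r I" and i: "i \<le> r" and reg: "colon r I (var i) = I"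
    and A: "good r (adj r I (var i)) g"
  shows "\<exists>p. good r I p"
proof -
  let ?x = "var i"
  have x: "?x \<in> Rn r 1" "?x \<noteq> 0" using Rn_var[OF i] var_nonzero by auto 
  have x1: "n - int 1 = n - 1" for n by simp
  have ex: "\<exists>\<alpha> \<beta> \<rho> :: int \<Rightarrow> enat. (\<forall>q. hc r I (n - 1) q = \<alpha> q + \<rho> (q - 1)) \<and> (\<forall>q. hc r (adj r I ?x) n q = \<beta> q + \<rho> q)
      \<and> (\<forall>q. hc r I n q = \<alpha> q + \<beta> q) \<and>
      (\<forall>q v. \<rho> (q - 1) = 0 \<longrightarrow> v \<in> Zc r I (n - 1) q \<longrightarrow> mult_cochain ?x v \<in> Bc r I n q \<longrightarrow> v \<in> Bc r I (n - 1) q)" for n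
    using hc_exact[OF I x, of n] unfolding reg x1 by metis
  obtain n0 where n0: "\<And>n q. n0 \<le> n \<Longrightarrow> hc r (adj r I ?x) n q = 0" using A unfolding good_def by blast
  have fA: "hc r (adj r I ?x) n q \<noteq> \<infinity>" for n q using A unfolding good_def by blast
  \<comment> \<open>Where \<open>I + (x_i)\<close> has no cohomology, the connecting map is
    zero.\<close>
  have inj: "v \<in> Bc r I m q" if "n0 \<le> m" "v \<in> Zc r I m q" "mult_cochain ?x v \<in> Bc r I (m + 1) q" for m q v
  proof -
    obtain \<alpha> \<beta> \<rho> :: "int \<Rightarrow> enat" where "\<And>q. hc r (adj r I ?x) (m + 1) q = \<beta> q + \<rho> q"
      "\<And>q v. \<rho> (q - 1) = 0 \<Longrightarrow> v \<in> Zc r I m q \<Longrightarrow> mult_cochain ?x v \<in> Bc r I (m + 1) q \<Longrightarrow> v \<in> Bc r I m q"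
      using ex[of "m + 1"] by auto
    moreover have "hc r (adj r I ?x) (m + 1) (q - 1) = 0" using n0 that by auto
    ultimately show ?thesis using that by auto
  qed
  have tors: "v \<in> Bc r I m q" if "n0 \<le> m" "v \<in> Zc r I m q" "mult_cochain (?x ^ k) v \<in> Bc r I (m + int k) q" for m q v k
    using that
  proof (induction k arbitrary: m v)
    case 0
    then show ?case by (simp add: mult_cochain_def)
  next
    case (Suc k)
    have "mult_cochain (?x ^ k) (mult_cochain ?x v) = mult_cochain (?x ^ Suc k) v"
      by (simp add: mult_cochain_def fun_eq_iff laurent_of_mult ac_simps)
    moreover have "mult_cochain ?x v \<in> Zc r I (m + 1) q" using Zc_mult_cochain[OF I x(1) Suc.prems(2)] by simp
    moreover have "m + int (Suc k) = (m + 1) + int k" "n0 \<le> m + 1" using Suc.prems(1) by auto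
    ultimately have "mult_cochain ?x v \<in> Bc r I (m + 1) q"
      using Suc.IH[of "m + 1" "mult_cochain ?x v"] Suc.prems(3) by (simp only:)
    then show ?case using inj Suc.prems by blast
  qed
  have van: "hc r I m q = 0" if "n0 \<le> m" for m q
  proof -
    have "Zc r I m q \<subseteq> Bc r I m q" using tors[OF that] Zc_torsion[OF I i] by blast
    then show ?thesis unfolding hc_def using cc.rd_zero_iff[OF Zc_subspace[OF I] Bc_subspace[OF I]] by blast
  qed
  \<comment> \<open>In the exact sequence, twist \<open>n - 1\<close> is bounded by twist
    \<open>n\<close> and by the cohomology of \<open>I + (x_i)\<close>.\<close>
  have finK: "hc r I (n0 - int k) q \<noteq> \<infinity>" for k q
  proof (induction k arbitrary: q)
    case 0
    then show ?case using van by simp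
  next
    case (Suc k)
    obtain \<alpha> \<beta> \<rho> :: "int \<Rightarrow> enat" where e: "\<And>q. hc r I (n0 - int k - 1) q = \<alpha> q + \<rho> (q - 1)"
      "\<And>q. hc r (adj r I ?x) (n0 - int k) q = \<beta> q + \<rho> q" "\<And>q. hc r I (n0 - int k) q = \<alpha> q + \<beta> q"
      using ex[of "n0 - int k"] by auto
    have "\<alpha> q \<noteq> \<infinity>" using Suc[of q] unfolding e(3)[of q] plus_eq_infty_iff_enat by simp
    moreover have "\<rho> (q - 1) \<noteq> \<infinity>"
      using fA[of "n0 - int k" "q - 1"] unfolding e(2)[of "q - 1"] plus_eq_infty_iff_enat by simp
    moreover have "n0 - int (Suc k) = n0 - int k - 1" by simp
    ultimately show ?case using e(1)[of q] plus_eq_infty_iff_enat by metis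
  qed
  have fin: "hc r I n q \<noteq> \<infinity>" for n q
  proof (cases "n0 \<le> n")
    case False
    then have "n = n0 - int (nat (n0 - n))" by simp
    then show ?thesis using finK by metis
  qed (simp add: van)
  obtain P where P: "\<And>t. poly P t - poly P (t - 1) = poly g t" using antidifference by blast
  \<comment> \<open>The sequence fixes the polynomial only up to a constant; \<open>E\<close> is
    that constant, since it does not change from \<open>n - 1\<close> to \<open>n\<close>.\<close>
  define E where "E n = chi r I n - real (the_enat (Hc r I n)) + poly P (real_of_int n)" for n
  have "E n = E (n - 1)" for n
  proof -
    have "chi r I n = chi r I (n - 1) + chi r (adj r I ?x) n"
      using chi_exact[OF I x, of n] fin fA unfolding reg by simp
    moreover have "real (the_enat (Hc r I n)) = real (the_enat (Hc r I (n - 1))) + real (the_enat (Hc r (adj r I ?x) n))"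
      using Hc_exact[OF I x, of n] the_enat_add[OF Hc_finite[OF I] Hc_finite[OF adj_hi[OF I x(1)]], of "n - 1" n]
      unfolding reg by simp
    moreover have "chi r (adj r I ?x) n = real (the_enat (Hc r (adj r I ?x) n)) - poly g (real_of_int n)"
      using A unfolding good_def by blast
    ultimately show ?thesis using P[of "real_of_int n"] unfolding E_def by simp
  qed
  then have E: "E n = E 0" for n by (rule int_step_const)
  have "chi r I n = real (the_enat (Hc r I n)) - poly (P - [:E 0:]) (real_of_int n)" for n
    using E[of n] unfolding E_def[of n] by simp
  then have "good r I (P - [:E 0:])" unfolding good_def using fin van by blast
  then show ?thesis ..
qed

text \<open>Cut by a variable outside \<open>I\<close>. Either it is a nonzerodivisor modulo
  \<open>I\<close>, or both outer ideals of the exact sequence are strictly larger than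
  \<open>I\<close>.\<close>

theorem good_exists: "homogeneous_ideal r I \<Longrightarrow> \<exists>p. good r I p"
proof (induction I rule: hi_induct)
  case (step I)
  show ?case
  proof (cases "\<forall>i\<le>r. var i \<in> I")
    case True
    then show ?thesis using good_all_vars step(1) by blast
  next
    case False
    then obtain i where i: "i \<le> r" "var i \<notin> I" by blast
    have x: "var i \<in> Rn r 1" "var i \<noteq> 0" using Rn_var[OF i(1)] var_nonzero by auto
    have "I \<subset> adj r I (var i)" using adj_mono[of I r "var i"] adj_self[OF step(1), of "var i"] i by blast
    then obtain g where g: "good r (adj r I (var i)) g" using step(2)[OF adj_hi[OF step(1) x(1)]] by blast
    show ?thesis
    proof (cases "colon r I (var i) = I")
      case True
      then show ?thesis using good_regular[OF step(1) i(1) _ g] by blast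
    next
      case False
      then have "I \<subset> colon r I (var i)" using colon_mono[OF step(1), of "var i"] x(1) by auto
      then obtain pc where "good r (colon r I (var i)) pc" using step(2)[OF colon_hi[OF step(1) x(1)]] by blast
      then show ?thesis using good_exact[OF step(1) x _ g] by blast
    qed
  qed
qed

section \<open>Comparison with the given Hilbert polynomial and Euler characteristic\<close>

definition hf :: "nat \<Rightarrow> cpoly set \<Rightarrow> nat \<Rightarrow> nat" where
  "hf r I n = the_enat (pm.rd (Rn r n) I)"

lemma hf_enat: "homogeneous_ideal r I \<Longrightarrow> enat (hf r I n) = pm.rd (Rn r n) I"
  unfolding hf_def using pm.rd_finite_iff[OF hi_subspace, of r I "Rn r n"] fd_Rn[OF hi_subspace, of r I r n]
  by (cases "pm.rd (Rn r n) I") simp_all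

lemma hilbert_function_eq:
  assumes I: "homogeneous_ideal r I"
  shows "hilbert_function r I n = hf r I n"
proof -
  have W: "pm.subspace (I \<inter> homog n)" using hi_subspace[OF I] homog_subspace pm.subspace_inter by blast
  have "enat (quot_dim smul (Rn r n) (I \<inter> homog n)) = pm.rd (Rn r n) (I \<inter> homog n)"
    unfolding quot_dim_def by (rule pm.quot_dim_eq_rd[OF Rn_subspace W fd_Rn[OF W]])
  also have "I \<inter> homog n = Rn r n \<inter> I" using hi_Rg[OF I] by blast
  also have "pm.rd (Rn r n) (Rn r n \<inter> I) = pm.rd (Rn r n) I" by (rule pm.rd_inter[OF Rn_subspace hi_subspace[OF I]])
  finally show ?thesis unfolding hilbert_function_def hf_enat[OF I, symmetric] using \<open>I \<inter> homog n = Rn r n \<inter> I\<close> by simp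
qed

lemma poly_eq_eventually:
  fixes p q :: "real poly"
  assumes "\<forall>\<^sub>F t in sequentially. poly p (real t) = poly q (real t)"
  shows "p = q"
proof -
  obtain N where N: "\<And>t. N \<le> t \<Longrightarrow> poly p (real t) = poly q (real t)"
    using assms unfolding eventually_sequentially by blast
  have "real ` {N..} \<subseteq> {x. poly (p - q) x = 0}" using N by auto
  moreover have "infinite (real ` {N..})"
    using infinite_Ici[of N] finite_imageD[of real "{N..}"] by (auto simp: inj_on_def)
  ultimately have "infinite {x. poly (p - q) x = 0}" using finite_subset by blast
  then show ?thesis using poly_roots_finite[of "p - q"] by auto
qed

text \<open>The augmentation changes the Cech complex in one place only. If \<open>z\<close> is the
  rank of the augmentation map, then \<open>H\<^sup>0\<close> has dimension \<open>z + h 1\<close>,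
  while \<open>R/I\<close> has dimension \<open>h 0 + z\<close> in degree 0; hence the Euler
  characteristic is the dimension of \<open>R/I\<close> in degree 0 minus
  \<open>chi\<close>.\<close>

lemma euler_characteristic_good:
  assumes I: "homogeneous_ideal r I" and g: "good r I p"
  shows "real_of_int (euler_characteristic r I) = poly p 0"
proof -
  let ?C = "coch r (Rg r) 0" and ?D = "coch r I 0"
  have fin: "hc r I n q \<noteq> \<infinity>" for n q using g unfolding good_def by blast
  have cyc: "cech_cocycles r I p = Zc r I 0 (int p + 1)" for p
    unfolding cech_cocycles_def Zc_def cc.cyc_def cochains_eq
    by (simp add: add.commute)
  have qd: "enat (quot_dim cscale V W) = cc.rd V W" if "cc.subspace V" "cc.subspace W" "cc.rd V W \<noteq> \<infinity>" for V W
    unfolding quot_dim_def using that cc.rd_finite_iff[OF that(2)] by (intro cc.quot_dim_eq_rd) auto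
  have coh_Suc: "enat (cohomology_dim r I (Suc p)) = hc r I 0 (int (Suc p) + 1)" for p
  proof -
    have "cech_coboundaries r I (Suc p) = Bc r I 0 (int (Suc p) + 1)"
      unfolding cech_coboundaries_def Bc_def cc.bnd_def cochains_eq set_plus_def
      by (auto simp: add.commute)
    then show ?thesis
      unfolding cohomology_dim_def cyc hc_def
      using qd[OF Zc_subspace[OF I] Bc_subspace[OF I]] fin[of 0 "int (Suc p) + 1"] unfolding hc_def by simp
  qed
  have Z1: "cc.subspace (Zc r I 0 q)" and B1: "cc.subspace (Bc r I 0 q)" for q
    using Zc_subspace[OF I] Bc_subspace[OF I] by blast+
  have C: "cc.subspace (?C q)" and D: "cc.subspace (?D q)" for q
    using coch_subspace[OF Rg_hi] coch_subspace[OF I] by blast+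
  interpret d: Vector_Spaces.linear cscale cscale "coboundary r" by (rule coboundary_linear)
  have dC: "cc.subspace (coboundary r ` ?C q)" for q by (rule cc.subspace_image[OF coboundary_linear C])
  have r0: "cc.rd (?C 0) (Zc r I 0 0) = cc.rd (coboundary r ` ?C 0) (?D 1)"
    by (rule rd_image[OF coboundary_linear C Z1 D, symmetric]) (simp add: Zc_def cc.cyc_def)
  have B_eq: "Bc r I 0 1 = coboundary r ` ?C 0 + ?D 1" by (simp add: Bc_def cc.bnd_def)
  have B0_eq: "Bc r I 0 0 = ?D 0"
  proof -
    have "c = 0" if "c \<in> ?C (- 1)" for c using coch_zero[OF that] by (intro ext) simp
    then have "?C (- 1) = {0}" using cc.subspace_0[OF C] by blast
    then show ?thesis by (simp add: Bc_def cc.bnd_def d.zero)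
  qed
  have DB: "?D 1 \<subseteq> Bc r I 0 1" unfolding B_eq by (rule cc.subset_plus_right[OF dC])
  have DZ: "?D 0 \<subseteq> Zc r I 0 0"
    using coboundary_coch[OF I, of _ 0 0] coch_mono[OF hi_Rg[OF I], of r 0 0] by (auto simp: Zc_def cc.cyc_def)
  have BZ: "Bc r I 0 1 \<subseteq> Zc r I 0 1"
  proof -
    have "coboundary r ` ?C 0 \<subseteq> Zc r I 0 1"
      using coboundary_coch[OF Rg_hi, of _ r 0 0] coboundary_coboundary[of r] cc.subspace_0[OF D]
      by (auto simp: Zc_def cc.cyc_def)
    moreover have "?D 1 \<subseteq> Zc r I 0 1"
      using coboundary_coch[OF I, of _ 0 1] coch_mono[OF hi_Rg[OF I], of r 0 1] by (auto simp: Zc_def cc.cyc_def)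
    ultimately show ?thesis unfolding B_eq by (rule cc.plus_subset[OF Z1])
  qed
  have self: "cc.rd (?D 1) (?D 1) = 0" by (subst cc.rd_zero_iff) (auto intro: D)
  have coh1: "cc.rd (Zc r I 0 1) (?D 1) = cc.rd (?C 0) (Zc r I 0 0) + hc r I 0 1"
  proof -
    have "cc.rd (Zc r I 0 1) (?D 1) = cc.rd (Bc r I 0 1) (?D 1) + cc.rd (Zc r I 0 1) (Bc r I 0 1 + ?D 1)"
      by (intro cc.rd_chain Z1 B1 D BZ)
    also have "Bc r I 0 1 + ?D 1 = Bc r I 0 1" by (intro cc.plus_absorb B1 D DB)
    also have "cc.rd (Bc r I 0 1) (?D 1) = cc.rd (coboundary r ` ?C 0) (?D 1)"
      unfolding B_eq cc.rd_plus[OF dC D D] cc.plus_absorb[OF D D order_refl] self by simp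
    finally show ?thesis using r0 by (simp add: hc_def)
  qed
  have H0: "Hc r I 0 = hc r I 0 0 + cc.rd (?C 0) (Zc r I 0 0)"
  proof -
    have "Hc r I 0 = cc.rd (Zc r I 0 0) (?D 0) + cc.rd (?C 0) (Zc r I 0 0 + ?D 0)"
      unfolding Hc_def by (intro cc.rd_chain C Z1 D) (auto simp: Zc_def cc.cyc_def)
    then show ?thesis using cc.plus_absorb[OF Z1 D DZ] by (simp add: hc_def B0_eq)
  qed
  have f0: "cc.rd (?C 0) (Zc r I 0 0) \<noteq> \<infinity>"
    using Hc_finite[OF I, of 0] unfolding H0 plus_eq_infty_iff_enat by simp
  \<comment> \<open>Degree zero of the given complex has no incoming differential, so only the
    cochains with values in \<open>I\<close> are divided out.\<close>
  have coh0: "enat (cohomology_dim r I 0) = cc.rd (Zc r I 0 1) (?D 1)"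
  proof -
    have "cech_coboundaries r I 0 = ?D 1"
      unfolding cech_coboundaries_def cochains_eq by (auto simp: d.zero)
    moreover have "cc.rd (Zc r I 0 1) (?D 1) \<noteq> \<infinity>"
      using coh1 f0 fin[of 0 1] by (metis plus_eq_infty_iff_enat)
    ultimately show ?thesis unfolding cohomology_dim_def using qd[OF Z1 D] cyc[of 0] by simp
  qed
  define z where "z = real (the_enat (cc.rd (?C 0) (Zc r I 0 0)))"
  define h where "h q = real (the_enat (hc r I 0 (int q)))" for q
  have c0: "real (cohomology_dim r I 0) = z + h 1"
    using coh0 coh1 the_enat_add[OF f0 fin[of 0 1]] by (simp add: z_def h_def) (metis the_enat.simps)
  have cS: "real (cohomology_dim r I p) = h (Suc p)" if "0 < p" for p
  proof -
    obtain m where "p = Suc m" using \<open>0 < p\<close> gr0_conv_Suc by blast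
    then show ?thesis using coh_Suc[of m] by (simp add: h_def add.commute) (metis the_enat.simps)
  qed
  have HH: "real (the_enat (Hc r I 0)) = h 0 + z"
    unfolding H0 the_enat_add[OF fin f0] by (simp add: z_def h_def)
  have "real_of_int (euler_characteristic r I) = (\<Sum>p\<le>r. (- 1) ^ p * real (cohomology_dim r I p))"
    by (simp add: euler_characteristic_def)
  also have "\<dots> = (\<Sum>p\<le>r. (- 1) ^ p * (if p = 0 then z else 0) + (- 1) ^ p * h (Suc p))"
    by (intro sum.cong) (auto simp: c0 cS distrib_left)
  also have "\<dots> = (\<Sum>p\<le>r. if p = 0 then z else 0) + (\<Sum>p\<le>r. (- 1) ^ p * h (Suc p))"
    unfolding sum.distrib by (intro arg_cong2[of _ _ _ _ "(+)"] sum.cong) auto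
  also have "\<dots> = z - (\<Sum>p\<le>r. (- 1) ^ Suc p * h (Suc p))" by (simp add: sum_negf)
  also have "\<dots> = z + h 0 - chi r I 0"
    unfolding chi_def sum.atMost_Suc_shift by (simp add: h_def)
  also have "\<dots> = poly p 0" using g HH unfolding good_def by simp
  finally show ?thesis .
qed

text \<open>The polynomial in \<open>good\<close> equals the Hilbert function wherever the augmented
  cohomology vanishes, and the Euler characteristic at 0.\<close>

theorem hilbert_polynomial_props:
  assumes I: "homogeneous_ideal r I"
  shows "\<forall>\<^sub>F t in sequentially. poly (hilbert_polynomial r I) (real t) = real (hf r I t)"
    and "real_of_int (euler_characteristic r I) = poly (hilbert_polynomial r I) 0"
proof -
  obtain p where p: "good r I p" using good_exists[OF I] by blast
  then obtain n0 where n0: "\<And>n q. n0 \<le> n \<Longrightarrow> hc r I n q = 0" unfolding good_def by blast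
  have ev: "\<forall>\<^sub>F t in sequentially. poly p (real t) = real (hf r I t)"
    unfolding eventually_sequentially
  proof (intro exI allI impI)
    fix t assume "nat n0 \<le> t"
    then have "n0 \<le> int t" by simp
    then have "chi r I (int t) = 0" unfolding chi_def using n0 by (simp add: zero_enat_def)
    moreover have "chi r I (int t) = real (the_enat (Hc r I (int t))) - poly p (real t)"
      using p unfolding good_def by (metis of_int_of_nat_eq)
    ultimately show "poly p (real t) = real (hf r I t)" by (simp add: Hc_eq[OF I] hf_def)
  qed
  have "hilbert_polynomial r I = p"
    unfolding hilbert_polynomial_def hilbert_function_eq[OF I]
  proof (rule the_equality)
    show "\<forall>\<^sub>F t in sequentially. poly p (real t) = real (hf r I t)" by (rule ev)
    fix q assume "\<forall>\<^sub>F t in sequentially. poly q (real t) = real (hf r I t)"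
    with ev have "\<forall>\<^sub>F t in sequentially. poly q (real t) = poly p (real t)" by eventually_elim simp
    then show "q = p" by (rule poly_eq_eventually)
  qed
  then show "\<forall>\<^sub>F t in sequentially. poly (hilbert_polynomial r I) (real t) = real (hf r I t)"
    and "real_of_int (euler_characteristic r I) = poly (hilbert_polynomial r I) 0"
    using ev euler_characteristic_good[OF I p] by simp_all
qed

lemma hilbert_polynomial_eqI:
  assumes "homogeneous_ideal r I" "\<forall>\<^sub>F t in sequentially. poly p (real t) = real (hf r I t)"
  shows "hilbert_polynomial r I = p"
proof (rule poly_eq_eventually)
  show "\<forall>\<^sub>F t in sequentially. poly (hilbert_polynomial r I) (real t) = poly p (real t)"
    using hilbert_polynomial_props(1)[OF assms(1)] assms(2) by eventually_elim simp
qed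

section \<open>Hilbert functions\<close>

lemma hf_zero_iff: "homogeneous_ideal r I \<Longrightarrow> hf r I n = 0 \<longleftrightarrow> Rn r n \<subseteq> I"
  using hf_enat[of r I n] pm.rd_zero_iff[OF Rn_subspace hi_subspace, of r I r n] by (metis enat_0_iff(1))

lemma hf_mono:
  assumes I: "homogeneous_ideal r I" and J: "homogeneous_ideal r J" and IJ: "I \<inter> homog n \<subseteq> J"
  shows "hf r J n \<le> hf r I n"
proof -
  have "pm.rd (Rn r n) (I \<inter> homog n) = pm.rd (Rn r n) I"
    by (rule pm.rd_cong) (auto intro: Rn_subspace hi_subspace[OF I] homog_subspace pm.subspace_inter)
  moreover have "pm.rd (Rn r n) J \<le> pm.rd (Rn r n) (I \<inter> homog n)"
    by (intro pm.rd_mono_right Rn_subspace pm.subspace_inter hi_subspace[OF I] hi_subspace[OF J] homog_subspace IJ)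
  ultimately show ?thesis using hf_enat[OF I] hf_enat[OF J] by (metis enat_ord_simps(1))
qed

lemma hf_eq_iff:
  assumes I: "homogeneous_ideal r I" and J: "homogeneous_ideal r J" and IJ: "I \<subseteq> J"
  shows "hf r I n = hf r J n \<longleftrightarrow> J \<inter> homog n \<subseteq> I"
proof
  assume "J \<inter> homog n \<subseteq> I"
  then show "hf r I n = hf r J n" using hf_mono[OF I J, of n] hf_mono[OF J I, of n] IJ by (intro antisym) blast+
next
  assume eq: "hf r I n = hf r J n"
  have s: "pm.subspace (Rn r n \<inter> J)" by (intro pm.subspace_inter Rn_subspace hi_subspace[OF J])
  have "pm.rd (Rn r n) I = pm.rd (Rn r n \<inter> J) I + pm.rd (Rn r n) (Rn r n \<inter> J + I)"
    by (intro pm.rd_chain Rn_subspace s hi_subspace[OF I]) auto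
  also have "pm.rd (Rn r n) (Rn r n \<inter> J + I) = pm.rd (Rn r n) J"
  proof (rule pm.rd_cong)
    fix v assume "v \<in> Rn r n"
    then show "v \<in> Rn r n \<inter> J + I \<longleftrightarrow> v \<in> J"
      using pm.plus_subset[OF hi_subspace[OF J], of "Rn r n \<inter> J" I] IJ
        pm.subset_plus_left[OF hi_subspace[OF I], of "Rn r n \<inter> J"] by blast
  qed (intro Rn_subspace hi_subspace[OF J] pm.subspace_plus s hi_subspace[OF I])+
  finally have "enat (hf r J n) = pm.rd (Rn r n \<inter> J) I + enat (hf r J n)"
    using hf_enat[OF I, of n] hf_enat[OF J, of n] eq by simp
  then have "pm.rd (Rn r n \<inter> J) I = 0" by (cases "pm.rd (Rn r n \<inter> J) I") (auto simp: zero_enat_def)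
  then have "Rn r n \<inter> J \<subseteq> I" using pm.rd_zero_iff[OF s hi_subspace[OF I]] by blast
  then show "J \<inter> homog n \<subseteq> I" using hi_Rg[OF J] by blast
qed

lemma hf_exact:
  assumes I: "homogeneous_ideal r I" and x: "x \<in> Rn r e" "x \<noteq> 0"
  shows "hf r I (n + e) = hf r (colon r I x) n + hf r (adj r I x) (n + e)"
proof -
  have "Hc r I (int (n + e)) = Hc r (colon r I x) (int n) + Hc r (adj r I x) (int (n + e))"
    using Hc_exact[OF I x, of "int (n + e)"] by simp
  then have "enat (hf r I (n + e)) = enat (hf r (colon r I x) n) + enat (hf r (adj r I x) (n + e))"
    unfolding Hc_eq[OF I] Hc_eq[OF colon_hi[OF I x(1)]] Hc_eq[OF adj_hi[OF I x(1)]]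
      hf_enat[OF I] hf_enat[OF colon_hi[OF I x(1)]] hf_enat[OF adj_hi[OF I x(1)]] .
  then show ?thesis by simp
qed

lemma hf_0:
  assumes I: "homogeneous_ideal r I" and 1: "1 \<notin> I"
  shows "hf r I 0 = 1"
proof -
  have ns: "smul c 1 \<notin> I" if "c \<noteq> 0" for c
  proof
    assume "smul c 1 \<in> I"
    then have "smul (1 / c) (smul c 1) \<in> I" using hi_subspace[OF I] pm.subspace_scale by blast
    then show False using 1 that by (simp add: pm.scale_scale)
  qed
  have "f \<in> pm.span {1}" if "f \<in> Rn r 0" for f
  proof -
    have "f = smul (Poly_Mapping.lookup f 0) 1"
    proof (rule poly_mapping_eqI)
      fix m
      have "Poly_Mapping.lookup f m = 0" if "m \<noteq> 0"
      proof (rule ccontr)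
        assume "Poly_Mapping.lookup f m \<noteq> 0"
        then have "mon_deg m = 0" using \<open>f \<in> Rn r 0\<close> by (auto simp: homog_def in_keys_iff)
        then have "Poly_Mapping.lookup m i = 0" for i by (auto simp: mon_deg_def in_keys_iff)
        then show False using that by (metis poly_mapping_eqI lookup_zero)
      qed
      then show "Poly_Mapping.lookup f m = Poly_Mapping.lookup (smul (Poly_Mapping.lookup f 0) 1) m"
        by (auto simp: lookup_smul lookup_one when_def)
    qed
    then show ?thesis by (metis pm.span_base pm.span_scale singletonI)
  qed
  then have "pm.qbasis {1} (Rn r 0) I"
    unfolding pm.qbasis_def using ns pm.subset_plus_left[OF hi_subspace[OF I], of "pm.span {1}"]
    by (auto simp: homog_one)
  then have "pm.rd (Rn r 0) I = enat 1" using pm.rd_qbasis[OF hi_subspace[OF I]] by fastforce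
  then show ?thesis using hf_enat[OF I, of 0] by simp
qed

abbreviation HP :: "nat \<Rightarrow> cpoly set \<Rightarrow> real poly" where "HP \<equiv> hilbert_polynomial"

lemmas HP_eventually = hilbert_polynomial_props(1)

lemma HP_exact:
  assumes I: "homogeneous_ideal r I" and x: "x \<in> Rn r e" "x \<noteq> 0"
  shows "HP r I = pcompose (HP r (colon r I x)) [:- real e, 1:] + HP r (adj r I x)"
proof (rule hilbert_polynomial_eqI[OF I])
  have "\<forall>\<^sub>F t in sequentially. e \<le> t" by (rule eventually_ge_at_top)
  moreover obtain N where N: "\<And>t. N \<le> t \<Longrightarrow> poly (HP r (colon r I x)) (real t) = real (hf r (colon r I x) t)"
    using HP_eventually[OF colon_hi[OF I x(1)]] unfolding eventually_sequentially by blast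
  have "\<forall>\<^sub>F t in sequentially. N + e \<le> t" by (rule eventually_ge_at_top)
  ultimately show "\<forall>\<^sub>F t in sequentially. poly (pcompose (HP r (colon r I x)) [:- real e, 1:] + HP r (adj r I x)) (real t) = real (hf r I t)"
    using HP_eventually[OF adj_hi[OF I x(1)]]
  proof eventually_elim
    case (elim t)
    then show ?case using N[of "t - e"] hf_exact[OF I x, of "t - e"]
      by (simp add: poly_pcompose of_nat_diff)
  qed
qed

lemma HP_mono:
  assumes I: "homogeneous_ideal r I" and J: "homogeneous_ideal r J" and IJ: "I \<subseteq> J"
  shows "\<forall>\<^sub>F t in sequentially. poly (HP r J) (real t) \<le> poly (HP r I) (real t)"
  using HP_eventually[OF I] HP_eventually[OF J]
proof eventually_elim
  case (elim t)
  then show ?case using hf_mono[OF I J, of t] IJ by auto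
qed

lemma HP_nonneg: "homogeneous_ideal r I \<Longrightarrow> \<forall>\<^sub>F t in sequentially. 0 \<le> poly (HP r I) (real t)"
  by (drule HP_eventually, erule eventually_mono) simp

lemma HP_zero_iff:
  assumes I: "homogeneous_ideal r I"
  shows "HP r I = 0 \<longleftrightarrow> (\<forall>\<^sub>F t in sequentially. Rn r t \<subseteq> I)"
proof
  assume "HP r I = 0"
  with HP_eventually[OF I] have "\<forall>\<^sub>F t in sequentially. hf r I t = 0" by simp
  then show "\<forall>\<^sub>F t in sequentially. Rn r t \<subseteq> I" by (simp add: hf_zero_iff[OF I])
next
  assume "\<forall>\<^sub>F t in sequentially. Rn r t \<subseteq> I"
  then show "HP r I = 0"
    by (intro hilbert_polynomial_eqI[OF I]) (simp add: hf_zero_iff[OF I])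
qed

lemma poly_eventually_pos:
  fixes p :: "real poly"
  assumes "0 < lead_coeff p"
  shows "\<forall>\<^sub>F t in sequentially. 0 < poly p (real t)"
proof -
  obtain n where n: "\<And>x. n \<le> x \<Longrightarrow> lead_coeff p \<le> poly p x" using poly_pinfty_gt_lc[OF assms] by blast
  have "\<forall>\<^sub>F t in sequentially. nat \<lceil>n\<rceil> \<le> t" by (rule eventually_ge_at_top)
  then show ?thesis
  proof eventually_elim
    case (elim t)
    then have "n \<le> real t" by linarith
    then show ?case using n assms by fastforce
  qed
qed

lemma lead_coeff_pos:
  fixes p :: "real poly"
  assumes "p \<noteq> 0" "\<forall>\<^sub>F t in sequentially. 0 \<le> poly p (real t)"
  shows "0 < lead_coeff p"
proof (rule ccontr)
  assume "\<not> 0 < lead_coeff p"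
  then have "0 < lead_coeff (- p)" using assms(1) by (simp add: lead_coeff_minus less_le)
  from poly_eventually_pos[OF this] assms(2) have "\<forall>\<^sub>F t in sequentially. False"
    by eventually_elim simp
  then show False by simp
qed

lemma degree_mono_eventually:
  fixes p q :: "real poly"
  assumes "\<forall>\<^sub>F t in sequentially. 0 \<le> poly p (real t)" "\<forall>\<^sub>F t in sequentially. poly p (real t) \<le> poly q (real t)"
  shows "degree p \<le> degree q" and "q = 0 \<Longrightarrow> p = 0"
proof -
  show "degree p \<le> degree q"
  proof (rule ccontr)
    assume "\<not> degree p \<le> degree q"
    then have d: "degree q < degree p" by simp
    then have "p \<noteq> 0" by auto
    have "degree (p - q) = degree p" using d by (metis degree_add_eq_left degree_minus diff_conv_add_uminus)
    then have "lead_coeff (p - q) = lead_coeff p" using d by (simp add: coeff_eq_0)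
    then have "0 < lead_coeff (p - q)" using lead_coeff_pos[OF \<open>p \<noteq> 0\<close> assms(1)] by simp
    from poly_eventually_pos[OF this] assms(2) have "\<forall>\<^sub>F t in sequentially. False"
      by eventually_elim simp
    then show False by simp
  qed
  assume "q = 0"
  have "\<forall>\<^sub>F t in sequentially. poly p (real t) = poly 0 (real t)"
    using assms by eventually_elim (simp add: \<open>q = 0\<close>)
  then show "p = 0" by (rule poly_eq_eventually)
qed

lemma degree_difference_less:
  fixes p :: "real poly"
  assumes "0 < degree p"
  shows "degree (p - pcompose p [:- c, 1:]) < degree p"
proof -
  let ?q = "pcompose p [:- c, 1:]"
  have d: "degree ?q = degree p" by (simp add: degree_pcompose)
  have "lead_coeff ?q = lead_coeff p" by (subst lead_coeff_comp) auto
  then have "coeff (p - ?q) (degree p) = 0" using d by simp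
  moreover have "degree (p - ?q) \<le> degree p" using degree_diff_le[of p "degree p" ?q] d by simp
  ultimately show ?thesis using assms
    by (metis degree_0 leading_coeff_0_iff le_neq_implies_less)
qed

text \<open>Only the two highest powers contribute in degree \<open>n\<close>, and the contributions
  of the coefficient of \<open>t ^ n\<close> cancel.\<close>

lemma coeff_difference:
  fixes p :: "real poly"
  assumes "degree p = Suc n"
  shows "coeff (p - pcompose p [:- 1, 1:]) n = real (Suc n) * lead_coeff p"
proof -
  have "pcompose p [:- 1, 1:] = (\<Sum>i\<le>Suc n. smult (coeff p i) ([:- 1, 1:] ^ i))"
    by (intro iffD1[OF poly_eq_poly_eq_iff] ext)
      (simp add: poly_pcompose poly_sum poly_altdef[of p] assms del: sum.atMost_Suc)
  moreover have "coeff ([:- 1, 1:] ^ i) n = real (i choose n) * (- 1) ^ (i - n)" for i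
  proof (cases "n \<le> i")
    case False
    then show ?thesis by (simp add: coeff_eq_0 degree_linear_power binomial_eq_0)
  qed (simp add: coeff_linear_poly_power)
  ultimately have "coeff (pcompose p [:- 1, 1:]) n = (\<Sum>i\<le>Suc n. coeff p i * (real (i choose n) * (- 1) ^ (i - n)))"
    by (simp add: coeff_sum del: sum.atMost_Suc)
  also have "\<dots> = (\<Sum>i<n. coeff p i * (real (i choose n) * (- 1) ^ (i - n))) + coeff p n - real (Suc n) * coeff p (Suc n)"
    by (simp add: lessThan_Suc_atMost[symmetric] algebra_simps)
  also have "(\<Sum>i<n. coeff p i * (real (i choose n) * (- 1) ^ (i - n))) = 0"
    by (intro sum.neutral) (auto simp: binomial_eq_0)
  finally show ?thesis using assms by simp
qed

section \<open>Dimension\<close>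

lemma integral_subschemeD:
  assumes "integral_subscheme r P"
  shows "homogeneous_ideal r P" "saturation r P = P" "1 \<notin> P" "P \<noteq> Rg r"
    "\<And>a b. a \<in> Rg r \<Longrightarrow> b \<in> Rg r \<Longrightarrow> a * b \<in> P \<Longrightarrow> a \<in> P \<or> b \<in> P" "HP r P \<noteq> 0"
proof -
  show P: "homogeneous_ideal r P" and s: "saturation r P = P"
    using assms by (auto simp: integral_subscheme_def closed_subscheme_def)
  show ne: "P \<noteq> Rg r" and "\<And>a b. a \<in> Rg r \<Longrightarrow> b \<in> Rg r \<Longrightarrow> a * b \<in> P \<Longrightarrow> a \<in> P \<or> b \<in> P"
    using assms primeideal_coord_ring_iff[OF P] unfolding integral_subscheme_def by blast+
  show 1: "1 \<notin> P" using ne hi_mult[OF P, of 1] hi_Rg[OF P] by auto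
  show "HP r P \<noteq> 0"
  proof
    assume "HP r P = 0"
    then obtain N where N: "Rn r N \<subseteq> P"
      unfolding HP_zero_iff[OF P] eventually_sequentially by blast
    have "\<forall>i\<le>r. var i ^ N * 1 \<in> P"
      using N Rg_power[OF Rg_var, of _ r N] homog_power[OF homog_var, of _ N] by auto
    then have "1 \<in> saturation r P" by (auto simp: saturation_def)
    then show False using s 1 by simp
  qed
qed

lemma prime_colon:
  assumes P: "integral_subscheme r P" and f: "f \<in> Rg r" "f \<notin> P"
  shows "colon r P f = P"
  using integral_subschemeD(5)[OF P f(1)] f colon_mono[OF integral_subschemeD(1)[OF P] f(1)]
  by (auto simp: colon_def)

text \<open>A homogeneous \<open>f\<close> in \<open>Q - P\<close> is a nonzerodivisor modulo
  \<open>P\<close>, so the Hilbert polynomial of \<open>P + (f)\<close> is a difference of that of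
  \<open>P\<close>, and \<open>Q\<close> contains \<open>P + (f)\<close>.\<close>

lemma degree_HP_strict:
  assumes P: "integral_subscheme r P" and Q: "integral_subscheme r Q" and PQ: "P \<subset> Q"
  shows "degree (HP r Q) < degree (HP r P)"
proof -
  note hP = integral_subschemeD(1)[OF P] and hQ = integral_subschemeD(1)[OF Q]
  obtain t where "\<not> Q \<inter> homog t \<subseteq> P" using hi_subsetI[OF hQ hP] PQ by blast
  then obtain f where f: "f \<in> Q" "f \<in> homog t" "f \<notin> P" by blast
  have fR: "f \<in> Rn r t" using f hi_Rg[OF hQ] by blast
  have f0: "f \<noteq> 0" using f hi_zero[OF hP] by auto
  have e: "HP r (adj r P f) = HP r P - pcompose (HP r P) [:- real t, 1:]"
    using HP_exact[OF hP fR f0] prime_colon[OF P _ f(3)] fR by simp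
  have sub: "adj r P f \<subseteq> Q" using adj_least[OF hQ] PQ f by blast
  note le = HP_mono[OF adj_hi[OF hP fR] hQ sub]
  have "HP r (adj r P f) \<noteq> 0"
    using degree_mono_eventually(2)[OF HP_nonneg[OF hQ] le] integral_subschemeD(6)[OF Q] by blast
  \<comment> \<open>A constant Hilbert polynomial of \<open>P\<close> would make that of
    \<open>P + (f)\<close> zero, and then that of \<open>Q\<close> as well.\<close>
  then have "0 < degree (HP r P)"
    using e by (metis degree_eq_zeroE gr0I pcompose_const diff_self)
  then show ?thesis
    using degree_difference_less[of "HP r P" "real t"] degree_mono_eventually(1)[OF HP_nonneg[OF hQ] le] e by simp
qed

lemma chain_le_degree:
  assumes I: "homogeneous_ideal r I"
    and P: "\<And>i. i \<le> n \<Longrightarrow> integral_subscheme r (P i) \<and> I \<subseteq> P i" "\<And>i. i < n \<Longrightarrow> P i \<subset> P (Suc i)"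
  shows "HP r I \<noteq> 0 \<and> n \<le> degree (HP r I)"
proof -
  have "i + degree (HP r (P i)) \<le> degree (HP r (P 0))" if "i \<le> n" for i
    using that
  proof (induction i)
    case (Suc i)
    then have "degree (HP r (P (Suc i))) < degree (HP r (P i))"
      using P by (intro degree_HP_strict) auto
    then show ?case using Suc by simp
  qed simp
  from this[of n] have n: "n \<le> degree (HP r (P 0))" by simp
  have P0: "integral_subscheme r (P 0)" "I \<subseteq> P 0" using P by auto
  note h0 = integral_subschemeD(1)[OF P0(1)]
  note le = HP_mono[OF I h0 P0(2)]
  show ?thesis
    using degree_mono_eventually[OF HP_nonneg[OF h0] le] n integral_subschemeD(6)[OF P0(1)] by auto
qed

text \<open>If \<open>a * b \<in> I\<close> splits, the Hilbert polynomial is the sum of a shift of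
  that of \<open>I : a\<close> and that of \<open>I + (a)\<close>, so one of these larger ideals
  keeps its degree; induction ends at a prime.\<close>

lemma exists_integral_over:
  assumes "homogeneous_ideal r I" "HP r I \<noteq> 0"
  shows "\<exists>P. integral_subscheme r P \<and> I \<subseteq> P \<and> degree (HP r P) = degree (HP r I)"
  using assms
proof (induction I rule: hi_induct)
  case (step I)
  note I = step(1)
  show ?case
  proof (rule prime_or_split[OF I])
    assume pr: "primeideal I (coord_ring r)"
    \<comment> \<open>A prime ideal omitting a variable is saturated; it omits one because its
      Hilbert polynomial is nonzero.\<close>
    have "\<exists>i\<le>r. var i \<notin> I"
    proof (rule ccontr)
      assume v: "\<not> (\<exists>i\<le>r. var i \<notin> I)"
      have "Rn r (Suc n) \<subseteq> I" for n
      proof -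
        have "(\<Sum>i\<le>r. var i *o Rn r n) \<subseteq> I"
          using v by (intro pm.set_sum_subset hi_subspace[OF I]) (auto simp: elt_set_times_def intro!: hi_mult'[OF I])
        then show ?thesis using Rn_Suc_subset by blast
      qed
      then have "\<forall>\<^sub>F t in sequentially. Rn r t \<subseteq> I"
        unfolding eventually_sequentially by (metis Suc_le_D)
      then show False using step(3) HP_zero_iff[OF I] by blast
    qed
    then obtain i where i: "i \<le> r" "var i \<notin> I" by blast
    have prime: "a \<in> I \<or> b \<in> I" if "a \<in> Rg r" "b \<in> Rg r" "a * b \<in> I" for a b
      using pr primeideal_coord_ring_iff[OF I] that by blast
    have "f \<in> I" if f: "f \<in> Rg r" "var i ^ k * f \<in> I" for f k
      using f(2)
    proof (induction k)
      case (Suc k)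
      have "var i * (var i ^ k * f) \<in> I" using Suc.prems by (simp add: mult.assoc)
      then show ?case using prime[of "var i" "var i ^ k * f"] i f Suc.IH by (auto intro: Rg_mult Rg_power Rg_var)
    qed simp
    then have "saturation r I = I" using saturation_mono[OF I] i unfolding saturation_def by auto
    then show ?thesis using pr I unfolding integral_subscheme_def closed_subscheme_def by blast
  next
    assume "I = Rg r"
    then show ?thesis using step(3) HP_zero_iff[OF I] by auto
  next
    fix a b s t assume ab: "a \<in> Rn r s" "b \<in> Rn r t" "a \<notin> I" "b \<notin> I" "a * b \<in> I"
    have a0: "a \<noteq> 0" using ab hi_zero[OF I] by auto
    let ?C = "colon r I a" and ?A = "adj r I a"
    have C: "homogeneous_ideal r ?C" and A: "homogeneous_ideal r ?A" using colon_hi adj_hi I ab by blast+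
    have "b \<in> ?C" using ab by (auto simp: colon_def)
    then have IC: "I \<subset> ?C" using colon_mono[OF I, of a] ab by blast
    have IA: "I \<subset> ?A" using adj_mono[of I r a] adj_self[OF I, of a] ab by blast
    have dC: "degree (HP r ?C) \<le> degree (HP r I)" and dA: "degree (HP r ?A) \<le> degree (HP r I)"
      using degree_mono_eventually(1)[OF HP_nonneg HP_mono] C A I IC IA by (simp_all add: psubset_imp_subset)
    have e: "HP r I = pcompose (HP r ?C) [:- real s, 1:] + HP r ?A" by (rule HP_exact[OF I ab(1) a0])
    have "(HP r ?C \<noteq> 0 \<and> degree (HP r ?C) = degree (HP r I)) \<or> (HP r ?A \<noteq> 0 \<and> degree (HP r ?A) = degree (HP r I))"
    proof (rule ccontr)
      assume no: "\<not> ?thesis"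
      have dp: "degree (pcompose (HP r ?C) [:- real s, 1:]) = degree (HP r ?C)" by (simp add: degree_pcompose)
      show False
      proof (cases "HP r ?C = 0 \<or> HP r ?A = 0")
        case True
        then show ?thesis using no e step(3) dp by auto
      next
        case False
        then have "degree (HP r ?C) < degree (HP r I)" "degree (HP r ?A) < degree (HP r I)" using no dC dA by auto
        then have "degree (pcompose (HP r ?C) [:- real s, 1:] + HP r ?A) < degree (HP r I)"
          using dp by (intro degree_add_less) auto
        then show ?thesis using e by simp
      qed
    qed
    then show ?thesis using step(2)[OF C IC] step(2)[OF A IA] IC IA by (metis psubset_imp_subset subset_trans)
  qed
qed

text \<open>Cut a prime \<open>Q\<close> of full dimension by a variable outside it: the coefficient
  of \<open>t ^ n\<close> in the difference is \<open>n + 1\<close> times the leading one, so the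
  degree drops by exactly one and the induction continues above \<open>Q\<close>.\<close>

lemma exists_chain:
  assumes "homogeneous_ideal r I" "HP r I \<noteq> 0" "degree (HP r I) = n"
  shows "\<exists>P. (\<forall>i\<le>n. integral_subscheme r (P i) \<and> I \<subseteq> P i) \<and> (\<forall>i<n. P i \<subset> P (Suc i))"
  using assms
proof (induction n arbitrary: I)
  case 0
  then obtain Q where "integral_subscheme r Q" "I \<subseteq> Q" using exists_integral_over by blast
  then show ?case by (intro exI[of _ "\<lambda>_. Q"]) auto
next
  case (Suc n)
  obtain Q where Q: "integral_subscheme r Q" "I \<subseteq> Q" "degree (HP r Q) = Suc n"
    using exists_integral_over[OF Suc.prems(1,2)] Suc.prems(3) by auto
  note hQ = integral_subschemeD(1)[OF Q(1)]
  have "\<exists>i\<le>r. var i \<notin> Q"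
  proof (rule ccontr)
    assume "\<not> (\<exists>i\<le>r. var i \<notin> Q)"
    then have "1 \<in> saturation r Q" by (auto simp: saturation_def intro!: exI[of _ 1])
    then show False using integral_subschemeD(2,3)[OF Q(1)] by simp
  qed
  then obtain i where i: "i \<le> r" "var i \<notin> Q" by blast
  let ?J = "adj r Q (var i)"
  have J: "homogeneous_ideal r ?J" using adj_hi[OF hQ Rn_var[OF i(1)]] .
  have e: "HP r ?J = HP r Q - pcompose (HP r Q) [:- 1, 1:]"
    using HP_exact[OF hQ Rn_var[OF i(1)] var_nonzero] prime_colon[OF Q(1) Rg_var[OF i(1)] i(2)] by simp
  have c: "coeff (HP r ?J) n = real (Suc n) * lead_coeff (HP r Q)"
    unfolding e by (rule coeff_difference[OF Q(3)])
  have "lead_coeff (HP r Q) \<noteq> 0" using integral_subschemeD(6)[OF Q(1)] by simp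
  then have cn: "coeff (HP r ?J) n \<noteq> 0" using c by simp
  then have "n \<le> degree (HP r ?J)" "HP r ?J \<noteq> 0" by (auto intro: le_degree)
  moreover have "degree (HP r ?J) < Suc n"
    using degree_difference_less[of "HP r Q" 1] Q(3) unfolding e by simp
  ultimately obtain P where P: "\<And>i. i \<le> n \<Longrightarrow> integral_subscheme r (P i) \<and> ?J \<subseteq> P i" "\<And>i. i < n \<Longrightarrow> P i \<subset> P (Suc i)"
    using Suc.IH[OF J] by (metis le_antisym less_Suc_eq_le)
  have Q0: "Q \<subset> P 0" using P(1)[of 0] adj_mono[of Q r "var i"] adj_self[OF hQ, of "var i"] i by blast
  show ?case
  proof (intro exI[of _ "case_nat Q P"] conjI allI impI)
    fix k assume "k \<le> Suc n"
    then show "integral_subscheme r (case_nat Q P k)" "I \<subseteq> case_nat Q P k"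
      using Q P(1) adj_mono[of Q r "var i"] by (auto split: nat.split)
  next
    fix k assume "k < Suc n"
    then show "case_nat Q P k \<subset> case_nat Q P (Suc k)" using Q0 P(2) by (auto split: nat.split)
  qed
qed

theorem subscheme_dim_eq:
  assumes I: "homogeneous_ideal r I"
  shows "subscheme_dim r I = (if HP r I = 0 then 0 else enat (degree (HP r I)))"
proof -
  let ?A = "{enat n | n. \<exists>P :: nat \<Rightarrow> cpoly set.
            (\<forall>i\<le>n. integral_subscheme r (P i) \<and> I \<subseteq> P i) \<and> (\<forall>i<n. P i \<subset> P (Suc i))}"
  have le: "HP r I \<noteq> 0 \<and> x \<le> enat (degree (HP r I))" if "x \<in> ?A" for x
  proof -
    obtain n P where n: "x = enat n" "\<forall>i\<le>n. integral_subscheme r (P i) \<and> I \<subseteq> P i" "\<forall>i<n. P i \<subset> P (Suc i)"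
      using \<open>x \<in> ?A\<close> by blast
    then show ?thesis using chain_le_degree[OF I, of n P] by auto
  qed
  show ?thesis
  proof (cases "HP r I = 0")
    case True
    then have "?A = {}" using le by blast
    then show ?thesis unfolding subscheme_dim_def using True by (simp only: Sup_empty bot_enat_def if_True refl)
  next
    case False
    then have "enat (degree (HP r I)) \<in> ?A" using exists_chain[OF I False refl] by blast
    then have "Sup ?A = enat (degree (HP r I))" using le by (intro antisym Sup_least Sup_upper) auto
    then show ?thesis unfolding subscheme_dim_def using False by simp
  qed
qed

section \<open>Saturation and general linear forms\<close>

lemma var_power_up:
  assumes "homogeneous_ideal r I" "var i ^ k * f \<in> I" "k \<le> k'" "i \<le> r"
  shows "var i ^ k' * f \<in> I"
proof -
  have "var i ^ k' * f = var i ^ (k' - k) * (var i ^ k * f)"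
    using assms(3) by (simp add: mult.assoc[symmetric] power_add[symmetric])
  then show ?thesis using hi_mult[OF assms(1,2)] Rg_power[OF Rg_var[OF assms(4)]] by metis
qed

lemma saturationI:
  assumes I: "homogeneous_ideal r I" and f: "f \<in> Rg r" and k: "\<And>i. i \<le> r \<Longrightarrow> \<exists>k. var i ^ k * f \<in> I"
  shows "f \<in> saturation r I"
proof -
  obtain k where k: "\<And>i. i \<le> r \<Longrightarrow> var i ^ k i * f \<in> I" using assms(3) by metis
  define m where "m = Max (k ` {..r})"
  have "k i \<le> m" if "i \<le> r" for i unfolding m_def using that by (intro Max_ge) auto
  then have "\<forall>i\<le>r. var i ^ m * f \<in> I" using var_power_up[OF I k] by blast
  then show ?thesis using f unfolding saturation_def by blast
qed

lemma saturation_idem: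
  assumes I: "homogeneous_ideal r I"
  shows "saturation r (saturation r I) = saturation r I"
proof
  show "saturation r (saturation r I) \<subseteq> saturation r I"
  proof
    fix f assume "f \<in> saturation r (saturation r I)"
    then obtain k where f: "f \<in> Rg r" and k: "\<And>i. i \<le> r \<Longrightarrow> var i ^ k * f \<in> saturation r I"
      unfolding saturation_def by blast
    have "\<exists>k. var i ^ k * f \<in> I" if i: "i \<le> r" for i
    proof -
      obtain l where "var i ^ l * (var i ^ k * f) \<in> I" using k[OF i] i unfolding saturation_def by blast
      then have "var i ^ (l + k) * f \<in> I" by (simp add: power_add mult.assoc)
      then show ?thesis ..
    qed
    then show "f \<in> saturation r I" by (rule saturationI[OF I f])
  qed
qed (rule saturation_mono[OF saturation_hi[OF I]])

text \<open>Pigeonhole: a monomial of degree at least \<open>(r + 1) k\<close> in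
  \<open>r + 1\<close> variables has an exponent at least \<open>k\<close>.\<close>

lemma high_degree_mult:
  assumes I: "homogeneous_ideal r I" and f: "\<And>i. i \<le> r \<Longrightarrow> var i ^ k * f \<in> I"
    and g: "g \<in> Rn r n" "Suc r * k \<le> n"
  shows "g * f \<in> I"
proof -
  have "Poly_Mapping.single m c * f \<in> I" if m: "m \<in> monomials r n" for m c
  proof -
    have "\<exists>i\<le>r. k \<le> Poly_Mapping.lookup m i"
    proof (rule ccontr)
      assume "\<not> ?thesis"
      then have lt: "Poly_Mapping.lookup m i < k" if "i \<le> r" for i using that by (metis not_le)
      have "n = (\<Sum>i\<le>r. Poly_Mapping.lookup m i)"
        using m mon_deg_eq[of "{..r}" m] by (simp add: monomials_def)
      also have "\<dots> < (\<Sum>i\<le>r. k)" using lt by (intro sum_strict_mono) auto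
      finally show False using g(2) by simp
    qed
    then obtain i where i: "i \<le> r" "k \<le> Poly_Mapping.lookup m i" by blast
    define m' where "m' = m - Poly_Mapping.single i k"
    have m': "m = Poly_Mapping.single i k + m'"
      using i by (intro poly_mapping_eqI) (auto simp: m'_def lookup_add lookup_minus lookup_single when_def)
    have "var i ^ k = Poly_Mapping.single (Poly_Mapping.single i k) 1" for k
      by (induction k) (simp_all add: var_def mult_single single_add[symmetric])
    then have "Poly_Mapping.single m c * f = Poly_Mapping.single m' c * (var i ^ k * f)"
      by (subst m') (simp add: mult.assoc[symmetric] mult_single add.commute)
    moreover have "Poly_Mapping.single m' c \<in> Rg r"
      using m by (auto simp: Rg_iff monomials_def m'_def in_keys_iff lookup_minus subset_eq)
    ultimately show ?thesis using hi_mult[OF I f[OF i(1)], of "Poly_Mapping.single m' c"] by metis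
  qed
  moreover have "g * f = (\<Sum>m\<in>Poly_Mapping.keys g. Poly_Mapping.single m (Poly_Mapping.lookup g m) * f)"
    by (subst (1) poly_mapping_sum_singles) (simp add: sum_distrib_right)
  ultimately show ?thesis using g(1) Rn_monomials[of g r n] by (simp only:) (intro hi_sum[OF I], blast)
qed

text \<open>Start with \<open>J = I\<close> and enlarge \<open>J\<close> inside the saturation by
  one homogeneous \<open>f\<close> at a time: multiples of \<open>f\<close> of high degree lie in
  \<open>I\<close>, so agreement in high degrees persists, and the chain stops at the
  saturation.\<close>

lemma saturation_high_degree:
  assumes I: "homogeneous_ideal r I"
  shows "\<exists>n0. \<forall>n\<ge>n0. saturation r I \<inter> homog n \<subseteq> I"
proof -
  have S: "homogeneous_ideal r (saturation r I)" by (rule saturation_hi[OF I])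
  have "(\<exists>n0. \<forall>n\<ge>n0. J \<inter> homog n \<subseteq> I) \<Longrightarrow> I \<subseteq> J \<Longrightarrow> J \<subseteq> saturation r I \<Longrightarrow> ?thesis"
    if "homogeneous_ideal r J" for J
    using that
  proof (induction J rule: hi_induct)
    case (step J)
    show ?case
    proof (cases "J = saturation r I")
      case True
      then show ?thesis using step(3) by simp
    next
      case False
      then obtain e where "\<not> saturation r I \<inter> homog e \<subseteq> J" using hi_subsetI[OF S step(1)] step(5) by blast
      then obtain f where f: "f \<in> saturation r I" "f \<in> homog e" "f \<notin> J" by blast
      have fR: "f \<in> Rn r e" using f hi_Rg[OF S] by blast
      obtain k where k: "\<And>i. i \<le> r \<Longrightarrow> var i ^ k * f \<in> I" using f(1) unfolding saturation_def by blast
      obtain n0 where n0: "\<And>n. n0 \<le> n \<Longrightarrow> J \<inter> homog n \<subseteq> I" using step(3) by blast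
      have "adj r J f \<inter> homog n \<subseteq> I" if n: "max n0 (e + Suc r * k) \<le> n" for n
      proof
        fix h assume h: "h \<in> adj r J f \<inter> homog n"
        have en: "e \<le> n" using n by simp
        obtain j g where jg: "j \<in> J \<inter> homog n" "h = j + f * g" "g \<in> Rn r (n - e)"
          using adj_homog_elim[OF step(1) fR, of h n] h en by (metis IntD1 IntD2)
        have "g * f \<in> I" using n by (intro high_degree_mult[OF I k jg(3)]) auto
        then show "h \<in> I" using jg n0[of n] n hi_add[OF I] by (auto simp: mult.commute)
      qed
      then have "\<exists>n0. \<forall>n\<ge>n0. adj r J f \<inter> homog n \<subseteq> I" by blast
      moreover have "J \<subset> adj r J f" using adj_mono[of J r f] adj_self[OF step(1), of f] f by blast
      ultimately show ?thesis
        using step(2)[OF adj_hi[OF step(1) fR]] step(4,5) adj_least[OF S step(5) f(1)] by blast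
    qed
  qed
  from this[OF I] show ?thesis using saturation_mono[OF I] by blast
qed

text \<open>Coefficients on the moment curve: whether such a form lies in a subspace is governed by
  polynomials in the single parameter \<open>t\<close>, so each bad condition excludes finitely many
  \<open>t\<close>.\<close>

definition lform :: "nat \<Rightarrow> complex \<Rightarrow> cpoly" where
  "lform r t = (\<Sum>i\<le>r. smul (t ^ i) (var i))"

lemma lform_Rn: "lform r t \<in> Rn r 1"
  unfolding lform_def using Rn_var pm.subspace_scale[OF Rn_subspace] by (intro pm.subspace_sum[OF Rn_subspace]) blast

lemma lookup_var: "Poly_Mapping.lookup (var i) (Poly_Mapping.single j 1) = (if i = j then 1 else 0)"
proof -
  have "Poly_Mapping.single i (1::nat) = Poly_Mapping.single j 1 \<longleftrightarrow> i = j"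
    by (metis lookup_single_eq lookup_single_not_eq zero_neq_one)
  then show ?thesis by (auto simp: var_def lookup_single when_def)
qed

lemma lform_nonzero: "lform r t \<noteq> 0"
proof
  assume "lform r t = 0"
  then have "Poly_Mapping.lookup (lform r t) (Poly_Mapping.single 0 1) = 0" by simp
  then show False by (simp add: lform_def lookup_sum lookup_smul lookup_var[unfolded One_nat_def] if_distrib cong: if_cong)
qed

text \<open>A coordinate of the class of \<open>lform r t\<close> modulo \<open>P\<close> is a
  polynomial in \<open>t\<close>; one that is nonzero on \<open>var i\<close> gives a nonzero
  polynomial.\<close>

lemma finite_lform_in_prime:
  assumes P: "homogeneous_ideal r P" and i: "i \<le> r" "var i \<notin> P"
  shows "finite {t. lform r t \<in> P}"
proof -
  obtain p :: "cpoly \<Rightarrow> cpoly" where p: "Vector_Spaces.linear smul smul p" "\<And>v. p v = 0 \<longleftrightarrow> v \<in> P"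
    by (rule pm.exists_projection[OF hi_subspace[OF P]]) (rule that)
  interpret p: Vector_Spaces.linear smul smul p by (rule p(1))
  have "p (var i) \<noteq> 0" using p(2)[of "var i"] i by simp
  then obtain m where m: "Poly_Mapping.lookup (p (var i)) m \<noteq> 0" by (metis poly_mapping_eqI lookup_zero)
  define q where "q = (\<Sum>j\<le>r. monom (Poly_Mapping.lookup (p (var j)) m) j)"
  have "coeff q i \<noteq> 0" using m i by (simp add: q_def coeff_sum)
  then have "q \<noteq> 0" by auto
  have "poly q t = Poly_Mapping.lookup (p (lform r t)) m" for t
    by (simp add: q_def lform_def p.sum p.scale poly_sum poly_monom lookup_sum lookup_smul mult.commute)
  moreover have "p (lform r t) = 0" if "lform r t \<in> P" for t using p(2)[of "lform r t"] that by simp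
  ultimately have "{t. lform r t \<in> P} \<subseteq> {t. poly q t = 0}" by auto
  then show ?thesis using poly_roots_finite[OF \<open>q \<noteq> 0\<close>] finite_subset by blast
qed

text \<open>This takes the place of avoiding associated primes. A form \<open>l\<close> that is good
  for \<open>I : a\<close> and \<open>I + (a)\<close> is good for \<open>I\<close>: from
  \<open>l f \<in> I\<close> one gets \<open>x_i^k f = j + a g\<close> with
  \<open>j \<in> I\<close>, then \<open>l g \<in> I : a\<close>, so powers of the variables push
  \<open>g\<close> into \<open>I : a\<close> and hence \<open>f\<close> into
  \<open>I\<close>.\<close>

lemma finite_bad_lforms:
  assumes "homogeneous_ideal r I"
  shows "finite {t. \<exists>f\<in>Rg r. lform r t * f \<in> I \<and> f \<notin> saturation r I}"
  using assms
proof (induction I rule: hi_induct)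
  case (step I)
  note I = step(1)
  show ?case
  proof (rule prime_or_split[OF I])
    assume pr: "primeideal I (coord_ring r)"
    show ?thesis
    proof (cases "\<exists>i\<le>r. var i \<notin> I")
      case True
      then obtain i where i: "i \<le> r" "var i \<notin> I" by blast
      have "{t. \<exists>f\<in>Rg r. lform r t * f \<in> I \<and> f \<notin> saturation r I} \<subseteq> {t. lform r t \<in> I}"
        using pr lform_Rn saturation_mono[OF I] unfolding primeideal_coord_ring_iff[OF I] by blast
      then show ?thesis using finite_lform_in_prime[OF I i] finite_subset by blast
    next
      case False
      have "f \<in> saturation r I" if "f \<in> Rg r" for f
        using False by (intro saturationI[OF I that] exI[of _ 1]) (simp add: hi_mult'[OF I _ that])
      then show ?thesis by (intro finite_subset[OF _ finite.emptyI]) blast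
    qed
  next
    assume "I = Rg r"
    then show ?thesis using saturation_mono[OF I] by (intro finite_subset[OF _ finite.emptyI]) blast
  next
    fix a b s t assume ab: "a \<in> Rn r s" "b \<in> Rn r t" "a \<notin> I" "b \<notin> I" "a * b \<in> I"
    let ?C = "colon r I a" and ?A = "adj r I a"
    have C: "homogeneous_ideal r ?C" and A: "homogeneous_ideal r ?A" using colon_hi adj_hi I ab by blast+
    have "b \<in> ?C" using ab by (auto simp: colon_def)
    then have IC: "I \<subset> ?C" using colon_mono[OF I, of a] ab by blast
    have IA: "I \<subset> ?A" using adj_mono[of I r a] adj_self[OF I, of a] ab by blast
    let ?B = "\<lambda>J. {t. \<exists>f\<in>Rg r. lform r t * f \<in> J \<and> f \<notin> saturation r J}"
    have "?B I \<subseteq> ?B ?C \<union> ?B ?A"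
    proof (rule subsetI, rule ccontr)
      fix t assume t: "t \<in> ?B I" and nb: "t \<notin> ?B ?C \<union> ?B ?A"
      let ?l = "lform r t"
      have l: "?l \<in> Rg r" using lform_Rn by blast
      obtain f where f: "f \<in> Rg r" "?l * f \<in> I" "f \<notin> saturation r I" using t by blast
      have "f \<in> saturation r ?A" using nb f IA by blast
      then obtain k where k: "\<And>i. i \<le> r \<Longrightarrow> var i ^ k * f \<in> ?A" unfolding saturation_def by blast
      have "\<exists>k. var i ^ k * f \<in> I" if i: "i \<le> r" for i
      proof -
        obtain j g where jg: "j \<in> I" "g \<in> Rg r" "var i ^ k * f = j + a * g" using adj_elim[OF k[OF i]] by metis
        have "a * g = var i ^ k * f - j" using jg(3) by simp
        then have "a * (?l * g) = ?l * (var i ^ k * f - j)" by (simp add: mult.left_commute[of a])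
        also have "\<dots> = var i ^ k * (?l * f) - ?l * j" by (simp add: algebra_simps)
        also have "\<dots> \<in> I" using hi_diff[OF I] hi_mult[OF I f(2)] hi_mult[OF I jg(1) l] Rg_power[OF Rg_var[OF i]] by blast
        finally have "?l * g \<in> ?C" using l jg Rg_mult by (auto simp: colon_def)
        then have "g \<in> saturation r ?C" using nb jg by blast
        then obtain k' where "var i ^ k' * g \<in> ?C" using i unfolding saturation_def by blast
        then have "a * (var i ^ k' * g) \<in> I" by (simp add: colon_def)
        moreover have "var i ^ k' * j \<in> I" using hi_mult[OF I jg(1)] Rg_power[OF Rg_var[OF i]] by blast
        ultimately have "var i ^ k' * j + a * (var i ^ k' * g) \<in> I" by (rule hi_add[OF I, rotated])
        moreover have "var i ^ (k' + k) * f = var i ^ k' * j + a * (var i ^ k' * g)"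
          unfolding power_add mult.assoc jg(3) by (simp add: distrib_left mult.left_commute)
        ultimately have "var i ^ (k' + k) * f \<in> I" by simp
        then show ?thesis ..
      qed
      then show False using saturationI[OF I f(1)] f(3) by blast
    qed
    then show ?thesis using step(2)[OF C IC] step(2)[OF A IA] finite_subset by blast
  qed
qed

definition regular :: "nat \<Rightarrow> cpoly set \<Rightarrow> cpoly \<Rightarrow> bool" where
  "regular r I x \<longleftrightarrow> x \<in> Rn r 1 \<and> x \<noteq> 0 \<and> (\<forall>f\<in>Rg r. x * f \<in> I \<longrightarrow> f \<in> I)"

lemma exists_regular:
  assumes I: "homogeneous_ideal r I" "saturation r I = I" and J: "homogeneous_ideal r J" "saturation r J = J"
  obtains x where "regular r I x" "regular r J x"
proof -
  let ?B = "\<lambda>I. {t. \<exists>f\<in>Rg r. lform r t * f \<in> I \<and> f \<notin> saturation r I}"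
  have "finite (?B I \<union> ?B J)" using finite_bad_lforms[OF I(1)] finite_bad_lforms[OF J(1)] by simp
  then obtain t where t: "t \<notin> ?B I \<union> ?B J" using ex_new_if_finite[OF infinite_UNIV_char_0] by blast
  show thesis
    by (rule that[of "lform r t"]) (use t I J lform_Rn lform_nonzero in \<open>auto simp: regular_def\<close>)
qed

lemma regular_colon:
  assumes "homogeneous_ideal r I" "regular r I x"
  shows "colon r I x = I"
  using assms hi_Rg[OF assms(1)] colon_mono[OF assms(1), of x] by (auto simp: regular_def colon_def)

lemma hf_regular:
  assumes I: "homogeneous_ideal r I" and x: "regular r I x"
  shows "hf r I (Suc n) = hf r I n + hf r (adj r I x) (Suc n)"
  using hf_exact[OF I, of x 1 n] regular_colon[OF assms] x by (simp add: regular_def)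

lemma hf_saturation_eventually:
  assumes I: "homogeneous_ideal r I"
  shows "\<exists>n0. \<forall>n\<ge>n0. hf r (saturation r I) n = hf r I n"
proof -
  obtain n0 where "\<And>n. n0 \<le> n \<Longrightarrow> saturation r I \<inter> homog n \<subseteq> I" using saturation_high_degree[OF I] by blast
  then have "hf r (saturation r I) n = hf r I n" if "n0 \<le> n" for n
    using hf_eq_iff[OF I saturation_hi[OF I] saturation_mono[OF I], of n] that by simp
  then show ?thesis by blast
qed

section \<open>The pencil of hyperplanes\<close>

lemma mult_linear: "Vector_Spaces.linear smul smul ((*) (x :: cpoly))"
  unfolding Vector_Spaces.linear_iff
  by (intro conjI allI pm.vector_space_axioms) (auto simp: distrib_left smul_mult_right)

lemma elt_times_image: "x *o A = (*) x ` A"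
  by (auto simp: elt_set_times_def)

lemma elt_times_subspace: "pm.subspace A \<Longrightarrow> pm.subspace (x *o A)" for x :: cpoly
  unfolding elt_times_image by (rule pm.subspace_image[OF mult_linear])

lemma elt_times_Rn: "x \<in> Rn r e \<Longrightarrow> A \<subseteq> Rn r n \<Longrightarrow> x *o A \<subseteq> Rn r (n + e)"
  using Rn_mult[of x r e _ n] by (auto simp: elt_set_times_def add.commute)

lemma elt_times_ideal: "homogeneous_ideal r I \<Longrightarrow> x \<in> Rg r \<Longrightarrow> x *o I \<subseteq> I"
  using hi_mult by (auto simp: elt_set_times_def)

lemma rd_elt_times_le:
  assumes "pm.subspace A" "pm.subspace B" "pm.subspace B'" "(x :: cpoly) *o B \<subseteq> B'"
  shows "pm.rd (x *o A) B' \<le> pm.rd A B"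
proof -
  interpret m: Vector_Spaces.linear smul smul "(*) x" by (rule mult_linear)
  let ?P = "{v. x * v \<in> B'}"
  have P: "pm.subspace ?P"
    using assms(3) by (auto simp: pm.subspace_def distrib_left smul_mult_right)
  have "pm.rd (x *o A) B' = pm.rd A ?P"
    unfolding elt_times_image by (rule rd_image[OF mult_linear assms(1) P assms(3)]) simp
  also have "\<dots> \<le> pm.rd A B"
    using assms(4) by (intro pm.rd_mono_right assms P) (auto simp: elt_set_times_def)
  finally show ?thesis .
qed

text \<open>Without the degree restriction of \<open>regular\<close>, so that it covers powers and
  products and forms of arbitrary degree.\<close>

definition nzd :: "nat \<Rightarrow> cpoly set \<Rightarrow> cpoly \<Rightarrow> bool" where
  "nzd r I x \<longleftrightarrow> x \<in> Rg r \<and> (\<forall>f\<in>Rg r. x * f \<in> I \<longrightarrow> f \<in> I)"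

lemma nzd_mult: "nzd r I x \<Longrightarrow> nzd r I y \<Longrightarrow> nzd r I (x * y)"
  unfolding nzd_def
proof (elim conjE, intro conjI ballI impI)
  fix f assume y: "y \<in> Rg r" "\<forall>f\<in>Rg r. y * f \<in> I \<longrightarrow> f \<in> I" and x: "\<forall>f\<in>Rg r. x * f \<in> I \<longrightarrow> f \<in> I"
    and f: "f \<in> Rg r" "x * y * f \<in> I"
  have "y * f \<in> I" using x f Rg_mult[OF y(1) f(1)] by (simp add: mult.assoc)
  then show "f \<in> I" using y(2) f(1) by blast
qed (rule Rg_mult)

lemma nzd_power: "nzd r I x \<Longrightarrow> nzd r I (x ^ k)"
proof (induction k)
  case (Suc k)
  then show ?case using nzd_mult by simp
qed (simp add: nzd_def)

lemma regular_nzd: "regular r I x \<Longrightarrow> nzd r I x"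
  by (simp add: regular_def nzd_def)

lemma prime_nzd: "integral_subscheme r P \<Longrightarrow> f \<in> Rg r \<Longrightarrow> f \<notin> P \<Longrightarrow> nzd r P f"
  using integral_subschemeD(5) unfolding nzd_def by blast

lemma rd_nzd:
  assumes "homogeneous_ideal r I" "nzd r I x" "pm.subspace A" "A \<subseteq> Rg r"
  shows "pm.rd (x *o A) I = pm.rd A I"
  unfolding elt_times_image
  by (rule rd_image[OF mult_linear assms(3) hi_subspace[OF assms(1)] hi_subspace[OF assms(1)]])
    (use assms hi_mult[OF assms(1)] in \<open>auto simp: nzd_def\<close>)

definition dm :: "cpoly set \<Rightarrow> cpoly set \<Rightarrow> nat" where
  "dm A B = the_enat (pm.rd A B)"

lemma dm_enat: "A \<subseteq> Rn r n \<Longrightarrow> pm.subspace B \<Longrightarrow> enat (dm A B) = pm.rd A B"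
  unfolding dm_def using pm.rd_finite_iff[of B A] pm.fd_mono[OF fd_Rn[of B r n], of A B]
  by (cases "pm.rd A B") auto

text \<open>On a subspace \<open>X\<close> this is \<open>(x, y)^t X\<close>. With
  \<open>X = R_n\<close> it plays the role of bidegree \<open>(n, t)\<close>: forms of degree
  \<open>n\<close> with coefficients of degree \<open>t\<close> on the parameter line of the
  pencil.\<close>

fun pw :: "cpoly \<Rightarrow> cpoly \<Rightarrow> nat \<Rightarrow> cpoly set \<Rightarrow> cpoly set" where
  "pw x y 0 X = X"
| "pw x y (Suc t) X = x *o pw x y t X + y *o pw x y t X"

lemma pw_subspace: "pm.subspace X \<Longrightarrow> pm.subspace (pw x y t X)"
  by (induction t) (auto intro: pm.subspace_plus elt_times_subspace)

lemma pw_mono: "X \<subseteq> Y \<Longrightarrow> pw x y t X \<subseteq> pw x y t Y"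
proof (induction t)
  case (Suc t)
  then show ?case unfolding pw.simps by (intro set_plus_mono2 set_times_mono)
qed simp

lemma pw_Rn: "x \<in> Rn r 1 \<Longrightarrow> y \<in> Rn r 1 \<Longrightarrow> X \<subseteq> Rn r n \<Longrightarrow> pw x y t X \<subseteq> Rn r (n + t)"
proof (induction t)
  case (Suc t)
  have "x *o pw x y t X \<subseteq> Rn r (n + Suc t)" "y *o pw x y t X \<subseteq> Rn r (n + Suc t)"
    using elt_times_Rn[of _ r 1 "pw x y t X" "n + t"] Suc by simp_all
  then show ?case unfolding pw.simps by (rule pm.plus_subset[OF Rn_subspace])
qed simp

lemma pw_elt_times: "pw x y t (z *o X) = z *o pw x y t X"
  by (induction t) (simp_all add: set_times_plus_distrib2 set_times_rearrange2 mult.commute)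

lemma pw_plus: "pw x y t (X + Y) = pw x y t X + pw x y t Y"
  by (induction t) (simp_all add: set_times_plus_distrib2 ac_simps)

lemma pw_ideal: "homogeneous_ideal r I \<Longrightarrow> x \<in> Rg r \<Longrightarrow> y \<in> Rg r \<Longrightarrow> pw x y t I \<subseteq> I"
proof (induction t)
  case (Suc t)
  have "x *o pw x y t I \<subseteq> I" "y *o pw x y t I \<subseteq> I"
    using Suc elt_times_ideal[OF Suc.prems(1)] set_times_mono[of "pw x y t I" I] by blast+
  then show ?case using pm.plus_subset[OF hi_subspace[OF Suc.prems(1)]] by simp
qed simp

lemma pw_pw: "pw x y s (pw x y t X) = pw x y (s + t) X"
  by (induction s) simp_all

lemma pw_left: "v \<in> pw x y t X \<Longrightarrow> pm.subspace X \<Longrightarrow> x * v \<in> pw x y (Suc t) X"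
  using pm.subset_plus_left[OF elt_times_subspace[OF pw_subspace]] by fastforce

lemma pw_right: "v \<in> pw x y t X \<Longrightarrow> pm.subspace X \<Longrightarrow> y * v \<in> pw x y (Suc t) X"
  using pm.subset_plus_right[OF elt_times_subspace[OF pw_subspace]] by fastforce

lemma pw_mult:
  assumes "pm.subspace Z" "\<And>u v. u \<in> X \<Longrightarrow> v \<in> Y \<Longrightarrow> u * v \<in> Z" "f \<in> pw x y q X" "g \<in> pw x y t Y"
  shows "f * g \<in> pw x y (q + t) Z"
proof -
  have 1: "f * g \<in> pw x y t Z" if "f \<in> X" "g \<in> pw x y t Y" for f g
  proof -
    have "f *o pw x y t Y = pw x y t (f *o Y)" by (simp add: pw_elt_times)
    also have "\<dots> \<subseteq> pw x y t Z" using assms(2)[OF that(1)] by (intro pw_mono) (auto simp: elt_set_times_def)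
    finally show ?thesis using that(2) by auto
  qed
  show ?thesis
    using assms(3)
  proof (induction q arbitrary: f)
    case 0
    then show ?case using 1 assms(4) by simp
  next
    case (Suc q)
    then obtain u v where uv: "u \<in> pw x y q X" "v \<in> pw x y q X" "f = x * u + y * v"
      by (auto simp: set_plus_def elt_set_times_def)
    have "x * (u * g) \<in> x *o pw x y (q + t) Z" "y * (v * g) \<in> y *o pw x y (q + t) Z"
      using Suc.IH uv by auto
    then have "x * (u * g) + y * (v * g) \<in> pw x y (Suc q + t) Z" by auto
    then show ?case using uv by (simp add: algebra_simps)
  qed
qed

text \<open>Factors \<open>x\<close> and \<open>y\<close> may be counted in the other
  degree.\<close>

lemma pw_shift:
  assumes "x \<in> Rn r 1" "y \<in> Rn r 1"
  shows "pw x y (k + e) (Rn r j) \<subseteq> pw x y k (Rn r (j + e))"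
  unfolding pw_pw[symmetric] by (intro pw_mono pw_Rn assms order.refl)

lemma monomial_pw:
  assumes "x \<in> Rn r 1" "y \<in> Rn r 1"
  shows "x ^ a * y ^ b \<in> pw x y (a + b) (Rn r 0)"
proof -
  have "y ^ b \<in> pw x y b (Rn r 0)"
  proof (induction b)
    case (Suc b)
    then show ?case using pw_right[OF _ Rn_subspace] by simp
  qed (simp add: homog_one)
  then show ?thesis
  proof (induction a)
    case (Suc a)
    then show ?case using pw_left[OF _ Rn_subspace] by (simp add: mult.assoc)
  qed simp
qed

text \<open>Evaluating at \<open>t = c + 1\<close> is enough. Bounds up to constants in
  \<open>t\<close> thus become inequalities between slopes.\<close>

lemma slope_le:
  fixes \<alpha> \<beta> c :: nat
  assumes "\<And>t. \<alpha> * t \<le> \<beta> * t + c"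
  shows "\<alpha> \<le> \<beta>"
proof (rule ccontr)
  assume "\<not> \<alpha> \<le> \<beta>"
  then have "Suc \<beta> * Suc c \<le> \<alpha> * Suc c" by (intro mult_le_mono1) simp
  with assms[of "Suc c"] show False by simp
qed

locale pencil =
  fixes r :: nat and I :: "cpoly set" and x y :: cpoly
  assumes I: "homogeneous_ideal r I" and x: "regular r I x" and y: "y \<in> Rn r 1"
begin

abbreviation A :: "nat \<Rightarrow> cpoly set" where "A n \<equiv> Rn r n"
abbreviation P :: "nat \<Rightarrow> cpoly set \<Rightarrow> cpoly set" where "P \<equiv> pw x y"

text \<open>
  In degree \<open>t\<close> of the pencil, \<open>inc n t\<close> is the increment of \<open>F n\<close>; it decreases to \<open>rho n\<close>, which is thus
  the dimension of the forms of degree \<open>n\<close> on the generic member of the pencil.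
\<close>

definition F :: "nat \<Rightarrow> nat \<Rightarrow> nat" where "F n t = dm (P t (A n)) I"
definition inc :: "nat \<Rightarrow> nat \<Rightarrow> nat" where "inc n t = dm (y *o P t (A n)) (x *o P t (A n) + I)"
definition rho :: "nat \<Rightarrow> nat" where "rho n = (INF t. inc n t)"

lemma xR: "x \<in> Rn r 1" and x_nzd: "nzd r I x" and sI: "pm.subspace I"
  using x regular_nzd hi_subspace[OF I] by (auto simp: regular_def)

lemma sP: "pm.subspace (P t (A n))" and PR: "P t (A n) \<subseteq> Rn r (n + t)"
  by (intro pw_subspace Rn_subspace, intro pw_Rn xR y order.refl)

lemma PRg: "P t (A n) \<subseteq> Rg r"
  using PR by blast

lemma sxP: "pm.subspace (z *o P t (A n))"
  by (intro elt_times_subspace sP)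

lemma sxPI: "pm.subspace (z *o P t (A n) + I)"
  by (intro pm.subspace_plus sxP sI)

lemma F_enat: "enat (F n t) = pm.rd (P t (A n)) I"
  unfolding F_def by (rule dm_enat[OF PR sI])

lemma inc_enat: "enat (inc n t) = pm.rd (y *o P t (A n)) (x *o P t (A n) + I)"
  unfolding inc_def by (rule dm_enat[OF elt_times_Rn[OF y PR] sxPI])

text \<open>Multiplication by the regular form \<open>x\<close> preserves dimension modulo
  \<open>I\<close>, so only the part coming from \<open>y\<close> is new.\<close>

lemma F_Suc: "F n (Suc t) = F n t + inc n t"
proof -
  have "enat (F n (Suc t)) = pm.rd (y *o P t (A n) + x *o P t (A n)) I"
    unfolding F_enat by (simp add: add.commute)
  also have "\<dots> = pm.rd (x *o P t (A n)) I + pm.rd (y *o P t (A n)) (x *o P t (A n) + I)"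
    by (intro pm.rd_plus sxP sI)
  also have "pm.rd (x *o P t (A n)) I = enat (F n t)"
    unfolding F_enat by (rule rd_nzd[OF I x_nzd sP PRg])
  finally show ?thesis unfolding inc_enat[symmetric] by simp
qed

text \<open>Multiplication by \<open>y\<close> maps the increment at \<open>t\<close> onto the one
  at \<open>t + 1\<close>, because \<open>x y Q\<close> is already contained in
  \<open>x (x Q + y Q)\<close> for \<open>Q = P t (A n)\<close>.\<close>

lemma inc_Suc: "inc n (Suc t) \<le> inc n t"
proof -
  let ?Q = "P t (A n)" and ?C = "x *o P (Suc t) (A n) + I"
  have xy: "y *o (x *o ?Q) = x *o (y *o ?Q)" by (simp add: set_times_rearrange2 mult.commute)
  have sub: "x *o (y *o ?Q) \<subseteq> ?C"
  proof -
    have "y *o ?Q \<subseteq> P (Suc t) (A n)" using pm.subset_plus_right[OF sxP] by simp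
    then have "x *o (y *o ?Q) \<subseteq> x *o P (Suc t) (A n)" by (rule set_times_mono)
    then show ?thesis using pm.subset_plus_left[OF sI] by blast
  qed
  have eq: "y *o P (Suc t) (A n) = y *o (y *o ?Q) + x *o (y *o ?Q)"
    by (simp add: set_times_plus_distrib2 xy add.commute)
  have s: "pm.subspace (y *o (y *o ?Q))" "pm.subspace (x *o (y *o ?Q))" by (intro elt_times_subspace sxP)+
  have "enat (inc n (Suc t)) = pm.rd (y *o (y *o ?Q)) ?C"
    unfolding inc_enat
  proof (rule pm.rd_cong_left)
    show "y *o P (Suc t) (A n) \<subseteq> y *o (y *o ?Q) + ?C"
      unfolding eq by (intro set_plus_mono2 order.refl sub)
    show "y *o (y *o ?Q) \<subseteq> y *o P (Suc t) (A n) + ?C"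
      unfolding eq using pm.subset_plus_left[OF s(2), of "y *o (y *o ?Q)"]
        pm.subset_plus_left[OF sxPI, of "y *o (y *o ?Q) + x *o (y *o ?Q)"] by blast
  qed (intro sxP s sxPI)+
  also have "\<dots> \<le> pm.rd (y *o ?Q) (x *o ?Q + I)"
  proof (rule rd_elt_times_le[OF sxP sxPI sxPI])
    have "y *o (x *o ?Q + I) = x *o (y *o ?Q) + y *o I" by (simp add: set_times_plus_distrib2 xy)
    also have "\<dots> \<subseteq> ?C"
      using sub elt_times_ideal[OF I, of y] y pm.subset_plus_right[OF sxP, of I]
      by (intro pm.plus_subset sxPI) blast+
    finally show "y *o (x *o ?Q + I) \<subseteq> ?C" .
  qed
  finally show ?thesis unfolding inc_enat[symmetric] by simp
qed

lemma rho_le_inc: "rho n \<le> inc n t"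
  unfolding rho_def by (rule cINF_lower) auto

lemma rho_eventually: "\<exists>T. \<forall>t\<ge>T. inc n t = rho n"
proof -
  have "rho n \<in> Set.range (inc n)" unfolding rho_def by (rule Inf_nat_def1) auto
  then obtain T where T: "inc n T = rho n" by auto
  have "inc n t \<le> inc n T" if "T \<le> t" for t
    using lift_Suc_antimono_le[of "inc n", OF inc_Suc that] .
  then show ?thesis using T rho_le_inc by (metis le_antisym)
qed

lemma rho_eqI: "(\<And>t. inc n t = k) \<Longrightarrow> rho n = k"
  unfolding rho_def by simp

lemma F_lower: "rho n * t \<le> F n t"
proof (induction t)
  case (Suc t)
  then show ?case using rho_le_inc[of n t] by (simp add: F_Suc)
qed simp

lemma F_upper: "\<exists>c. \<forall>t. F n t \<le> rho n * t + c"
proof -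
  obtain T where T: "\<forall>t\<ge>T. inc n t = rho n" using rho_eventually by blast
  have mono: "F n s \<le> F n t" if "s \<le> t" for s t
    using that by (rule lift_Suc_mono_le[rotated]) (simp add: F_Suc)
  have "F n (T + k) = F n T + rho n * k" for k
    by (induction k) (use T in \<open>simp_all add: F_Suc\<close>)
  then have "F n t \<le> rho n * t + F n T" for t
  proof (cases "t \<le> T")
    case False
    then have "F n t = F n T + rho n * (t - T)" using \<open>\<And>k. F n (T + k) = F n T + rho n * k\<close>[of "t - T"] by simp
    also have "\<dots> \<le> F n T + rho n * t" by simp
    finally show ?thesis by simp
  next
    case True
    then show ?thesis using mono[OF True] by simp
  qed
  then show ?thesis by blast
qed

lemma rho_leI:
  assumes "\<And>t. F n t \<le> F k (t + a) + b"
  shows "rho n \<le> rho k"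
proof -
  obtain c where c: "\<And>t. F k t \<le> rho k * t + c" using F_upper by blast
  have "rho n * t \<le> rho k * t + (rho k * a + c + b)" for t
    using F_lower[of n t] assms[of t] c[of "t + a"] by (simp add: distrib_left)
  then show ?thesis by (rule slope_le)
qed

lemma mult_A: "f \<in> A a \<Longrightarrow> f *o A b \<subseteq> A (b + a)"
  by (rule elt_times_Rn) auto

text \<open>Semicontinuity: the first increment is spanned by the image under \<open>y\<close> of
  the forms on the special member \<open>x = 0\<close>, and later increments are no larger.\<close>

lemma rho_Suc_le_hf: "rho (Suc n) \<le> hf r (adj r I x) (Suc n)"
proof -
  have "enat (rho (Suc n)) \<le> enat (inc (Suc n) 0)" using rho_le_inc by simp
  also have "\<dots> = pm.rd (y *o A (Suc n)) (x *o A (Suc n) + I)" unfolding inc_enat by simp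
  also have "\<dots> \<le> pm.rd (A (Suc n)) (x *o A n + I)"
  proof (rule rd_elt_times_le)
    have "y *o (x *o A n) = x *o (y *o A n)" by (simp add: set_times_rearrange2 mult.commute)
    also have "\<dots> \<subseteq> x *o A (Suc n)" using mult_A[OF y, of n] by (intro set_times_mono) simp
    finally show "y *o (x *o A n + I) \<subseteq> x *o A (Suc n) + I"
      unfolding set_times_plus_distrib2 using elt_times_ideal[OF I, of y] y by (intro set_plus_mono2) auto
  qed (intro pm.subspace_plus elt_times_subspace Rn_subspace sI)+
  also have "\<dots> = pm.rd (A (Suc n)) (adj r I x)"
  proof (rule pm.rd_cong)
    fix v assume v: "v \<in> A (Suc n)"
    show "v \<in> x *o A n + I \<longleftrightarrow> v \<in> adj r I x"
    proof
      assume "v \<in> x *o A n + I"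
      then show "v \<in> adj r I x" by (auto simp: adj_def set_plus_def elt_set_times_def) (metis add.commute)
    next
      assume "v \<in> adj r I x"
      then obtain i g where "i \<in> I \<inter> homog (Suc n)" "v = i + x * g" "g \<in> Rn r (Suc n - 1)"
        using adj_homog_elim[OF I xR, of v "Suc n"] v by (metis IntD2 One_nat_def Suc_le_mono le0)
      then have "x * g + i \<in> x *o A n + I" "v = x * g + i" by (auto simp: add.commute)
      then show "v \<in> x *o A n + I" by simp
    qed
  qed (intro pm.subspace_plus elt_times_subspace Rn_subspace sI hi_subspace[OF adj_hi[OF I xR]])+
  finally show ?thesis using hf_enat[OF adj_hi[OF I xR], of "Suc n"] by (metis enat_ord_simps(1))
qed

text \<open>Modulo \<open>J\<close> the multiples by \<open>x\<close> vanish, while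
  \<open>y^t\<close> times the forms of degree \<open>n\<close> keep their dimension; so every
  increment is at least \<open>hf r J n\<close>. Applied to the saturated section by
  \<open>x\<close>, this is the counterpart of the upper bound.\<close>

lemma hf_le_rho:
  assumes J: "homogeneous_ideal r J" and IJ: "I \<subseteq> J" and xJ: "x \<in> J" and yJ: "nzd r J y"
  shows "hf r J n \<le> rho n"
proof -
  have sJ: "pm.subspace J" by (rule hi_subspace[OF J])
  have "enat (hf r J n) \<le> pm.rd (P t (A n)) J" for t
  proof (induction t)
    case 0
    then show ?case by (simp add: hf_enat[OF J])
  next
    case (Suc t)
    have "pm.rd (P t (A n)) J = pm.rd (y *o P t (A n)) J" by (rule rd_nzd[OF J yJ sP PRg, symmetric])
    also have "\<dots> \<le> pm.rd (P (Suc t) (A n)) J"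
      using pm.subset_plus_right[OF sxP[of x t n]] by (intro pm.rd_mono_left sxP sP sJ) simp
    finally show ?case using Suc by (rule order.trans[rotated])
  qed
  moreover have "pm.rd (P t (A n)) J \<le> enat (inc n t)" for t
  proof -
    have "x *o P t (A n) + I \<subseteq> J"
      using PRg hi_mult'[OF J xJ] by (intro pm.plus_subset sJ IJ) (auto simp: elt_set_times_def)
    then have "pm.rd (y *o P t (A n)) J \<le> enat (inc n t)"
      unfolding inc_enat by (intro pm.rd_mono_right sxP sxPI sJ)
    then show ?thesis using rd_nzd[OF J yJ sP PRg] by simp
  qed
  ultimately have "enat (hf r J n) \<le> enat (inc n t)" for t by (rule order.trans)
  then show ?thesis unfolding rho_def by (intro cINF_greatest) auto
qed

lemma xP_subset: "x *o P t (A n) \<subseteq> P t (A (Suc n))"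
proof -
  have "x *o A n \<subseteq> A (Suc n)" using mult_A[OF xR, of n] by simp
  then show ?thesis unfolding pw_elt_times[symmetric] by (rule pw_mono)
qed

lemma F_mono: "F n t \<le> F (Suc n) t"
proof -
  have "enat (F n t) = pm.rd (x *o P t (A n)) I" unfolding F_enat by (rule rd_nzd[OF I x_nzd sP PRg, symmetric])
  also have "\<dots> \<le> enat (F (Suc n) t)" unfolding F_enat by (intro pm.rd_mono_left sxP sP sI xP_subset)
  finally show ?thesis by simp
qed

lemma rho_mono: "rho n \<le> rho (Suc n)"
  by (rule rho_leI[of _ _ 0 0]) (simp add: F_mono)

text \<open>Modulo \<open>x\<close> times the previous degree, forms of degree \<open>n + 2\<close>
  are spanned by variables times forms of degree \<open>n + 1\<close>, and each of the
  \<open>r + 1\<close> variables contributes at most the dimension of the new forms there.\<close>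

lemma F_Suc_Suc: "F (Suc (Suc n)) t \<le> F (Suc n) t + Suc r * (F (Suc n) t - F n t)"
proof -
  let ?Q = "P t (A (Suc n))"
  let ?D = "pm.rd ?Q (x *o P t (A n) + I)"
  have D: "enat (F (Suc n) t) = enat (F n t) + ?D"
  proof -
    have "pm.rd ?Q I = pm.rd (x *o P t (A n)) I + ?D"
      by (intro pm.rd_chain sP sxP sI xP_subset)
    then show ?thesis unfolding F_enat rd_nzd[OF I x_nzd sP PRg] .
  qed
  then have D': "?D = enat (F (Suc n) t - F n t)" by (cases ?D) auto
  have pwsum: "pw x y t (\<Sum>k\<in>K. B k) = (\<Sum>k\<in>K. pw x y t (B k))" if "finite K" "K \<noteq> {}" for K :: "nat set" and B
    using that by (induction K rule: finite_ne_induct) (simp_all add: pw_plus)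
  have sub: "P t (A (Suc (Suc n))) \<subseteq> (\<Sum>k\<le>r. var k *o ?Q)"
    using pw_mono[OF Rn_Suc_subset[of r "Suc n"], of x y t] by (simp add: pwsum[of "{..r}"] pw_elt_times)
  let ?S = "\<Sum>k\<le>r. var k *o ?Q"
  have sS: "pm.subspace ?S" by (intro pm.subspace_set_sum sxP)
  have "enat (F (Suc (Suc n)) t) = pm.rd (P t (A (Suc (Suc n)))) I" by (rule F_enat)
  also have "\<dots> = pm.rd (x *o ?Q) I + pm.rd (P t (A (Suc (Suc n)))) (x *o ?Q + I)"
    by (intro pm.rd_chain sP sxP sI xP_subset)
  also have "pm.rd (x *o ?Q) I = enat (F (Suc n) t)" unfolding F_enat by (rule rd_nzd[OF I x_nzd sP PRg])
  also have "pm.rd (P t (A (Suc (Suc n)))) (x *o ?Q + I) \<le> pm.rd ?S (x *o ?Q + I)"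
    by (intro pm.rd_mono_left sP sS sxPI sub)
  also have "\<dots> \<le> (\<Sum>k\<le>r. pm.rd (var k *o ?Q) (x *o ?Q + I))"
    by (intro pm.rd_set_sum_le sxP sxPI) simp
  also have "\<dots> \<le> (\<Sum>k\<le>r. ?D)"
  proof (intro sum_mono rd_elt_times_le sP sxPI)
    fix k assume k: "k \<in> {..r}"
    have "var k *o (x *o P t (A n)) = x *o P t (var k *o A n)"
      by (simp add: pw_elt_times set_times_rearrange2 mult.commute)
    also have "\<dots> \<subseteq> x *o ?Q" using mult_A[OF Rn_var, of k n] k by (intro set_times_mono pw_mono) simp
    finally show "var k *o (x *o P t (A n) + I) \<subseteq> x *o ?Q + I"
      unfolding set_times_plus_distrib2 using elt_times_ideal[OF I Rg_var, of k] k by (intro set_plus_mono2) auto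
  qed
  also have "(\<Sum>k\<le>r. ?D) = enat (Suc r * (F (Suc n) t - F n t))"
    unfolding D' by (simp add: of_nat_eq_enat[symmetric] distrib_right)
  finally show ?thesis by simp
qed

text \<open>Equal slopes mean that the new forms in degree \<open>n + 1\<close> have dimension
  bounded in \<open>t\<close>; then so do those in degree \<open>n + 2\<close>.\<close>

lemma rho_stable:
  assumes "rho (Suc n) = rho n"
  shows "rho (Suc (Suc n)) = rho (Suc n)"
proof (rule antisym)
  obtain c where c: "\<And>t. F (Suc n) t \<le> rho (Suc n) * t + c" using F_upper by blast
  show "rho (Suc (Suc n)) \<le> rho (Suc n)"
  proof (rule rho_leI[of _ _ 0 "Suc r * c"])
    fix t
    have "F (Suc n) t - F n t \<le> c" using c[of t] F_lower[of n t] assms by simp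
    then have "Suc r * (F (Suc n) t - F n t) \<le> Suc r * c" by (rule mult_le_mono2)
    then show "F (Suc (Suc n)) t \<le> F (Suc n) (t + 0) + Suc r * c" using F_Suc_Suc[of n t] by simp
  qed
qed (rule rho_mono)

text \<open>If \<open>x\<close> and \<open>y\<close> generate everything modulo \<open>I\<close>
  from degree \<open>N\<close> on, then \<open>F n t\<close> is the Hilbert function at
  \<open>n + t\<close>, whose increment is \<open>d\<close>.\<close>

lemma rho_of_generated:
  assumes gen: "\<And>k. N \<le> k \<Longrightarrow> A (Suc k) \<subseteq> x *o A k + y *o A k + I"
    and hf: "\<And>k. N \<le> k \<Longrightarrow> hf r I (Suc k) = hf r I k + d" and n: "N \<le> n"
  shows "rho n = d"
proof -
  have cover: "A (n + t) \<subseteq> P t (A n) + I" for t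
  proof (induction t)
    case 0
    then show ?case using pm.subset_plus_left[OF sI] by simp
  next
    case (Suc t)
    have "A (n + Suc t) \<subseteq> x *o A (n + t) + y *o A (n + t) + I" using gen[of "n + t"] n by simp
    also have "\<dots> \<subseteq> x *o (P t (A n) + I) + y *o (P t (A n) + I) + I"
      by (intro set_plus_mono2 set_times_mono Suc order.refl)
    also have "\<dots> \<subseteq> P (Suc t) (A n) + I"
    proof (intro pm.plus_subset)
      have *: "z *o (P t (A n) + I) \<subseteq> P (Suc t) (A n) + I" if "z *o P t (A n) \<subseteq> P (Suc t) (A n)" "z \<in> Rg r" for z
        unfolding set_times_plus_distrib2 using that elt_times_ideal[OF I] by (intro set_plus_mono2) auto
      show "x *o (P t (A n) + I) \<subseteq> P (Suc t) (A n) + I"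
        using * xR pm.subset_plus_left[OF sxP] by auto
      show "y *o (P t (A n) + I) \<subseteq> P (Suc t) (A n) + I"
        using * y pm.subset_plus_right[OF sxP] by auto
      show "I \<subseteq> P (Suc t) (A n) + I" by (rule pm.subset_plus_right[OF sP])
      show "pm.subspace (P (Suc t) (A n) + I)" by (intro pm.subspace_plus sP sI)
      then show "pm.subspace (P (Suc t) (A n) + I)" .
    qed
    finally show ?case .
  qed
  have "F n t = hf r I (n + t)" for t
  proof -
    have "pm.rd (P t (A n)) I = pm.rd (A (n + t)) I"
      using cover[of t] PR[of t n] pm.subset_plus_left[OF sI, of "A (n + t)"]
      by (intro pm.rd_cong_left sP Rn_subspace sI) auto
    then show ?thesis using F_enat[of n t] hf_enat[OF I, of "n + t"] by (metis enat.inject)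
  qed
  then have "inc n t = d" for t using F_Suc[of n t] hf[of "n + t"] n by simp
  then show ?thesis by (rule rho_eqI)
qed

end

section \<open>Bezout\<close>

text \<open>Each multiplication by \<open>f\<close> raises the slope for \<open>S\<close> by at
  least the slope \<open>d\<close> of \<open>C\<close>. After \<open>k\<close> multiplications the
  slope is at least \<open>k d\<close> in a degree near \<open>k m\<close>, where it is at most
  about \<open>s k m\<close>.\<close>

lemma bezout:
  fixes s b :: int
  assumes pS: "pencil r I x y" and pC: "pencil r J x y" and S: "integral_subscheme r I" and IJ: "I \<subseteq> J"
    and gen: "\<And>k. N \<le> k \<Longrightarrow> Rn r (Suc k) \<subseteq> x *o Rn r k + y *o Rn r k + J"
    and hfC: "\<And>k. N \<le> k \<Longrightarrow> hf r J (Suc k) = hf r J k + d"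
    and hfS: "\<And>k. N \<le> k \<Longrightarrow> int (hf r (adj r I x) k) \<le> s * int k + b"
    and f: "f \<in> pw x y q (Rn r m)" "f \<in> J" "f \<notin> I"
  shows "int d \<le> s * int m"
proof -
  interpret S: pencil r I x y by (rule pS)
  interpret C: pencil r J x y by (rule pC)
  have fR: "f \<in> Rn r (m + q)" using f(1) S.PR by blast
  have fnzd: "nzd r I f" using prime_nzd[OF S _ f(3)] fR by blast
  \<comment> \<open>The multiples of \<open>f\<close> form a copy of the forms on \<open>S\<close>
    and vanish on \<open>C\<close>, because \<open>f \<in> J\<close>.\<close>
  have FS: "S.F n t + C.F (n + m) (t + q) \<le> S.F (n + m) (t + q)" for n t
  proof -
    have sf: "pm.subspace (f *o pw x y t (Rn r n))" by (rule S.sxP)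
    have sub: "f *o pw x y t (Rn r n) \<subseteq> pw x y (t + q) (Rn r (n + m))"
    proof -
      have "f * g \<in> pw x y (q + t) (Rn r (m + n))" if "g \<in> pw x y t (Rn r n)" for g
        by (rule pw_mult[OF Rn_subspace Rn_mult f(1) that])
      then show ?thesis by (auto simp: elt_set_times_def add.commute)
    qed
    have "f *o pw x y t (Rn r n) + I \<subseteq> J"
      using S.PRg hi_mult'[OF C.I f(2)] by (intro pm.plus_subset C.sI IJ) (auto simp: elt_set_times_def)
    then have "pm.rd (pw x y (t + q) (Rn r (n + m))) J
        \<le> pm.rd (pw x y (t + q) (Rn r (n + m))) (f *o pw x y t (Rn r n) + I)"
      by (intro pm.rd_mono_right S.sP S.sxPI C.sI)
    moreover have "pm.rd (pw x y (t + q) (Rn r (n + m))) I = pm.rd (f *o pw x y t (Rn r n)) I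
        + pm.rd (pw x y (t + q) (Rn r (n + m))) (f *o pw x y t (Rn r n) + I)"
      by (intro pm.rd_chain S.sP sf S.sI sub)
    moreover have "pm.rd (f *o pw x y t (Rn r n)) I = enat (S.F n t)"
      unfolding S.F_enat by (rule rd_nzd[OF S.I fnzd S.sP S.PRg])
    ultimately have "enat (S.F n t) + enat (C.F (n + m) (t + q)) \<le> enat (S.F (n + m) (t + q))"
      unfolding S.F_enat C.F_enat by (simp add: add_left_mono)
    then show ?thesis by simp
  qed
  have step: "S.rho n + d \<le> S.rho (n + m)" if n: "N \<le> n" for n
  proof -
    obtain c where c: "\<And>t. S.F (n + m) t \<le> S.rho (n + m) * t + c" using S.F_upper by blast
    have d: "C.rho (n + m) = d" using n by (intro C.rho_of_generated[of N] gen hfC) auto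
    have "(S.rho n + d) * t \<le> S.rho (n + m) * t + (S.rho (n + m) * q + c)" for t
      using S.F_lower[of n t] C.F_lower[of "n + m" "t + q"] FS[of n t] c[of "t + q"]
      unfolding d by (simp add: distrib_left distrib_right)
    then show ?thesis by (rule slope_le)
  qed
  have "k * d \<le> S.rho (Suc N + k * m)" for k
  proof (induction k)
    case (Suc k)
    have "S.rho (Suc N + k * m) + d \<le> S.rho (Suc N + k * m + m)" by (rule step) simp
    with Suc show ?case by (simp add: algebra_simps)
  qed simp
  then have *: "int k * int d \<le> s * (int (Suc N) + int k * int m) + b" for k
  proof -
    have "int (S.rho (Suc (N + k * m))) \<le> s * int (Suc (N + k * m)) + b"
      using S.rho_Suc_le_hf[of "N + k * m"] hfS[of "Suc (N + k * m)"] by simp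
    moreover have "int (k * d) \<le> int (S.rho (Suc (N + k * m)))"
      using \<open>\<And>k. k * d \<le> S.rho (Suc N + k * m)\<close>[of k] by (simp del: of_nat_mult)
    ultimately show ?thesis by (simp add: algebra_simps)
  qed
  show ?thesis
  proof (rule ccontr)
    assume "\<not> int d \<le> s * int m"
    then have "s * int m + 1 \<le> int d" by simp
    \<comment> \<open>An excess of one per multiplication would accumulate beyond the fixed
      error.\<close>
    then have "int k * (s * int m + 1) \<le> int k * int d" for k by (intro mult_left_mono) auto
    then have "int k \<le> s * int (Suc N) + b" for k
      using *[of k] by (simp add: algebra_simps) (smt (verit) mult.assoc mult.commute)
    from this[of "Suc (nat (s * int (Suc N) + b))"] show False by linarith
  qed
qed

section \<open>The sectional genus is bounded below\<close>

text \<open>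
  If the slopes grew faster than allowed, some nonzero \<open>f\<close> of degree \<open>m\<close> would be divisible by
  \<open>z ^ (m + 1)\<close> up to powers of \<open>x\<close>; multiplication by \<open>f\<close> would then map degree \<open>M\<close> injectively into
  a multiple of degree \<open>M - 1\<close>.
\<close>

lemma rho_upper_bound:
  fixes s c :: int
  assumes p: "pencil r I x y" and S: "integral_subscheme r I" and z: "z \<in> Rn r 1" "z \<notin> I"
    and gen: "\<And>k. N0 \<le> k \<Longrightarrow> Rn r (Suc k) \<subseteq> x *o Rn r k + y *o Rn r k + z *o Rn r k + I"
    and rho: "\<And>n. N0 \<le> n \<Longrightarrow> int (pencil.rho r I x y n) = s * int n + c" and s: "0 < s"
  shows "c \<le> s"
proof (rule ccontr)
  assume cs: "\<not> c \<le> s"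
  interpret S: pencil r I x y by (rule p)
  let ?P = "pw x y" and ?A = "Rn r" and ?m = "N0" and ?N = "Suc N0"
  have zn: "nzd r I z" using prime_nzd[OF S _ z(2)] z(1) by blast
  \<comment> \<open>Otherwise \<open>x^N\<close> times degree \<open>m\<close> and
    \<open>z^(m + 1)\<close> times degree \<open>N0\<close> are independent modulo \<open>I\<close>.
    Both lie in degree \<open>m + N\<close>, so comparing slopes gives
    \<open>c \<le> s\<close>.\<close>
  have "\<exists>q f g. f \<in> ?P q (?A ?m) \<and> f \<notin> I \<and> g \<in> ?P q (?A N0) \<and> x ^ ?N * f - z ^ Suc ?m * g \<in> I"
  proof (rule ccontr)
    assume none: "\<not> ?thesis"
    have "S.F N0 q + S.F ?m q \<le> S.F (?m + ?N) q" for q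
    proof -
      let ?X = "x ^ ?N *o ?P q (?A ?m)" and ?Z = "z ^ Suc ?m *o ?P q (?A N0)"
      have pow: "u ^ k *o ?A n \<subseteq> ?A (n + k)" if "u \<in> ?A 1" for u k n
        using Rg_power[of u r k] homog_power[of u 1 k] that by (intro elt_times_Rn) auto
      have X: "?X \<subseteq> ?P q (?A (?m + ?N))"
        unfolding pw_elt_times[symmetric] using pow[OF S.xR] by (rule pw_mono)
      have Z: "?Z \<subseteq> ?P q (?A (?m + ?N))"
        unfolding pw_elt_times[symmetric] using pow[OF z(1), of "Suc ?m" N0] by (intro pw_mono) (simp add: add.commute)
      have "pm.rd ?X (?Z + I) = pm.rd (?P q (?A ?m)) I"
        unfolding elt_times_image[of "x ^ ?N"]
      proof (rule rd_image[OF mult_linear S.sP S.sI S.sxPI])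
        fix v assume v: "v \<in> ?P q (?A ?m)"
        show "x ^ ?N * v \<in> ?Z + I \<longleftrightarrow> v \<in> I"
        proof
          assume "x ^ ?N * v \<in> ?Z + I"
          then obtain g i where gi: "g \<in> ?P q (?A N0)" "i \<in> I" "x ^ ?N * v = z ^ Suc ?m * g + i"
            by (auto simp: set_plus_def elt_set_times_def)
          then have "x ^ ?N * v - z ^ Suc ?m * g \<in> I" by simp
          then show "v \<in> I" using none v gi(1) by blast
        next
          assume "v \<in> I"
          then have "x ^ ?N * v \<in> I" using hi_mult[OF S.I] S.xR Rg_power by blast
          then show "x ^ ?N * v \<in> ?Z + I" using pm.subset_plus_right[OF S.sxP] by blast
        qed
      qed
      then have "pm.rd (?X + ?Z) I = enat (S.F N0 q) + enat (S.F ?m q)"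
        unfolding pm.rd_plus[OF S.sxP S.sxP S.sI] S.F_enat
        using rd_nzd[OF S.I nzd_power[OF zn] S.sP S.PRg] by (simp del: power_Suc)
      moreover have "pm.rd (?X + ?Z) I \<le> pm.rd (?P q (?A (?m + ?N))) I"
        using X Z by (intro pm.rd_mono_left pm.subspace_plus S.sxP S.sP S.sI pm.plus_subset)
      ultimately have "enat (S.F N0 q) + enat (S.F ?m q) \<le> enat (S.F (?m + ?N) q)" unfolding S.F_enat by simp
      then show ?thesis by simp
    qed
    note FF = this
    obtain e where e: "\<And>t. S.F (?m + ?N) t \<le> S.rho (?m + ?N) * t + e" using S.F_upper by blast
    have "(S.rho N0 + S.rho ?m) * t \<le> S.rho (?m + ?N) * t + e" for t
      using FF[of t] e[of t] S.F_lower[of N0 t] S.F_lower[of ?m t] by (simp add: distrib_right)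
    then have "S.rho N0 + S.rho ?m \<le> S.rho (?m + ?N)" by (rule slope_le)
    then have "int (S.rho N0) + int (S.rho ?m) \<le> int (S.rho (?m + ?N))" by simp
    then have "s * int N0 + c + (s * int ?m + c) \<le> s * int (?m + ?N) + c" using rho by simp
    then show False using cs by (simp add: algebra_simps)
  qed
  then obtain q f g where f: "f \<in> ?P q (?A ?m)" "f \<notin> I" and g: "g \<in> ?P q (?A N0)"
    and fg: "x ^ ?N * f - z ^ Suc ?m * g \<in> I" by blast
  define i where "i = x ^ ?N * f - z ^ Suc ?m * g"
  have i: "i \<in> I" "x ^ ?N * f = z ^ Suc ?m * g + i" using fg by (simp_all add: i_def)
  have fR: "f \<in> Rg r" and gR: "g \<in> Rg r" using f g S.PRg by blast+
  \<comment> \<open>\<open>L\<close> is chosen so that a monomial of degree \<open>L\<close> in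
    \<open>x\<close>, \<open>y\<close>, \<open>z\<close> has more than \<open>m + 1\<close> factors
    \<open>z\<close> or at least \<open>N\<close> factors among \<open>x\<close> and
    \<open>y\<close>. \<open>M1\<close> is one less than \<open>N0 + L\<close>.\<close>
  let ?L = "?N + Suc ?m" and ?M1 = "N0 + ?N + ?m"
  define T where "T t = z ^ Suc ?m *o ?P (t + q + ?L) (?A ?M1) + I" for t
  have sT: "pm.subspace (T t)" for t unfolding T_def by (rule S.sxPI)
  have IT: "I \<subseteq> T t" for t unfolding T_def by (rule pm.subset_plus_right[OF S.sxP])
  \<comment> \<open>By the generation hypothesis these elements together with \<open>I\<close> span
    degree \<open>N0 + l\<close>.\<close>
  define G where "G l = {x ^ a * y ^ b * z ^ c * w |a b c w. a + b + c = l \<and> w \<in> ?A N0}" for l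
  have gen_span: "?A (N0 + l) \<subseteq> D" if "pm.subspace D" "I \<subseteq> D" "G l \<subseteq> D" for l D
    using that
  proof (induction l arbitrary: D)
    case 0
    have "w \<in> G 0" if "w \<in> ?A N0" for w
      unfolding G_def using that by (intro CollectI exI[of _ 0] exI[of _ w]) simp
    then show ?case using 0 by auto
  next
    case (Suc l)
    have up: "u *o ?A (N0 + l) \<subseteq> D" if u: "u \<in> Rg r" and uG: "\<And>v. v \<in> G l \<Longrightarrow> u * v \<in> G (Suc l)" for u
    proof -
      have "?A (N0 + l) \<subseteq> {v. u * v \<in> D}"
      proof (rule Suc.IH)
        show "pm.subspace {v. u * v \<in> D}"
          using Suc.prems(1) by (auto simp: pm.subspace_def distrib_left smul_mult_right)
        show "I \<subseteq> {v. u * v \<in> D}" using hi_mult[OF S.I _ u] Suc.prems(2) by blast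
        show "G l \<subseteq> {v. u * v \<in> D}" using uG Suc.prems(3) by blast
      qed
      then show ?thesis by (auto simp: elt_set_times_def)
    qed
    have "x * v \<in> G (Suc l) \<and> y * v \<in> G (Suc l) \<and> z * v \<in> G (Suc l)" if vG: "v \<in> G l" for v
    proof -
      obtain a b c w where w: "v = x ^ a * y ^ b * z ^ c * w" "a + b + c = l" "w \<in> ?A N0"
        using vG unfolding G_def by blast
      have "x * v = x ^ Suc a * y ^ b * z ^ c * w" "y * v = x ^ a * y ^ Suc b * z ^ c * w"
        "z * v = x ^ a * y ^ b * z ^ Suc c * w" unfolding w(1) by (simp_all add: ac_simps)
      moreover have "Suc a + b + c = Suc l" "a + Suc b + c = Suc l" "a + b + Suc c = Suc l" using w by auto
      ultimately show ?thesis unfolding G_def using w(3) by blast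
    qed
    then have "x *o ?A (N0 + l) \<subseteq> D" "y *o ?A (N0 + l) \<subseteq> D" "z *o ?A (N0 + l) \<subseteq> D"
      using up S.xR S.y z(1) by blast+
    then have "x *o ?A (N0 + l) + y *o ?A (N0 + l) + z *o ?A (N0 + l) + I \<subseteq> D"
      using Suc.prems by (intro pm.plus_subset) auto
    then show ?case using gen[of "N0 + l"] by auto
  qed
  have "f * x ^ ?L * v \<in> T 0" if vG: "v \<in> G ?L" for v
  proof -
    obtain a b e w where w: "v = x ^ a * y ^ b * z ^ e * w" "a + b + e = ?L" "w \<in> ?A N0"
      using vG unfolding G_def by blast
    have ze: "z ^ k * w \<in> ?P 0 (?A (k + N0))" for k
      using Rn_mult[of "z ^ k" r k w N0] Rg_power[of z r k] homog_power[of z 1 k] z(1) w(3) by auto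
    have zT: "z ^ Suc ?m * u \<in> z ^ Suc ?m *o ?P (0 + q + ?L) (?A ?M1)" if "u \<in> ?P (k + l) (?A j)" "k = q + ?L" "j + l = ?M1" for u k l j
      using pw_shift[OF S.xR S.y, of k l j] that by auto
    have vR: "v \<in> Rg r" unfolding w(1) using w(3) S.xR S.y z(1) by (intro Rg_mult Rg_power) auto
    show ?thesis
    proof (cases "e \<le> Suc ?m")
      \<comment> \<open>Few factors \<open>z\<close>: the relation replaces \<open>x^N f\<close> by
        \<open>z^(m + 1) g\<close>, and the remaining factors \<open>x\<close>, \<open>y\<close>
        still supply pencil degree \<open>q + L\<close>.\<close>
      case True
      have h: "x ^ (Suc ?m + a) * y ^ b \<in> ?P (Suc ?m + a + b) (?A 0)" by (rule monomial_pw[OF S.xR S.y])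
      have h2: "x ^ (Suc ?m + a) * y ^ b * (z ^ e * w) \<in> ?P (Suc ?m + a + b + 0) (?A (0 + (e + N0)))"
        by (rule pw_mult[OF Rn_subspace Rn_mult h ze[of e]])
      have "g * (x ^ (Suc ?m + a) * y ^ b * (z ^ e * w)) \<in> ?P (q + (Suc ?m + a + b + 0)) (?A (N0 + (0 + (e + N0))))"
        by (rule pw_mult[OF Rn_subspace Rn_mult g h2])
      moreover have "q + (Suc ?m + a + b + 0) = (q + ?L) + (Suc ?m - e)" using w(2) True by linarith
      ultimately have "g * (x ^ (Suc ?m + a) * y ^ b * (z ^ e * w)) \<in> ?P ((q + ?L) + (Suc ?m - e)) (?A (N0 + (e + N0)))"
        by (simp only: add_0)
      from zT[OF this refl] True
      have 1: "z ^ Suc ?m * (g * (x ^ (Suc ?m + a) * y ^ b * (z ^ e * w))) \<in> z ^ Suc ?m *o ?P (0 + q + ?L) (?A ?M1)"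
        by (simp del: power_Suc pw.simps)
      have "f * x ^ ?L * v = x ^ Suc ?m * (x ^ ?N * f) * v" unfolding power_add by (simp only: ac_simps)
      also have "\<dots> = z ^ Suc ?m * (g * (x ^ (Suc ?m + a) * y ^ b * (z ^ e * w))) + x ^ Suc ?m * v * i"
        unfolding i(2) w(1) power_add[of x "Suc ?m" a] by (simp only: distrib_left distrib_right ac_simps)
      also have "\<dots> \<in> T 0" unfolding T_def
        using 1 hi_mult[OF S.I i(1), of "x ^ Suc ?m * v"] Rg_mult[OF Rg_power vR, of x "Suc ?m"] S.xR by blast
      finally show ?thesis .
    next
      \<comment> \<open>Many factors \<open>z\<close>: the monomial itself provides
        \<open>z^(m + 1)\<close>.\<close>
      case False
      have h: "x ^ (?L + a) * y ^ b \<in> ?P (?L + a + b) (?A 0)" by (rule monomial_pw[OF S.xR S.y])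
      have h2: "x ^ (?L + a) * y ^ b * (z ^ (e - Suc ?m) * w) \<in> ?P (?L + a + b + 0) (?A (0 + ((e - Suc ?m) + N0)))"
        by (rule pw_mult[OF Rn_subspace Rn_mult h ze[of "e - Suc ?m"]])
      have "f * (x ^ (?L + a) * y ^ b * (z ^ (e - Suc ?m) * w)) \<in> ?P (q + (?L + a + b + 0)) (?A (?m + (0 + ((e - Suc ?m) + N0))))"
        by (rule pw_mult[OF Rn_subspace Rn_mult f(1) h2])
      moreover have "q + (?L + a + b + 0) = (q + ?L) + (a + b)" by simp
      ultimately have "f * (x ^ (?L + a) * y ^ b * (z ^ (e - Suc ?m) * w)) \<in> ?P ((q + ?L) + (a + b)) (?A (?m + (0 + ((e - Suc ?m) + N0))))"
        by (simp only:)
      from zT[OF this refl] False w(2)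
      have 1: "z ^ Suc ?m * (f * (x ^ (?L + a) * y ^ b * (z ^ (e - Suc ?m) * w))) \<in> z ^ Suc ?m *o ?P (0 + q + ?L) (?A ?M1)"
        by (simp del: power_Suc pw.simps)
      have "z ^ e = z ^ Suc ?m * z ^ (e - Suc ?m)" using False by (simp add: power_add[symmetric] del: power_Suc)
      then have "f * x ^ ?L * v = z ^ Suc ?m * (f * (x ^ (?L + a) * y ^ b * (z ^ (e - Suc ?m) * w)))"
        unfolding w(1) power_add[of x ?L a] by (simp only: ac_simps)
      then have "f * x ^ ?L * v \<in> z ^ Suc ?m *o ?P (0 + q + ?L) (?A ?M1)" using 1 by (simp only:)
      then show ?thesis unfolding T_def by (rule subsetD[OF pm.subset_plus_left[OF S.sI]])
    qed
  qed
  then have "?A (N0 + ?L) \<subseteq> {v. f * x ^ ?L * v \<in> T 0}"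
  proof (intro gen_span)
    show "pm.subspace {v. f * x ^ ?L * v \<in> T 0}"
      using sT[of 0] by (auto simp: pm.subspace_def distrib_left smul_mult_right)
    show "I \<subseteq> {v. f * x ^ ?L * v \<in> T 0}"
    proof
      fix v assume "v \<in> I"
      moreover have "x \<in> Rg r" using S.xR by blast
      then have "f * x ^ ?L \<in> Rg r" by (intro Rg_mult fR Rg_power)
      ultimately have "f * x ^ ?L * v \<in> I" by (rule hi_mult[OF S.I])
      then show "v \<in> {v. f * x ^ ?L * v \<in> T 0}" using IT[of 0] by blast
    qed
  qed auto
  then have "(f * x ^ ?L) *o ?A (N0 + ?L) \<subseteq> T 0" by (auto simp: elt_set_times_def)
  then have sub: "(f * x ^ ?L) *o ?P t (?A (N0 + ?L)) \<subseteq> T t" for t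
  proof -
    have "(f * x ^ ?L) *o ?P t (?A (N0 + ?L)) \<subseteq> ?P t (T 0)"
      unfolding pw_elt_times[symmetric] by (rule pw_mono) fact
    also have "\<dots> \<subseteq> T t"
      unfolding T_def pw_plus pw_elt_times pw_pw using pw_ideal[OF S.I, of x y t] S.xR S.y
      by (intro set_plus_mono2) (auto simp: add.assoc)
    finally show ?thesis .
  qed
  have fx: "nzd r I (f * x ^ ?L)" using prime_nzd[OF S fR f(2)] S.x_nzd by (intro nzd_mult nzd_power)
  have "S.F (N0 + ?L) t \<le> S.F ?M1 (t + (q + ?L)) + 0" for t
  proof -
    have "enat (S.F (N0 + ?L) t) = pm.rd ((f * x ^ ?L) *o ?P t (?A (N0 + ?L))) I"
      unfolding S.F_enat by (rule rd_nzd[OF S.I fx S.sP S.PRg, symmetric])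
    also have "\<dots> \<le> pm.rd (T t) I" by (intro pm.rd_mono_left S.sxP sT S.sI sub)
    also have "\<dots> = pm.rd (z ^ Suc ?m *o ?P (t + q + ?L) (?A ?M1)) I"
    proof (rule pm.rd_cong_left[OF sT S.sxP S.sI])
      show "z ^ Suc ?m *o ?P (t + q + ?L) (?A ?M1) \<subseteq> T t + I"
        using pm.subset_plus_left[OF S.sI] unfolding T_def by blast
    qed (simp add: T_def)
    also have "\<dots> = enat (S.F ?M1 (t + q + ?L))"
      unfolding S.F_enat by (rule rd_nzd[OF S.I nzd_power[OF zn] S.sP S.PRg])
    finally show ?thesis by (simp add: add.assoc)
  qed
  \<comment> \<open>So the slope does not grow from degree \<open>M1\<close> to
    \<open>M1 + 1\<close>, although it should grow by \<open>s\<close>.\<close>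
  then have "S.rho (N0 + ?L) \<le> S.rho ?M1" by (rule S.rho_leI)
  then have "int (S.rho (N0 + ?L)) \<le> int (S.rho ?M1)" by simp
  then have "s * int (N0 + ?L) + c \<le> s * int ?M1 + c" using rho[of "N0 + ?L"] rho[of ?M1] by simp
  then have "s * int (N0 + ?L) \<le> s * int ?M1" by simp
  then have "int (N0 + ?L) \<le> int ?M1" using s by (simp add: mult_le_cancel_left)
  then show False by simp
qed

section \<open>The bound on the genus in terms of Hilbert functions\<close>

text \<open>A pause is permanent, so a pause below the final value \<open>d\<close> is
  impossible.\<close>

lemma seq_reach:
  fixes h :: "nat \<Rightarrow> nat"
  assumes mono: "\<And>n. h n \<le> h (Suc n)" and st: "\<And>n. h (Suc n) = h n \<Longrightarrow> h (Suc (Suc n)) = h (Suc n)"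
    and ev: "\<And>n. N \<le> n \<Longrightarrow> h n = d"
  shows "h n \<le> d" and "min d (Suc (h n)) \<le> h (Suc n)"
proof -
  have "h n \<le> h (n + N)" by (rule lift_Suc_mono_le[of h, OF mono]) simp
  then show "h n \<le> d" using ev[of "n + N"] by simp
  show "min d (Suc (h n)) \<le> h (Suc n)"
  proof (cases "h (Suc n) = h n")
    case True
    have "h (Suc (n + k)) = h (n + k) \<and> h (n + k) = h n" for k
      by (induction k) (use True st in auto)
    from this[of N] have "h n = d" using ev[of "n + N"] by simp
    then show ?thesis using True by simp
  next
    case False
    then show ?thesis using mono[of n] by simp
  qed
qed

lemma sum_max_triangle:
  fixes E :: int
  assumes "0 \<le> E"
  shows "2 * (\<Sum>k<n. max 0 (E - 1 - int k)) \<le> E * (E - 1)"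
proof -
  \<comment> \<open>The subtracted product is the part of the triangle not yet summed; it is never
    negative.\<close>
  have "2 * (\<Sum>k<n. max 0 (E - 1 - int k)) = E * (E - 1) - max 0 (E - int n) * (max 0 (E - int n) - 1)"
  proof (induction n)
    case 0
    then show ?case using assms by simp
  next
    case (Suc n)
    show ?case
    proof (cases "E - int n \<ge> 1")
      case True
      then have m: "max 0 (E - int n) = E - int n" "max 0 (E - 1 - int n) = E - int n - 1"
        "max 0 (E - int (Suc n)) = E - int n - 1" by auto
      show ?thesis using Suc unfolding sum.lessThan_Suc m by (simp add: algebra_simps)
    next
      case False
      then have m: "max 0 (E - int n) = 0" "max 0 (E - 1 - int n) = 0" "max 0 (E - int (Suc n)) = 0" by auto
      show ?thesis using Suc unfolding sum.lessThan_Suc m by simp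
    qed
  qed
  moreover have "0 \<le> m * (m - 1)" if "0 \<le> m" for m :: int
    using that by (cases "m = 0") auto
  ultimately show ?thesis by simp
qed

lemma sum_descending:
  fixes g :: "nat \<Rightarrow> int"
  assumes "0 \<le> E" "g 0 \<le> E" "\<And>k. g (Suc k) \<le> max 0 (g k - 1)"
  shows "2 * (\<Sum>k<n. g (Suc k)) \<le> E * (E - 1)"
proof -
  have g: "g k \<le> max 0 (E - int k)" for k
  proof (induction k)
    case (Suc k)
    then show ?case using assms(3)[of k] by simp
  qed (use assms in simp)
  have "g (Suc k) \<le> max 0 (E - 1 - int k)" for k using g[of "Suc k"] by simp
  then have "(\<Sum>k<n. g (Suc k)) \<le> (\<Sum>k<n. max 0 (E - 1 - int k))" by (intro sum_mono)
  then show ?thesis using sum_max_triangle[OF assms(1), of n] by linarith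
qed

lemma Rn_Suc_in_ideal:
  assumes K: "homogeneous_ideal r K" and "Rn r n \<subseteq> K"
  shows "Rn r (Suc n) \<subseteq> K"
proof -
  have "(\<Sum>i\<le>r. var i *o Rn r n) \<subseteq> K"
    using assms(2) hi_mult[OF K _ Rg_var]
    by (intro pm.set_sum_subset hi_subspace[OF K]) (auto simp: elt_set_times_def)
  then show ?thesis using Rn_Suc_subset by blast
qed

text \<open>Applied once per section, this expresses a form through the linear forms that cut the
  sections.\<close>

lemma peel:
  assumes K: "homogeneous_ideal r K" and u: "u \<in> Rn r 1" and v: "v \<in> Rn r (Suc k)" "v \<in> adj r K u"
  obtains g w where "g \<in> Rn r k" "w \<in> K" "w \<in> homog (Suc k)" "v = u * g + w"
proof -
  obtain i g where "i \<in> K \<inter> homog (Suc k)" "v = i + u * g" "g \<in> Rn r (Suc k - 1)"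
    using adj_homog_elim[OF K u v(2), of "Suc k"] v(1) by (metis IntD2 One_nat_def Suc_le_mono le0)
  then show thesis using that[of g i] by (auto simp: add.commute)
qed

text \<open>Saturating the section can only lower its Hilbert function, and changes nothing in high
  degrees: hence an inequality always and an equality eventually.\<close>

lemma section_props:
  assumes K: "homogeneous_ideal r K" and u: "regular r K u"
  defines "L \<equiv> saturation r (adj r K u)"
  shows "homogeneous_ideal r L" "saturation r L = L" "K \<subseteq> L" "u \<in> L"
    "hf r K n + hf r L (Suc n) \<le> hf r K (Suc n)"
    "\<exists>n0. \<forall>n\<ge>n0. hf r K (Suc n) = hf r K n + hf r L (Suc n) \<and> L \<inter> homog n \<subseteq> adj r K u"
proof -
  have uR: "u \<in> Rn r 1" using u by (simp add: regular_def)
  have A: "homogeneous_ideal r (adj r K u)" by (rule adj_hi[OF K uR])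
  show L: "homogeneous_ideal r L" unfolding L_def by (rule saturation_hi[OF A])
  show "saturation r L = L" unfolding L_def by (rule saturation_idem[OF A])
  have AL: "adj r K u \<subseteq> L" unfolding L_def by (rule saturation_mono[OF A])
  then show "K \<subseteq> L" "u \<in> L" using adj_mono[of K r u] adj_self[OF K, of u] by blast+
  show "hf r K n + hf r L (Suc n) \<le> hf r K (Suc n)"
    using hf_regular[OF K u, of n] hf_mono[OF A L, of "Suc n"] AL by auto
  obtain n0 where n0: "\<And>n. n0 \<le> n \<Longrightarrow> L \<inter> homog n \<subseteq> adj r K u"
    using saturation_high_degree[OF A] unfolding L_def by blast
  then have "hf r (adj r K u) (Suc n) = hf r L (Suc n)" if "n0 \<le> n" for n
    using hf_eq_iff[OF A L AL, of "Suc n"] that by simp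
  then show "\<exists>n0. \<forall>n\<ge>n0. hf r K (Suc n) = hf r K n + hf r L (Suc n) \<and> L \<inter> homog n \<subseteq> adj r K u"
    using hf_regular[OF K u] n0 by metis
qed

lemma adj_eventually_whole:
  assumes K: "homogeneous_ideal r K" and u: "regular r K u" and c: "\<And>n. N \<le> n \<Longrightarrow> hf r K n = c"
  shows "N \<le> n \<Longrightarrow> Rn r (Suc n) \<subseteq> adj r K u"
proof -
  assume "N \<le> n"
  then have "hf r (adj r K u) (Suc n) = 0" using hf_regular[OF K u, of n] c[of n] c[of "Suc n"] by simp
  then show ?thesis using hf_zero_iff[OF adj_hi[OF K, of u 1]] u by (simp add: regular_def)
qed

text \<open>Once the section by \<open>u\<close> is empty in some degree, it stays empty; so the
  Hilbert function gains at least one per degree until it reaches the number \<open>c\<close> of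
  points.\<close>

lemma points_growth:
  assumes K: "homogeneous_ideal r K" and u: "regular r K u" and c: "\<And>n. N \<le> n \<Longrightarrow> hf r K n = c" and c0: "0 < c"
  shows "hf r K n \<le> c" "min c (Suc n) \<le> hf r K n" "c \<le> n \<Longrightarrow> Rn r n \<subseteq> adj r K u"
proof -
  have A: "homogeneous_ideal r (adj r K u)" using adj_hi[OF K, of u 1] u by (simp add: regular_def)
  have mono: "hf r K n \<le> hf r K (Suc n)" for n using hf_regular[OF K u, of n] by simp
  have st: "hf r K (Suc (Suc n)) = hf r K (Suc n)" if "hf r K (Suc n) = hf r K n" for n
  proof -
    have "hf r (adj r K u) (Suc n) = 0" using that hf_regular[OF K u, of n] by simp
    then have "hf r (adj r K u) (Suc (Suc n)) = 0"
      using Rn_Suc_in_ideal[OF A] by (simp add: hf_zero_iff[OF A])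
    then show ?thesis using hf_regular[OF K u, of "Suc n"] by simp
  qed
  note reach = seq_reach[of "hf r K" N c, OF mono st c]
  show le: "hf r K n \<le> c" for n by (rule reach(1))
  have "1 \<notin> K"
  proof
    assume "1 \<in> K"
    then have "Rn r N \<subseteq> K" using hi_mult[OF K, of 1] by auto
    then have "hf r K N = 0" using hf_zero_iff[OF K] by blast
    then show False using c[of N] c0 by simp
  qed
  then have h0: "hf r K 0 = 1" by (rule hf_0[OF K])
  show ge: "min c (Suc n) \<le> hf r K n" for n
  proof (induction n)
    case (Suc n)
    then show ?case using reach(2)[of n] by linarith
  qed (use h0 c0 in simp)
  assume "c \<le> n"
  then obtain k where k: "n = Suc k" using c0 by (cases n) auto
  have "hf r K k = c" "hf r K (Suc k) = c" using ge[of k] ge[of "Suc k"] le[of k] le[of "Suc k"] \<open>c \<le> n\<close> k by auto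
  then have "hf r (adj r K u) (Suc k) = 0" using hf_regular[OF K u, of k] by simp
  then show "Rn r n \<subseteq> adj r K u" unfolding k hf_zero_iff[OF A] .
qed

text \<open>
  Castelnuovo's argument: once \<open>n\<close> reaches the number of points, equality of the ideals of the
  section in degree \<open>n\<close> propagates to degree \<open>n + 1\<close>.
\<close>

lemma castelnuovo_step:
  assumes K: "homogeneous_ideal r K" and A: "homogeneous_ideal r A" "A \<subseteq> K" and z: "regular r K z"
    and whole: "Rn r n \<subseteq> adj r K z" and eq: "K \<inter> homog n \<subseteq> A" and n: "0 < n"
  shows "K \<inter> homog (Suc n) \<subseteq> A"
proof -
  have zR: "z \<in> Rn r 1" using z by (simp add: regular_def)
  have z': "z \<in> Rg r" "z \<in> homog 1" using zR by auto
  obtain l where l: "n = Suc l" using n by (cases n) auto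
  have sZ: "pm.subspace (z *o Rn r n)" by (intro elt_times_subspace Rn_subspace)
  \<comment> \<open>Write a form of degree \<open>n\<close> as a multiple of \<open>z\<close> plus
    an element of \<open>K\<close>; the latter lies in \<open>A\<close> by hypothesis, and
    multiplying by variables moves up one degree.\<close>
  have "Rn r (Suc n) \<subseteq> A + z *o Rn r n"
  proof -
    have "var k *o Rn r n \<subseteq> A + z *o Rn r n" if k: "k \<le> r" for k
    proof
      fix v assume "v \<in> var k *o Rn r n"
      then obtain f where f: "f \<in> Rn r n" "v = var k * f" by (auto simp: elt_set_times_def)
      obtain g w where g: "g \<in> Rn r l" "w \<in> K" "w \<in> homog (Suc l)" "f = z * g + w"
        using peel[OF K zR, of f l] f(1) whole unfolding l by blast
      have "w \<in> A" using g eq l by blast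
      then have "var k * w \<in> A" using hi_mult[OF A(1) _ Rg_var[OF k]] by blast
      moreover have "var k * g \<in> Rn r n" using Rn_mult[OF Rn_var[OF k] g(1)] l by simp
      then have "z * (var k * g) \<in> z *o Rn r n" by blast
      moreover have "v = var k * w + z * (var k * g)" using f(2) g(4) by (simp add: algebra_simps)
      ultimately show "v \<in> A + z *o Rn r n" by blast
    qed
    then have "(\<Sum>k\<le>r. var k *o Rn r n) \<subseteq> A + z *o Rn r n"
      by (intro pm.set_sum_subset pm.subspace_plus hi_subspace[OF A(1)] sZ) auto
    then show ?thesis using Rn_Suc_subset by blast
  qed
  note cover = this
  show ?thesis
  proof
    fix f assume f: "f \<in> K \<inter> homog (Suc n)"
    then have "f \<in> Rn r (Suc n)" using hi_Rg[OF K] by blast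
    then obtain a h where ah: "a \<in> A" "h \<in> Rn r n" "f = a + z * h"
      using cover by (auto simp: set_plus_def elt_set_times_def)
    have "z * h = f - a" using ah by simp
    also have "\<dots> \<in> K" using f ah(1) A(2) by (intro hi_diff[OF K]) auto
    finally have "z * h \<in> K" .
    then have "h \<in> K" using z ah(2) unfolding regular_def by blast
    then have "h \<in> A" using ah(2) eq by blast
    then have "z * h \<in> A" using hi_mult[OF A(1) _ z'(1)] by blast
    then show "f \<in> A" using ah hi_add[OF A(1)] by blast
  qed
qed

text \<open>For \<open>d = s m + \<rho>\<close> the main terms agree with the quadratic bound up to
  an expression in the remainder \<open>\<rho>\<close>, at most \<open>s\<close>. This and the
  errors \<open>e\<close> and \<open>t\<close> are absorbed by \<open>s^4\<close>.\<close>

lemma final_estimate: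
  fixes s m \<rho> \<pi> e t :: real
  assumes s: "1 \<le> s" and \<rho>: "0 < \<rho>" "\<rho> \<le> s" and \<pi>: "1 - s \<le> \<pi>"
    and e: "e \<le> (s - 1) * (s * (s - 1) / 2) + (s * (s - 1) / 2)\<^sup>2 / 2" and t: "t \<le> (s * (s - 1) / 2)\<^sup>2 / 2"
  shows "(s * m + \<rho>) * m - s * m * (m + 1) / 2 - m * (1 - \<pi>) + e + t
    \<le> (s * m + \<rho>)\<^sup>2 / (2 * s) + (s * m + \<rho>) / (2 * s) * (2 * \<pi> - 2 - s) + s ^ 4"
proof -
  have id: "(s * m + \<rho>)\<^sup>2 / (2 * s) + (s * m + \<rho>) / (2 * s) * (2 * \<pi> - 2 - s)
    = (s * m + \<rho>) * m - s * m * (m + 1) / 2 - m * (1 - \<pi>) - (\<rho> * (s - \<rho>) + 2 * \<rho> * (1 - \<pi>)) / (2 * s)"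
    using s by (simp add: field_simps power2_eq_square)
  have "(\<rho> * (s - \<rho>) + 2 * \<rho> * (1 - \<pi>)) / (2 * s) \<le> s"
  proof -
    have "2 * \<rho> * (1 - \<pi>) \<le> 2 * \<rho> * s" using \<rho> \<pi> by (intro mult_left_mono) auto
    moreover have "0 \<le> (s - \<rho>) * (2 * s - \<rho>)" using \<rho> s by (intro mult_nonneg_nonneg) auto
    ultimately have "\<rho> * (s - \<rho>) + 2 * \<rho> * (1 - \<pi>) \<le> s * (2 * s)" by (simp add: algebra_simps)
    then show ?thesis using s by (simp add: divide_le_eq)
  qed
  moreover have "(s - 1) * (s * (s - 1) / 2) + (s * (s - 1) / 2)\<^sup>2 + s \<le> s ^ 4"
  proof -
    have "s ^ 4 - ((s - 1) * (s * (s - 1) / 2) + (s * (s - 1) / 2)\<^sup>2 + s)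
      = s * (s - 1) * (3 / 4 * s\<^sup>2 + 3 / 4 * s + 3 / 2)"
      by (simp add: field_simps power2_eq_square power4_eq_xxxx)
    also have "\<dots> \<ge> 0" using s by (intro mult_nonneg_nonneg add_nonneg_nonneg) auto
    finally show ?thesis by simp
  qed
  ultimately show ?thesis unfolding id using e t by simp
qed

theorem genus_bound:
  fixes s d :: nat and \<pi> pa :: int
  assumes S: "integral_subscheme r I" and J: "homogeneous_ideal r J" "saturation r J = J" and IJ: "I \<subseteq> J"
    and hS: "\<And>n. n0 \<le> n \<Longrightarrow> int (hf r I (Suc n)) = int (hf r I n) + int s * int (Suc n) + 1 - \<pi>"
    and hJ: "\<And>n. n0 \<le> n \<Longrightarrow> int (hf r J n) = int d * int n + 1 - pa"
    and s: "0 < s" and d: "0 < d"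
  shows "real_of_int pa \<le> (real d)\<^sup>2 / (2 * real s) + real d / (2 * real s) * (2 * real_of_int \<pi> - 2 - real s) + real s ^ 4"
proof -
  note I = integral_subschemeD(1)[OF S] and Isat = integral_subschemeD(2)[OF S]
  obtain x where x: "regular r I x" "regular r J x" using exists_regular[OF I Isat J] by blast
  \<comment> \<open>\<open>Sg\<close> and \<open>Gm\<close> are the sections of \<open>S\<close> and
    \<open>C\<close> by \<open>x\<close>; below, \<open>Lm\<close> consists of \<open>s\<close>
    points cut out of \<open>S\<close> by \<open>x\<close> and \<open>y\<close>.\<close>
  define Sg where "Sg = saturation r (adj r I x)"
  define Gm where "Gm = saturation r (adj r J x)"
  note Sg = section_props[OF I x(1), folded Sg_def] and Gm = section_props[OF J(1) x(2), folded Gm_def]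
  obtain y where y: "regular r Sg y" "regular r Gm y" using exists_regular[OF Sg(1,2) Gm(1,2)] by blast
  define Lm where "Lm = saturation r (adj r Sg y)"
  note Lm = section_props[OF Sg(1) y(1), folded Lm_def]
  obtain z where z: "regular r Lm z" using exists_regular[OF Lm(1,2) Lm(1,2)] by blast
  have xR: "x \<in> Rn r 1" and yR: "y \<in> Rn r 1" and zR: "z \<in> Rn r 1" using x y z by (auto simp: regular_def)
  obtain n1 where n1: "\<And>n. n1 \<le> n \<Longrightarrow> hf r I (Suc n) = hf r I n + hf r Sg (Suc n)" "\<And>n. n1 \<le> n \<Longrightarrow> Sg \<inter> homog n \<subseteq> adj r I x"
    using Sg(6) by blast
  obtain n2 where n2: "\<And>n. n2 \<le> n \<Longrightarrow> hf r J (Suc n) = hf r J n + hf r Gm (Suc n)" "\<And>n. n2 \<le> n \<Longrightarrow> Gm \<inter> homog n \<subseteq> adj r J x"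
    using Gm(6) by blast
  obtain n3 where n3: "\<And>n. n3 \<le> n \<Longrightarrow> hf r Sg (Suc n) = hf r Sg n + hf r Lm (Suc n)" "\<And>n. n3 \<le> n \<Longrightarrow> Lm \<inter> homog n \<subseteq> adj r Sg y"
    using Lm(6) by blast
  define N where "N = Suc (Suc (max n0 (max n1 (max n2 n3))))"
  have Nmax: "n0 < N" "n1 < N" "n2 < N" "n3 < N" by (auto simp: N_def)
  have hSg: "int (hf r Sg n) = int s * int n + 1 - \<pi>" if nN: "N \<le> Suc n" for n
  proof -
    obtain k where k: "n = Suc k" using nN by (cases n) (auto simp: N_def)
    then show ?thesis using hS[of k] n1(1)[of k] nN by (simp add: N_def)
  qed
  have hLm: "hf r Lm n = s" if nN: "N \<le> n" for n
  proof -
    obtain k where k: "n = Suc k" using nN by (cases n) (auto simp: N_def)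
    have "int (hf r Sg (Suc k)) = int (hf r Sg k) + int (hf r Lm (Suc k))"
      using n3(1)[of k] nN k by (simp add: N_def)
    then show ?thesis using hSg[of k] hSg[of "Suc k"] nN k by (simp add: algebra_simps)
  qed
  have hGm: "hf r Gm n = d" if nN: "N \<le> n" for n
  proof -
    obtain k where k: "n = Suc k" using nN by (cases n) (auto simp: N_def)
    have "int (hf r J (Suc k)) = int (hf r J k) + int (hf r Gm (Suc k))"
      using n2(1)[of k] nN k by (simp add: N_def)
    moreover have "int (hf r J (Suc k)) = int (hf r J k) + int d"
      using hJ[of k] hJ[of "Suc k"] nN k Nmax(1) by (simp add: algebra_simps)
    ultimately show ?thesis using k by simp
  qed
  have growth: "hf r Lm n \<le> s" "min s (Suc n) \<le> hf r Lm n" "s \<le> n \<Longrightarrow> Rn r n \<subseteq> adj r Lm z" for n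
    by (rule points_growth[where N = N, OF Lm(1) z hLm s]; assumption)+
  have ILm: "I \<subseteq> Lm" using Sg(3) Lm(3) by blast
  have zI: "z \<notin> I"
  proof
    assume "z \<in> I"
    then have "z * 1 \<in> Lm" using ILm by auto
    then have "1 \<in> Lm" using z Rg_one unfolding regular_def by blast
    then have "Rn r N \<subseteq> Lm" using hi_mult[OF Lm(1), of 1] by auto
    then have "hf r Lm N = 0" using hf_zero_iff[OF Lm(1)] by blast
    then show False using hLm[of N] s by simp
  qed
  interpret S: pencil r I x y by unfold_locales (use I x yR in auto)
  interpret C: pencil r J x y by unfold_locales (use J x yR in auto)
  \<comment> \<open>In high degrees everything is a multiple of \<open>z\<close> modulo the points;
    peeling off \<open>z\<close>, \<open>y\<close> and \<open>x\<close> in turn leads back to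
    \<open>I\<close>.\<close>
  have genS: "Rn r (Suc k) \<subseteq> x *o Rn r k + y *o Rn r k + z *o Rn r k + I" if k: "N \<le> k" for k
  proof
    fix v assume v: "v \<in> Rn r (Suc k)"
    have "v \<in> adj r Lm z" using adj_eventually_whole[OF Lm(1) z hLm k] v by blast
    then obtain g3 w3 where 3: "g3 \<in> Rn r k" "w3 \<in> Lm" "w3 \<in> homog (Suc k)" "v = z * g3 + w3"
      using peel[OF Lm(1) zR v] by blast
    then have "w3 \<in> adj r Sg y" "w3 \<in> Rn r (Suc k)" using n3(2)[of "Suc k"] k Nmax hi_Rg[OF Lm(1)] by auto
    then obtain g2 w2 where 2: "g2 \<in> Rn r k" "w2 \<in> Sg" "w2 \<in> homog (Suc k)" "w3 = y * g2 + w2"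
      using peel[OF Sg(1) yR, of w3 k] by blast
    then have "w2 \<in> adj r I x" "w2 \<in> Rn r (Suc k)" using n1(2)[of "Suc k"] k Nmax hi_Rg[OF Sg(1)] by auto
    then obtain g1 w1 where 1: "g1 \<in> Rn r k" "w1 \<in> I" "w2 = x * g1 + w1"
      using peel[OF I xR, of w2 k] by blast
    have v: "v = x * g1 + y * g2 + z * g3 + w1" using 1 2 3 by (simp add: ac_simps)
    show "v \<in> x *o Rn r k + y *o Rn r k + z *o Rn r k + I"
      unfolding v using 1(1,2) 2(1) 3(1) by (intro set_plus_intro set_times_intro2)
  qed
  have genC: "Rn r (Suc k) \<subseteq> x *o Rn r k + y *o Rn r k + J" if k: "N \<le> k" for k
  proof
    fix v assume v: "v \<in> Rn r (Suc k)"
    have "v \<in> adj r Gm y" using adj_eventually_whole[OF Gm(1) y(2) hGm k] v by blast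
    then obtain g2 w2 where 2: "g2 \<in> Rn r k" "w2 \<in> Gm" "w2 \<in> homog (Suc k)" "v = y * g2 + w2"
      using peel[OF Gm(1) yR v] by blast
    then have "w2 \<in> adj r J x" "w2 \<in> Rn r (Suc k)" using n2(2)[of "Suc k"] k Nmax hi_Rg[OF Gm(1)] by auto
    then obtain g1 w1 where 1: "g1 \<in> Rn r k" "w1 \<in> J" "w2 = x * g1 + w1"
      using peel[OF J(1) xR, of w2 k] by blast
    have v: "v = x * g1 + y * g2 + w1" using 1 2 by (simp add: ac_simps)
    show "v \<in> x *o Rn r k + y *o Rn r k + J"
      unfolding v using 1(1,2) 2(1) by (intro set_plus_intro set_times_intro2)
  qed
  have hJd: "hf r J (Suc k) = hf r J k + d" if "N \<le> k" for k
    using hJ[of k] hJ[of "Suc k"] that Nmax(1) by (simp add: algebra_simps)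
  have rhoC: "C.rho k = d" if "N \<le> k" for k
    by (rule C.rho_of_generated[OF genC hJd that])
  note reachC = seq_reach[of C.rho N d, OF C.rho_mono C.rho_stable rhoC]
  have Sg_le: "hf r Sg n \<le> S.rho n" for n
    by (rule S.hf_le_rho[OF Sg(1,3,4) regular_nzd[OF y(1)]])
  have hadj: "hf r (adj r I x) (Suc k) = hf r I (Suc k) - hf r I k" for k
    using hf_regular[OF I x(1), of k] by simp
  \<comment> \<open>In high degrees the special section by \<open>x\<close> bounds the slope from
    both sides.\<close>
  have rhoS: "int (S.rho n) = int s * int n + (1 - \<pi>)" if n: "N \<le> n" for n
  proof -
    obtain k where k: "n = Suc k" using n by (cases n) (auto simp: N_def)
    have "int (S.rho n) \<le> int s * int n + 1 - \<pi>"
    proof -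
      have "n0 \<le> k" using n k Nmax(1) by simp
      moreover have "int (hf r I (Suc k)) = int (hf r I k) + int (hf r (adj r I x) (Suc k))"
        using hf_regular[OF I x(1), of k] by simp
      ultimately show ?thesis using S.rho_Suc_le_hf[of k] hS[of k] k by (simp add: hadj)
    qed
    then show ?thesis using Sg_le[of n] hSg[of n] n by linarith
  qed
  have pi_lower: "1 - \<pi> \<le> int s"
    by (rule rho_upper_bound[OF S.pencil_axioms S zR zI genS rhoS]) (use s in auto)
  \<comment> \<open>The deficiency of the section curve: its Hilbert polynomial minus its Hilbert
    function.\<close>
  define e where "e n = int s * int n + 1 - \<pi> - int (hf r Sg n)" for n
  have one_J: "1 \<notin> J"
  proof
    assume "1 \<in> J"
    then have "Rn r n \<subseteq> J" for n using hi_mult[OF J(1), of 1] by auto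
    then have "hf r J n = 0" for n using hf_zero_iff[OF J(1)] by blast
    then show False using hJd[of N] d by simp
  qed
  have one_Sg: "1 \<notin> Sg"
  proof
    assume "1 \<in> Sg"
    then have "1 \<in> Lm" using Lm(3) by blast
    then have "Rn r N \<subseteq> Lm" using hi_mult[OF Lm(1), of 1] by auto
    then have "hf r Lm N = 0" using hf_zero_iff[OF Lm(1)] by blast
    then show False using hLm[of N] s by simp
  qed
  have e0: "e 0 = - \<pi>" using hf_0[OF Sg(1) one_Sg] by (simp add: e_def)
  have eN: "e n = 0" if "N \<le> n" for n using hSg[of n] that by (simp add: e_def)
  have eS: "e (Suc n) \<le> e n + int s - int (hf r Lm (Suc n))" for n
    using Lm(5)[of n] by (simp add: e_def algebra_simps)
  have eS': "e (Suc n) \<le> e n + max 0 (int s - 1 - 1 - int n)" for n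
    using eS[of n] growth(2)[of "Suc n"] by linarith
  have tri: "2 * (\<Sum>k<n. max 0 (int s - 1 - 1 - int k)) \<le> (int s - 1) * (int s - 1 - 1)" for n
    using sum_max_triangle[of "int s - 1" n] s by simp
  \<comment> \<open>The deficiency starts at \<open>- \<pi>\<close> and rises by at most
    \<open>s - 2\<close>, \<open>s - 3\<close> and so on, because \<open>n + 1\<close> or all
    \<open>s\<close> of the points impose independent conditions in degree \<open>n\<close>.\<close>
  define E where "E = (int s - 1) * (int s - 1 - 1) div 2 - \<pi>"
  have ebound: "e n \<le> E" for n
  proof -
    have "e n \<le> - \<pi> + (\<Sum>k<n. max 0 (int s - 1 - 1 - int k))"
    proof (induction n)
      case (Suc n)
      then show ?case using eS'[of n] by simp
    qed (simp add: e0)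
    then show ?thesis using tri[of n] unfolding E_def by linarith
  qed
  have E0: "0 \<le> E" using ebound[of N] eN[of N] by simp
  \<comment> \<open>This is where the lower bound \<open>1 - \<pi> \<le> s\<close> enters.\<close>
  have E2: "2 * E \<le> int s * (int s - 1)"
  proof -
    have "2 * (a div 2) \<le> a" for a :: int by presburger
    then have "2 * (a div 2 - \<pi>) \<le> a + 2 * (int s - 1)" for a :: int
      using pi_lower by (smt (verit))
    from this[of "(int s - 1) * (int s - 1 - 1)"]
    have "2 * E \<le> (int s - 1) * (int s - 1 - 1) + 2 * (int s - 1)" unfolding E_def .
    then show ?thesis by (simp add: algebra_simps)
  qed
  have whole: "Rn r n \<subseteq> adj r Lm z" if "s \<le> n" for n using growth(3)[OF that] .
  have Lms: "hf r Lm n = s" if "s \<le> Suc n" for n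
    using growth(1)[of n] growth(2)[of n] that by simp
  have ASg: "homogeneous_ideal r (adj r Sg y)" "adj r Sg y \<subseteq> Lm"
    using adj_hi[OF Sg(1) yR] saturation_mono unfolding Lm_def by blast+
  \<comment> \<open>An equality makes \<open>adj r Sg y\<close> agree with the ideal of the points
    in degree \<open>n + 1\<close>; by Castelnuovo it agrees ever after, so the deficiency is
    constant, hence 0.\<close>
  have stop: "e n = 0" if n: "s \<le> Suc n" and eq: "e (Suc n) = e n" for n
  proof -
    have step: "Lm \<inter> homog (Suc n + k) \<subseteq> adj r Sg y" for k
    proof (induction k)
      case 0
      have "hf r Sg (Suc n) = hf r Sg n + hf r (adj r Sg y) (Suc n)" by (rule hf_regular[OF Sg(1) y(1)])
      then have "hf r (adj r Sg y) (Suc n) = hf r Lm (Suc n)"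
        using eq Lms[of "Suc n"] n by (simp add: e_def algebra_simps)
      then show ?case using hf_eq_iff[OF ASg(1) Lm(1) ASg(2), of "Suc n"] by simp
    next
      case (Suc k)
      have "Lm \<inter> homog (Suc (Suc n + k)) \<subseteq> adj r Sg y"
        by (rule castelnuovo_step[OF Lm(1) ASg z whole Suc]) (use n in auto)
      then show ?case by simp
    qed
    have "e (Suc n + k) = e n" for k
    proof (induction k)
      case 0
      then show ?case using eq by simp
    next
      case (Suc k)
      have "hf r Sg (Suc (Suc n + k)) = hf r Sg (Suc n + k) + hf r (adj r Sg y) (Suc (Suc n + k))"
        by (rule hf_regular[OF Sg(1) y(1)])
      moreover have "hf r (adj r Sg y) (Suc (Suc n + k)) = hf r Lm (Suc (Suc n + k))"
        using hf_eq_iff[OF ASg(1) Lm(1) ASg(2), of "Suc (Suc n + k)"] step[of "Suc k"] by simp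
      moreover have "hf r Lm (Suc (Suc n + k)) = s" using n by (intro Lms) simp
      ultimately have "e (Suc (Suc n + k)) = e (Suc n + k)" by (simp add: e_def algebra_simps)
      then show ?case using Suc by simp
    qed
    from this[of N] show ?thesis using eN[of "Suc n + N"] by simp
  qed
  have edesc: "e (Suc n) \<le> max 0 (e n - 1)" if n: "s \<le> Suc n" for n
  proof (cases "e (Suc n) = e n")
    case True
    then show ?thesis using stop[OF n] by simp
  next
    case False
    then show ?thesis using eS[of n] Lms[of "Suc n"] n by simp
  qed
  \<comment> \<open>At most \<open>s - 1\<close> terms are bounded by \<open>E\<close> each; after
    them the deficiency falls by at least one per degree until it is no longer positive.\<close>
  have esum: "2 * (\<Sum>i<m. e (Suc i)) \<le> 2 * (int s - 1) * E + E * (E - 1)" for m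
  proof (cases "m \<le> s - 1")
    case True
    have "(\<Sum>i<m. e (Suc i)) \<le> (\<Sum>i<m. E)" using ebound by (intro sum_mono) auto
    also have "\<dots> = int m * E" by simp
    also have "\<dots> \<le> (int s - 1) * E" using True E0 s by (intro mult_right_mono) auto
    moreover have "0 \<le> E * (E - 1)" using E0 by (cases "E = 0") auto
    ultimately show ?thesis by (simp add: algebra_simps)
  next
    case False
    define k where "k = m - (s - 1)"
    have m: "m = (s - 1) + k" using False by (simp add: k_def)
    have "(\<Sum>i<m. e (Suc i)) = (\<Sum>i<s - 1. e (Suc i)) + (\<Sum>i<k. e (s - 1 + Suc i))"
      unfolding m by (induction k) (simp_all add: add.assoc)
    moreover have "(\<Sum>i<s - 1. e (Suc i)) \<le> (\<Sum>i<s - 1. E)" using ebound by (intro sum_mono) auto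
    moreover have "(\<Sum>i<s - 1. E) = (int s - 1) * E" using s by (simp add: of_nat_diff)
    moreover have "2 * (\<Sum>i<k. e (s - 1 + Suc i)) \<le> E * (E - 1)"
    proof (rule sum_descending[OF E0, of "\<lambda>i. e (s - 1 + i)"])
      show "e (s - 1 + 0) \<le> E" by (rule ebound)
      show "e (s - 1 + Suc i) \<le> max 0 (e (s - 1 + i) - 1)" for i
        using edesc[of "s - 1 + i"] s by simp
    qed
    ultimately show ?thesis by (simp add: algebra_simps)
  qed
  \<comment> \<open>Dividing \<open>d - 1\<close> instead of \<open>d\<close> gives the strict
    inequality \<open>s m < d\<close> that contradicts Bezout, and a remainder between 1 and
    \<open>s\<close>.\<close>
  define m where "m = (d - 1) div s"
  define \<rho> where "\<rho> = d - s * m"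
  have "(d - 1) = s * m + (d - 1) mod s" by (simp add: m_def)
  moreover have "(d - 1) mod s < s" using s by simp
  ultimately have dm: "d = s * m + \<rho>" "0 < \<rho>" "\<rho> \<le> s" unfolding \<rho>_def using d by linarith+
  \<comment> \<open>\<open>q = 0\<close> yields equality of the Hilbert functions in degree
    \<open>m\<close>; all \<open>q\<close> together yield equality of the slopes.\<close>
  have bez: "J \<inter> pw x y q (Rn r m) \<subseteq> I" for q
  proof (rule subsetI, rule ccontr)
    fix f assume f: "f \<in> J \<inter> pw x y q (Rn r m)" "f \<notin> I"
    have "int (hf r (adj r I x) k) \<le> int s * int k + (1 - \<pi>)" if k: "N \<le> k" for k
    proof -
      obtain l where l: "k = Suc l" using k by (cases k) (auto simp: N_def)
      have "n0 \<le> l" using k l Nmax(1) by simp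
      moreover have "int (hf r I (Suc l)) = int (hf r I l) + int (hf r (adj r I x) (Suc l))"
        using hf_regular[OF I x(1), of l] by simp
      ultimately show ?thesis using hS[of l] l by simp
    qed
    then have "int d \<le> int s * int m"
      using f by (intro bezout[OF S.pencil_axioms C.pencil_axioms S IJ genC hJd, of N]) auto
    then show False using dm by (simp flip: of_nat_mult)
  qed
  have hJm: "hf r J m = hf r I m"
    using hf_eq_iff[OF I J(1) IJ, of m] bez[of 0] hi_Rg[OF J(1)] by auto
  have rhoJm: "C.rho m = S.rho m"
  proof -
    have "C.F m t = S.F m t" for t
    proof -
      have "pm.rd (pw x y t (Rn r m)) J = pm.rd (pw x y t (Rn r m)) I"
        using bez[of t] IJ by (intro pm.rd_cong hi_subspace[OF J(1)] hi_subspace[OF I] S.sP) blast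
      then show ?thesis unfolding C.F_def S.F_def dm_def by simp
    qed
    then have "C.inc m t = S.inc m t" for t using C.F_Suc[of m t] S.F_Suc[of m t] by simp
    then show ?thesis unfolding C.rho_def S.rho_def by simp
  qed
  \<comment> \<open>Since \<open>d \<le> s (m + 1)\<close>, this bounds the shortfall of
    \<open>C.rho m\<close> from \<open>d\<close>; as \<open>C.rho m = S.rho m\<close>, it can be
    estimated on \<open>S\<close>.\<close>
  define M where "M = int s * int (Suc m) - int (C.rho m)"
  have Sg_lower: "int s * int (Suc n) - int (hf r Sg n) \<le> (int s - 1) + (\<Sum>k<n. max 0 (int s - 1 - 1 - int k))" for n
  proof (induction n)
    case 0
    then show ?case using hf_0[OF Sg(1) one_Sg] by simp
  next
    case (Suc n)
    have "int s * int (Suc (Suc n)) - int (hf r Sg (Suc n)) = int s * int (Suc n) - int (hf r Sg n) + (e (Suc n) - e n)"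
      by (simp add: e_def algebra_simps)
    then show ?case using Suc eS'[of n] by simp
  qed
  have M2: "2 * M \<le> int s * (int s - 1)"
  proof -
    have "M \<le> (int s - 1) + (\<Sum>k<m. max 0 (int s - 1 - 1 - int k))"
      using Sg_lower[of m] Sg_le[of m] unfolding M_def rhoJm by linarith
    then have "2 * M \<le> 2 * (int s - 1) + 2 * (\<Sum>k<m. max 0 (int s - 1 - 1 - int k))" by simp
    also note add_left_mono[OF tri[of m]]
    finally show ?thesis by (simp add: algebra_simps)
  qed
  have dM: "int d - int (C.rho m) \<le> M"
  proof -
    have "int d \<le> int s * int (Suc m)" using dm by (simp add: algebra_simps)
    then show ?thesis by (simp add: M_def)
  qed
  have M0: "0 \<le> M" using dM reachC(1)[of m] by simp
  \<comment> \<open>Beyond degree \<open>m\<close> the shortfall drops by at least one per degree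
    until it is 0.\<close>
  have tail: "2 * (\<Sum>k<n. int d - int (C.rho (m + Suc k))) \<le> M * (M - 1)" for n
  proof (rule sum_descending[OF M0, of "\<lambda>k. int d - int (C.rho (m + k))"])
    show "int d - int (C.rho (m + 0)) \<le> M" using dM by simp
    fix k
    show "int d - int (C.rho (m + Suc k)) \<le> max 0 (int d - int (C.rho (m + k)) - 1)"
      using reachC(2)[of "m + k"] by (simp add: min_def split: if_splits)
  qed
  have hJ_step: "int (hf r J n) + int (C.rho (Suc n)) \<le> int (hf r J (Suc n))" for n
    using C.rho_Suc_le_hf[of n] hf_regular[OF J(1) x(2), of n] by simp
  have hJ_tail: "int (hf r J m) + int n * int d \<le> int (hf r J (m + n)) + (\<Sum>k<n. int d - int (C.rho (m + Suc k)))" for n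
  proof (induction n)
    case (Suc n)
    then show ?case using hJ_step[of "m + n"] by (simp add: algebra_simps)
  qed simp
  have pa: "pa \<le> int d * int m + 1 - int (hf r J m) + (\<Sum>k<N. int d - int (C.rho (m + Suc k)))"
  proof -
    \<comment> \<open>Degree \<open>m + N\<close> is large enough for the Hilbert polynomial of
      \<open>C\<close> to be valid.\<close>
    have "int (hf r J (m + N)) = int d * int m + int N * int d + 1 - pa"
      using hJ[of "m + N"] Nmax(1) by (simp add: algebra_simps)
    then show ?thesis using hJ_tail[of N] by linarith
  qed
  have hI_lower: "int (hf r I n) \<ge> 1 + (\<Sum>i<n. int s * int (Suc i) + 1 - \<pi> - e (Suc i))" for n
  proof (induction n)
    case 0
    then show ?case using hf_0[OF I integral_subschemeD(3)[OF S]] by simp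
  next
    case (Suc n)
    then show ?case using Sg(5)[of n] by (simp add: e_def)
  qed
  have sum_lin: "2 * (\<Sum>i<n. int s * int (Suc i) + 1 - \<pi> - e (Suc i))
    = int s * int n * (int n + 1) + 2 * int n * (1 - \<pi>) - 2 * (\<Sum>i<n. e (Suc i))" for n
    by (induction n) (simp_all add: algebra_simps)
  let ?e = "real_of_int (\<Sum>i<m. e (Suc i))" and ?t = "real_of_int (\<Sum>k<N. int d - int (C.rho (m + Suc k)))"
  have le_half: "real_of_int X \<le> real s * (real s - 1) / 2" if "2 * X \<le> int s * (int s - 1)" for X
  proof -
    have "real_of_int (2 * X) \<le> real_of_int (int s * (int s - 1))" using that by (simp only: of_int_le_iff)
    then show ?thesis by simp
  qed
  have sq: "real_of_int X * (real_of_int X - 1) \<le> (real s * (real s - 1) / 2)\<^sup>2" if "2 * X \<le> int s * (int s - 1)" "0 \<le> X" for X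
  proof -
    have "real_of_int X * (real_of_int X - 1) \<le> (real_of_int X)\<^sup>2" using that by (simp add: power2_eq_square algebra_simps)
    also have "\<dots> \<le> (real s * (real s - 1) / 2)\<^sup>2" using le_half[OF that(1)] that(2) by (intro power_mono) auto
    finally show ?thesis .
  qed
  have e_le: "?e \<le> (real s - 1) * (real s * (real s - 1) / 2) + (real s * (real s - 1) / 2)\<^sup>2 / 2"
  proof -
    have "real_of_int (2 * (\<Sum>i<m. e (Suc i))) \<le> real_of_int (2 * (int s - 1) * E + E * (E - 1))"
      using esum[of m] by (simp only: of_int_le_iff)
    then have "2 * ?e \<le> 2 * ((real s - 1) * real_of_int E) + real_of_int E * (real_of_int E - 1)"
      by (simp add: algebra_simps)
    moreover have "(real s - 1) * real_of_int E \<le> (real s - 1) * (real s * (real s - 1) / 2)"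
      using le_half[OF E2] s by (intro mult_left_mono) auto
    moreover have "\<lbrakk>2 * a \<le> 2 * b + c; b \<le> g; c \<le> h\<rbrakk> \<Longrightarrow> a \<le> g + h / 2" for a b c g h :: real
      by linarith
    ultimately show ?thesis using sq[OF E2 E0] by blast
  qed
  have t_le: "?t \<le> (real s * (real s - 1) / 2)\<^sup>2 / 2"
  proof -
    have "real_of_int (2 * (\<Sum>k<N. int d - int (C.rho (m + Suc k)))) \<le> real_of_int (M * (M - 1))"
      using tail[of N] by (simp only: of_int_le_iff)
    then show ?thesis using sq[OF M2 M0] by simp
  qed
  have "2 * pa \<le> 2 * (int d * int m) - int s * int m * (int m + 1) - 2 * int m * (1 - \<pi>)
      + 2 * (\<Sum>i<m. e (Suc i)) + 2 * (\<Sum>k<N. int d - int (C.rho (m + Suc k)))"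
    using pa hI_lower[of m] sum_lin[of m] unfolding hJm by linarith
  then have "real_of_int (2 * pa) \<le> real_of_int (2 * (int d * int m) - int s * int m * (int m + 1) - 2 * int m * (1 - \<pi>)
      + 2 * (\<Sum>i<m. e (Suc i)) + 2 * (\<Sum>k<N. int d - int (C.rho (m + Suc k))))"
    by (simp only: of_int_le_iff)
  then have "real_of_int pa \<le> real d * real m - real s * real m * (real m + 1) / 2 - real m * (1 - real_of_int \<pi>) + ?e + ?t"
    by (simp add: field_simps)
  also have "\<dots> \<le> (real d)\<^sup>2 / (2 * real s) + real d / (2 * real s) * (2 * real_of_int \<pi> - 2 - real s) + real s ^ 4"
  proof -
    have d_eq: "real d = real s * real m + real \<rho>" using dm(1) by (metis of_nat_add of_nat_mult)
    have "1 - real s \<le> real_of_int \<pi>" using pi_lower by linarith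
    then show ?thesis unfolding d_eq using dm s e_le t_le by (intro final_estimate) auto
  qed
  finally show ?thesis .
qed

section \<open>General hyperplanes\<close>

lemma linear_monomial:
  assumes "m \<in> monomials r 1"
  shows "\<exists>j\<le>r. m = Poly_Mapping.single j 1"
proof -
  have m: "Poly_Mapping.keys m \<subseteq> {..r}" "(\<Sum>i\<in>Poly_Mapping.keys m. Poly_Mapping.lookup m i) = 1"
    using assms by (auto simp: monomials_def mon_deg_def)
  obtain j where j: "j \<in> Poly_Mapping.keys m" "Poly_Mapping.lookup m j = 1"
      "\<forall>b\<in>Poly_Mapping.keys m. j \<noteq> b \<longrightarrow> Poly_Mapping.lookup m b = 0"
    using m(2) unfolding sum_eq_1_iff[OF finite_keys] by blast
  have "m = Poly_Mapping.single j 1"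
    by (rule poly_mapping_eqI) (use j in \<open>auto simp: lookup_single when_def in_keys_iff\<close>)
  then show ?thesis using j(1) m(1) by auto
qed

lemma linear_form_eq:
  assumes h: "h \<in> Rn r 1"
  shows "h = (\<Sum>j\<le>r. smul (Poly_Mapping.lookup h (Poly_Mapping.single j 1)) (var j))" (is "_ = ?s")
proof (rule poly_mapping_eqI)
  fix m
  show "Poly_Mapping.lookup h m = Poly_Mapping.lookup ?s m"
  proof (cases "m \<in> monomials r 1")
    case True
    then obtain i where "i \<le> r" "m = Poly_Mapping.single i 1" using linear_monomial by blast
    then show ?thesis
      by (simp add: lookup_sum lookup_smul lookup_var[unfolded One_nat_def] if_distrib cong: if_cong)
  next
    case False
    have "?s \<in> Rn r 1" using Rn_var pm.subspace_scale[OF Rn_subspace] by (intro pm.subspace_sum[OF Rn_subspace]) blast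
    then have "m \<notin> Poly_Mapping.keys h" "m \<notin> Poly_Mapping.keys ?s"
      using False h unfolding Rn_monomials by blast+
    then show ?thesis by (simp add: in_keys_iff)
  qed
qed

lemma eval_poly_linear:
  assumes F: "F \<in> Rn r 1"
  shows "eval_poly a F = (\<Sum>j\<le>r. Poly_Mapping.lookup F (Poly_Mapping.single j 1) * a j)"
proof -
  let ?X = "\<lambda>j::nat. Poly_Mapping.single j (1::nat)"
  have K: "Poly_Mapping.keys F \<subseteq> ?X ` {..r}" using F linear_monomial unfolding Rn_monomials by blast
  have inj: "inj_on ?X {..r}"
    by (rule inj_onI) (metis lookup_single_eq lookup_single_not_eq zero_neq_one)
  have "eval_poly a F = (\<Sum>m\<in>?X ` {..r}. Poly_Mapping.lookup F m * (\<Prod>i\<in>Poly_Mapping.keys m. a i ^ Poly_Mapping.lookup m i))"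
    unfolding eval_poly_def by (rule sum.mono_neutral_left) (use K in \<open>auto simp: in_keys_iff\<close>)
  then show ?thesis by (simp add: sum.reindex[OF inj, unfolded One_nat_def])
qed

text \<open>One coordinate of a projection with kernel \<open>P\<close> is a linear functional on
  linear forms that vanishes on \<open>P\<close> but not on some variable; \<open>F\<close> encodes
  it as a linear polynomial in the coefficients of \<open>h\<close>.\<close>

lemma open_condition_outside:
  assumes P: "homogeneous_ideal r P" "saturation r P = P" "1 \<notin> P"
  obtains F where "F \<in> Rn r 1" "F \<noteq> 0"
    "\<And>h. h \<in> Rn r 1 \<Longrightarrow> eval_poly (\<lambda>i. Poly_Mapping.lookup h (Poly_Mapping.single i 1)) F \<noteq> 0 \<Longrightarrow> h \<notin> P"
proof -
  have "\<exists>i\<le>r. var i \<notin> P"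
  proof (rule ccontr)
    assume "\<not> ?thesis"
    then have "1 \<in> saturation r P" by (intro saturationI[OF P(1) Rg_one] exI[of _ 1]) simp
    then show False using P by simp
  qed
  then obtain i where i: "i \<le> r" "var i \<notin> P" by blast
  obtain p :: "cpoly \<Rightarrow> cpoly" where p: "Vector_Spaces.linear smul smul p" "\<And>v. p v = 0 \<longleftrightarrow> v \<in> P"
    by (rule pm.exists_projection[OF hi_subspace[OF P(1)]]) (rule that)
  interpret p: Vector_Spaces.linear smul smul p by (rule p(1))
  have "p (var i) \<noteq> 0" using p(2)[of "var i"] i by simp
  then obtain m where m: "Poly_Mapping.lookup (p (var i)) m \<noteq> 0" by (metis poly_mapping_eqI lookup_zero)
  define F where "F = (\<Sum>j\<le>r. smul (Poly_Mapping.lookup (p (var j)) m) (var j))"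
  have lF: "Poly_Mapping.lookup F (Poly_Mapping.single j 1) = Poly_Mapping.lookup (p (var j)) m" if "j \<le> r" for j
    using that by (simp add: F_def lookup_sum lookup_smul lookup_var[unfolded One_nat_def] if_distrib cong: if_cong)
  have FR: "F \<in> Rn r 1"
    unfolding F_def using Rn_var pm.subspace_scale[OF Rn_subspace] by (intro pm.subspace_sum[OF Rn_subspace]) blast
  have F0: "F \<noteq> 0" using lF[OF i(1)] m by auto
  have "h \<notin> P" if h: "h \<in> Rn r 1" and e: "eval_poly (\<lambda>i. Poly_Mapping.lookup h (Poly_Mapping.single i 1)) F \<noteq> 0" for h
  proof
    assume "h \<in> P"
    then have "0 = Poly_Mapping.lookup (p h) m" using p(2)[of h] by simp
    also have "p h = (\<Sum>j\<le>r. smul (Poly_Mapping.lookup h (Poly_Mapping.single j 1)) (p (var j)))"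
      by (subst linear_form_eq[OF h]) (simp add: p.sum p.scale)
    also have "Poly_Mapping.lookup \<dots> m = eval_poly (\<lambda>i. Poly_Mapping.lookup h (Poly_Mapping.single i 1)) F"
      unfolding eval_poly_linear[OF FR] lookup_sum lookup_smul by (intro sum.cong) (simp_all add: lF[unfolded One_nat_def])
    finally show False using e by simp
  qed
  then show thesis using that FR F0 by blast
qed

section \<open>Two nonempty open sets of hyperplanes meet\<close>

lemma digits_unique:
  fixes f g :: "nat \<Rightarrow> nat"
  assumes "\<And>i. i < n \<Longrightarrow> f i < B" "\<And>i. i < n \<Longrightarrow> g i < B" "(\<Sum>i<n. B ^ i * f i) = (\<Sum>i<n. B ^ i * g i)"
  shows "i < n \<Longrightarrow> f i = g i"
  using assms
proof (induction n arbitrary: f g i)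
  case (Suc n)
  have split: "(\<Sum>i<Suc n. B ^ i * f i) = f 0 + B * (\<Sum>i<n. B ^ i * f (Suc i))" for f
    by (simp add: sum.lessThan_Suc_shift sum_distrib_left mult.assoc del: sum.lessThan_Suc)
  have eq: "f 0 + B * (\<Sum>i<n. B ^ i * f (Suc i)) = g 0 + B * (\<Sum>i<n. B ^ i * g (Suc i))"
    using Suc.prems(4) unfolding split .
  have b: "f 0 < B" "g 0 < B" using Suc.prems(2,3) by auto
  have "f 0 = g 0" using arg_cong[OF eq, of "\<lambda>x. x mod B"] b by simp
  moreover have "(\<Sum>i<n. B ^ i * f (Suc i)) = (\<Sum>i<n. B ^ i * g (Suc i))"
    using eq b calculation by simp
  then have "f (Suc j) = g (Suc j)" if "j < n" for j
    using Suc.IH[of j "\<lambda>i. f (Suc i)" "\<lambda>i. g (Suc i)"] Suc.prems(2,3) that by simp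
  ultimately show ?case using Suc.prems(1) by (cases i) auto
qed simp

text \<open>Kronecker substitution: on the curve \<open>\<tau> \<mapsto> (\<tau>\<^bsup>B\<^sup>i\<^esup>)\<^sub>i\<close> distinct monomials have distinct exponents.\<close>

lemma kronecker_substitution:
  assumes F: "F \<in> Rg r" "F \<noteq> 0" and B: "\<And>m i. m \<in> Poly_Mapping.keys F \<Longrightarrow> Poly_Mapping.lookup m i < B"
  obtains q :: "complex poly" where "q \<noteq> 0" "\<And>t. poly q t = eval_poly (\<lambda>i. t ^ (B ^ i)) F"
proof -
  define w where "w m = (\<Sum>i<Suc r. B ^ i * Poly_Mapping.lookup m i)" for m :: "nat \<Rightarrow>\<^sub>0 nat"
  define q where "q = (\<Sum>m\<in>Poly_Mapping.keys F. monom (Poly_Mapping.lookup F m) (w m))"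
  have K: "Poly_Mapping.keys m \<subseteq> {..r}" if "m \<in> Poly_Mapping.keys F" for m using F(1) that by (simp add: Rg_iff)
  have w_inj: "m = m'" if m: "m \<in> Poly_Mapping.keys F" "m' \<in> Poly_Mapping.keys F" "w m = w m'" for m m'
  proof (rule poly_mapping_eqI)
    fix i
    show "Poly_Mapping.lookup m i = Poly_Mapping.lookup m' i"
    proof (cases "i < Suc r")
      case True
      then show ?thesis
        using digits_unique[of "Suc r" "Poly_Mapping.lookup m" B "Poly_Mapping.lookup m'" i] B m unfolding w_def by blast
    next
      case False
      then show ?thesis using K[OF m(1)] K[OF m(2)] by (metis atMost_iff in_keys_iff less_Suc_eq_le subsetD)
    qed
  qed
  obtain m where m: "m \<in> Poly_Mapping.keys F" using F(2) by (metis equals0I keys_eq_empty)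
  have "coeff q (w m) = (\<Sum>m'\<in>Poly_Mapping.keys F. if m' = m then Poly_Mapping.lookup F m' else 0)"
    unfolding q_def coeff_sum using w_inj m by (intro sum.cong) auto
  then have "coeff q (w m) = Poly_Mapping.lookup F m" using m by simp
  then have "q \<noteq> 0" using m by (auto simp: in_keys_iff)
  moreover have "poly q t = eval_poly (\<lambda>i. t ^ (B ^ i)) F" for t
  proof -
    have "(\<Prod>i\<in>Poly_Mapping.keys m. (t ^ B ^ i) ^ Poly_Mapping.lookup m i) = t ^ w m" if "m \<in> Poly_Mapping.keys F" for m
    proof -
      have "(\<Prod>i\<in>Poly_Mapping.keys m. (t ^ B ^ i) ^ Poly_Mapping.lookup m i) = (\<Prod>i<Suc r. (t ^ B ^ i) ^ Poly_Mapping.lookup m i)"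
        by (rule prod.mono_neutral_left) (use K[OF that] in \<open>auto simp: in_keys_iff less_Suc_eq_le\<close>)
      then show ?thesis by (simp only: w_def power_sum power_mult)
    qed
    then show ?thesis by (simp add: q_def poly_sum poly_monom eval_poly_def)
  qed
  ultimately show thesis by (rule that)
qed

text \<open>Restricted to one monomial curve, whose base \<open>B\<close> exceeds all exponents in
  \<open>F\<close> and \<open>G\<close>, both become nonzero polynomials in one variable; some
  parameter avoids their roots.\<close>

lemma exists_common_hyperplane:
  assumes F: "F \<in> Rg r" "F \<noteq> 0" and G: "G \<in> Rg r" "G \<noteq> 0"
  obtains h where "h \<in> Rn r 1" "h \<noteq> 0"
    "eval_poly (\<lambda>i. Poly_Mapping.lookup h (Poly_Mapping.single i 1)) F \<noteq> 0"
    "eval_poly (\<lambda>i. Poly_Mapping.lookup h (Poly_Mapping.single i 1)) G \<noteq> 0"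
proof -
  define A where "A = (\<Union>m\<in>Poly_Mapping.keys F \<union> Poly_Mapping.keys G. Poly_Mapping.lookup m ` Poly_Mapping.keys m)"
  define B where "B = Suc (Max (insert 0 A))"
  have "finite A" by (auto simp: A_def)
  have B: "Poly_Mapping.lookup m i < B" if "m \<in> Poly_Mapping.keys F \<union> Poly_Mapping.keys G" for m i
  proof (cases "i \<in> Poly_Mapping.keys m")
    case True
    then have "Poly_Mapping.lookup m i \<in> A" using that by (auto simp: A_def)
    then show ?thesis using Max_ge[of "insert 0 A"] \<open>finite A\<close> by (simp add: B_def less_Suc_eq_le)
  qed (simp add: B_def in_keys_iff)
  obtain q where q: "q \<noteq> 0" "\<And>t. poly q t = eval_poly (\<lambda>i. t ^ (B ^ i)) F"
    using kronecker_substitution[OF F, of B] B by blast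
  obtain q' where q': "q' \<noteq> 0" "\<And>t. poly q' t = eval_poly (\<lambda>i. t ^ (B ^ i)) G"
    using kronecker_substitution[OF G, of B] B by blast
  \<comment> \<open>The factor \<open>[:0, 1:]\<close> excludes \<open>t = 0\<close>, so that the
    linear form is nonzero.\<close>
  have "finite {t. poly (q * q' * [:0, 1:]) t = 0}" using q(1) q'(1) by (intro poly_roots_finite) simp
  then obtain t where t: "poly (q * q' * [:0, 1:]) t \<noteq> 0" using ex_new_if_finite[OF infinite_UNIV_char_0] by blast
  define h where "h = (\<Sum>i\<le>r. smul (t ^ (B ^ i)) (var i))"
  have lh: "Poly_Mapping.lookup h (Poly_Mapping.single i 1) = t ^ (B ^ i)" if "i \<le> r" for i
    using that by (simp add: h_def lookup_sum lookup_smul lookup_var[unfolded One_nat_def] if_distrib cong: if_cong)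
  have ev: "eval_poly (\<lambda>i. Poly_Mapping.lookup h (Poly_Mapping.single i 1)) f = eval_poly (\<lambda>i. t ^ (B ^ i)) f" if "f \<in> Rg r" for f
    unfolding eval_poly_def
  proof (intro sum.cong refl arg_cong2[of _ _ _ _ "(*)"] prod.cong arg_cong2[of _ _ _ _ "(^)"])
    fix m i assume "m \<in> Poly_Mapping.keys f" "i \<in> Poly_Mapping.keys m"
    then have "i \<le> r" using that by (auto simp: Rg_iff)
    then show "Poly_Mapping.lookup h (Poly_Mapping.single i 1) = t ^ (B ^ i)" by (rule lh)
  qed
  show thesis
  proof (rule that)
    show "h \<in> Rn r 1"
      unfolding h_def using Rn_var pm.subspace_scale[OF Rn_subspace] by (intro pm.subspace_sum[OF Rn_subspace]) blast
    show "h \<noteq> 0" using lh[of 0] t by auto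
  qed (use ev[OF F(1)] ev[OF G(1)] q(2)[of t] q'(2)[of t] t in auto)
qed

section \<open>The genus of hyperplane sections\<close>

lemma hypersurface_section_eq:
  assumes I: "homogeneous_ideal r I" and h: "h \<in> Rg r"
  shows "hypersurface_section r I h = saturation r (adj r I h)"
proof -
  have "I <+>\<^bsub>coord_ring r\<^esub> PIdl\<^bsub>coord_ring r\<^esub> h = adj r I h"
    by (auto simp: set_add_def' cgenideal_def coord_ring_simps adj_def set_plus_def elt_set_times_def mult.commute)
  then show ?thesis by (simp add: hypersurface_section_def)
qed

lemma arithmetic_genus_HP: "homogeneous_ideal r I \<Longrightarrow> real_of_int (arithmetic_genus r I) = 1 - poly (HP r I) 0"
  by (simp add: arithmetic_genus_def hilbert_polynomial_props(2))

text \<open>The exact sequence makes the Hilbert polynomial of the section a difference of that of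
  \<open>P\<close>, and saturation leaves it alone; so the genus is the same for every hyperplane
  not containing the subscheme.\<close>

lemma arithmetic_genus_section:
  assumes P: "integral_subscheme r P" and h: "h \<in> Rn r 1" "h \<notin> P"
  shows "real_of_int (arithmetic_genus r (hypersurface_section r P h)) = 1 - (poly (HP r P) 0 - poly (HP r P) (- 1))"
proof -
  note hP = integral_subschemeD(1)[OF P]
  have hR: "h \<in> Rg r" using h by blast
  have h0: "h \<noteq> 0" using h hi_zero[OF hP] by blast
  have A: "homogeneous_ideal r (adj r P h)" by (rule adj_hi[OF hP h(1)])
  obtain n0 where n0: "\<forall>n\<ge>n0. hf r (saturation r (adj r P h)) n = hf r (adj r P h) n"
    using hf_saturation_eventually[OF A] by blast
  have "HP r (saturation r (adj r P h)) = HP r (adj r P h)"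
  proof (rule hilbert_polynomial_eqI[OF saturation_hi[OF A]])
    show "\<forall>\<^sub>F t in sequentially. poly (HP r (adj r P h)) (real t) = real (hf r (saturation r (adj r P h)) t)"
      using HP_eventually[OF A] eventually_ge_at_top[of n0] by eventually_elim (use n0 in simp)
  qed
  moreover have "HP r P = pcompose (HP r P) [:- 1, 1:] + HP r (adj r P h)"
    using HP_exact[OF hP h(1) h0] prime_colon[OF P hR h(2)] by simp
  then have "poly (HP r P) 0 = poly (HP r P) (- 1) + poly (HP r (adj r P h)) 0"
    by (metis poly_add poly_pcompose poly_pCons poly_0 mult_zero_left add.right_neutral)
  ultimately show ?thesis
    by (simp add: hypersurface_section_eq[OF hP hR] arithmetic_genus_HP[OF saturation_hi[OF A]])
qed

lemma sectional_genus_eq: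
  assumes P: "integral_subscheme r P"
  shows "real_of_int (sectional_genus r P) = 1 - (poly (HP r P) 0 - poly (HP r P) (- 1))"
proof -
  let ?Q = "\<lambda>g h. arithmetic_genus r (hypersurface_section r P h) = g"
  define c where "c = 1 - (poly (HP r P) 0 - poly (HP r P) (- 1))"
  \<comment> \<open>The genus is an integer, so \<open>c\<close> equals its floor as soon as one
    hyperplane outside \<open>P\<close> is at hand.\<close>
  have val: "?Q \<lfloor>c\<rfloor> h" "real_of_int \<lfloor>c\<rfloor> = c" if "h \<in> Rn r 1" "h \<notin> P" for h
    using arithmetic_genus_section[OF P that] unfolding c_def by (metis floor_of_int)+
  obtain F where F: "F \<in> Rn r 1" "F \<noteq> 0"
    "\<And>h. h \<in> Rn r 1 \<Longrightarrow> eval_poly (\<lambda>i. Poly_Mapping.lookup h (Poly_Mapping.single i 1)) F \<noteq> 0 \<Longrightarrow> h \<notin> P"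
    using open_condition_outside[OF integral_subschemeD(1-3)[OF P]] by blast
  have FR: "F \<in> Rg r" using F(1) by blast
  obtain h where "h \<in> Rn r 1" "eval_poly (\<lambda>i. Poly_Mapping.lookup h (Poly_Mapping.single i 1)) F \<noteq> 0"
    using exists_common_hyperplane[OF FR F(2) FR F(2)] by blast
  then have c: "real_of_int \<lfloor>c\<rfloor> = c" using val(2) F(3) by blast
  have "sectional_genus r P = \<lfloor>c\<rfloor>"
    unfolding sectional_genus_def
  proof (rule the_equality)
    show "general_hyperplane r (?Q \<lfloor>c\<rfloor>)"
      unfolding general_hyperplane_def using F val(1) by blast
  next
    fix g assume "general_hyperplane r (?Q g)"
    then obtain G t where G: "G \<in> Rn r t" "G \<noteq> 0"
      "\<And>h. h \<in> Rn r 1 \<Longrightarrow> h \<noteq> 0 \<Longrightarrow> eval_poly (\<lambda>i. Poly_Mapping.lookup h (Poly_Mapping.single i 1)) G \<noteq> 0 \<Longrightarrow> ?Q g h"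
      unfolding general_hyperplane_def by blast
    have GR: "G \<in> Rg r" using G(1) by blast
    obtain h where h: "h \<in> Rn r 1" "h \<noteq> 0"
        "eval_poly (\<lambda>i. Poly_Mapping.lookup h (Poly_Mapping.single i 1)) F \<noteq> 0"
        "eval_poly (\<lambda>i. Poly_Mapping.lookup h (Poly_Mapping.single i 1)) G \<noteq> 0"
      using exists_common_hyperplane[OF FR F(2) GR G(2)] by blast
    show "g = \<lfloor>c\<rfloor>" using G(3)[OF h(1,2,4)] val(1)[OF h(1) F(3)[OF h(1,3)]] by simp
  qed
  then show ?thesis using c unfolding c_def by simp
qed

lemma subscheme_dim_HP:
  assumes I: "homogeneous_ideal r I" and dim: "subscheme_dim r I = enat n" and n: "0 < n"
  shows "HP r I \<noteq> 0" "degree (HP r I) = n"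
  using dim n unfolding subscheme_dim_eq[OF I] by (auto split: if_splits simp: zero_enat_def)

theorem proposition2p6:
  fixes r :: nat and I\<^sub>S I\<^sub>C :: "cpoly set" and s d :: real and \<pi> :: int
  assumes "integral_subscheme r I\<^sub>S" and "subscheme_dim r I\<^sub>S = 2"
    and "subscheme_degree r I\<^sub>S = s" and "sectional_genus r I\<^sub>S = \<pi>"
    and "closed_subscheme r I\<^sub>C" and "subscheme_dim r I\<^sub>C = 1"
    and "I\<^sub>S \<subseteq> I\<^sub>C"
    and "subscheme_degree r I\<^sub>C = d" and "d > 0"
  shows "real_of_int (arithmetic_genus r I\<^sub>C)
           \<le> d\<^sup>2 / (2 * s) + d / (2 * s) * (2 * real_of_int \<pi> - 2 - s) + s ^ 4"
proof -
  note S = integral_subschemeD(1)[OF assms(1)]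
  have C: "homogeneous_ideal r I\<^sub>C" "saturation r I\<^sub>C = I\<^sub>C" using assms(5) by (auto simp: closed_subscheme_def)
  have dS: "HP r I\<^sub>S \<noteq> 0" "degree (HP r I\<^sub>S) = 2"
    using subscheme_dim_HP[OF S, of 2] assms(2) by (auto simp: numeral_eq_enat)
  have dC: "HP r I\<^sub>C \<noteq> 0" "degree (HP r I\<^sub>C) = 1"
    using subscheme_dim_HP[OF C(1), of 1] assms(6) by (auto simp: one_enat_def)
  obtain a b c where HS: "HP r I\<^sub>S = [:c, b, a:]" "a \<noteq> 0"
    using degree2_coeffs[OF dS(2)] by blast
  obtain u v where HC: "HP r I\<^sub>C = [:v, u:]" "u \<noteq> 0"
    using degree1_coeffs[OF dC(2)] by blast
  have s: "s = 2 * a" using assms(3) HS by (simp add: subscheme_degree_def)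
  have d: "d = u" using assms(8) HC by (simp add: subscheme_degree_def)
  have "0 < lead_coeff (HP r I\<^sub>S)" by (rule lead_coeff_pos[OF dS(1) HP_nonneg[OF S]])
  then have s0: "0 < s" using HS by (simp add: s)
  \<comment> \<open>For the polynomial \<open>c + b t + a t^2\<close>, the values at 0 and at
    \<open>- 1\<close> differ by \<open>b - a\<close>.\<close>
  have pi: "real_of_int \<pi> = 1 - b + a"
    using sectional_genus_eq[OF assms(1)] HS assms(4) by (simp add: algebra_simps)
  have pa: "real_of_int (arithmetic_genus r I\<^sub>C) = 1 - v"
    using arithmetic_genus_HP[OF C(1)] HC by simp
  obtain nS where nS: "\<And>n. nS \<le> n \<Longrightarrow> real (hf r I\<^sub>S n) = c + b * real n + a * (real n)\<^sup>2"
  proof -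
    obtain N where "\<forall>n\<ge>N. poly (HP r I\<^sub>S) (real n) = real (hf r I\<^sub>S n)"
      using HP_eventually[OF S] unfolding eventually_sequentially by blast
    then show thesis using HS by (intro that[of N]) (simp add: power2_eq_square algebra_simps)
  qed
  obtain nC where nC: "\<And>n. nC \<le> n \<Longrightarrow> real (hf r I\<^sub>C n) = v + u * real n"
  proof -
    obtain N where "\<forall>n\<ge>N. poly (HP r I\<^sub>C) (real n) = real (hf r I\<^sub>C n)"
      using HP_eventually[OF C(1)] unfolding eventually_sequentially by blast
    then show thesis using HC by (intro that[of N]) (simp add: algebra_simps)
  qed
  \<comment> \<open>\<open>d\<close> is a first difference and \<open>s\<close> a second difference
    of Hilbert functions, so both are integers.\<close>
  have "real_of_int (int (hf r I\<^sub>C (Suc nC)) - int (hf r I\<^sub>C nC)) = d"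
    using nC[of nC] nC[of "Suc nC"] by (simp add: d algebra_simps)
  then obtain d' where d': "d = real d'" using assms(9) by (metis of_int_0_less_iff of_int_of_nat_eq zero_less_imp_eq_int)
  have "real_of_int (int (hf r I\<^sub>S (Suc (Suc nS))) - 2 * int (hf r I\<^sub>S (Suc nS)) + int (hf r I\<^sub>S nS)) = s"
    using nS[of nS] nS[of "Suc nS"] nS[of "Suc (Suc nS)"] by (simp add: s power2_eq_square algebra_simps)
  then obtain s' where s': "s = real s'" using s0 by (metis of_int_0_less_iff of_int_of_nat_eq zero_less_imp_eq_int)
  have hS: "int (hf r I\<^sub>S (Suc n)) = int (hf r I\<^sub>S n) + int s' * int (Suc n) + 1 - \<pi>" if n: "max nS nC \<le> n" for n
  proof -
    have "real_of_int (int (hf r I\<^sub>S (Suc n))) = real_of_int (int (hf r I\<^sub>S n) + int s' * int (Suc n) + 1 - \<pi>)"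
      using nS[of n] nS[of "Suc n"] n s by (simp add: pi flip: s') (simp add: s power2_eq_square algebra_simps)
    then show ?thesis by (simp only: of_int_eq_iff)
  qed
  have hC: "int (hf r I\<^sub>C n) = int d' * int n + 1 - arithmetic_genus r I\<^sub>C" if n: "max nS nC \<le> n" for n
  proof -
    have "real_of_int (int (hf r I\<^sub>C n)) = real_of_int (int d' * int n + 1 - arithmetic_genus r I\<^sub>C)"
      using nC[of n] n by (simp add: pa d flip: d')
    then show ?thesis by (simp only: of_int_eq_iff)
  qed
  show ?thesis
    unfolding s' d'
    by (rule genus_bound[OF assms(1) C assms(7), of "max nS nC"];
        (erule hS | erule hC | use s0 s' assms(9) d' in simp))
qed

end
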